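(* Let $A\in\mathbb{R}^{d\times d}$ be a nonzero matrix, let $B\in\mathbb{R}^{d\times d}$, and let $(L_t)_{t\ge 0}$ be a pure jump Lévy process in $\mathbb{R}^d$ whose Lévy measure satisfies assumption (N) of the context. Suppose there exists $n\in\mathbb{N}$ such that $$\operatorname{rank}[B,AB,\dots,A^nB]=d.$$ For $x\in\mathbb{R}^d$ let $X_t(x)$ be the solution of $$\mathrm{d}X_t=AX_t\,\mathrm{d}t+B\,\mathrm{d}L_t,\qquad X_0=x.$$ Then for all $t>0$ (and every $x\in\mathbb{R}^d$) the transition probability $P_t(x,\cdot)$, i.e. the law of $X_t(x)$, has a smooth ($C^\infty$) density with respect to Lebesgue measure on $\mathbb{R}^d$.
   Context: Write $\mathbb{R}^d_0=\mathbb{R}^d\setminus\{0\}$ and $\mathbb{R}^+=[0,\infty)$. The process $L$ has càdlàg paths and is given by $$L_t=\int_0^t\int_{|z|\le 1} z\,\tilde N(\mathrm{d}z,\mathrm{d}s)+\int_0^t\int_{|z|>1} z\,N(\mathrm{d}z,\mathrm{d}s),$$ where $N$ is a Poisson random measure on $\mathbb{R}^d_0\times\mathbb{R}^+$ with intensity $\nu(\mathrm{d}z)\,\mathrm{d}s$, $\tilde N(\mathrm{d}z,\mathrm{d}s)=N(\mathrm{d}z,\mathrm{d}s)-\nu(\mathrm{d}z)\,\mathrm{d}s$, and $\nu$ is a Lévy measure: $\nu(\{0\})=0$ and $\int_{\mathbb{R}^d_0}(1\wedge|z|^2)\,\nu(\mathrm{d}z)<\infty$. Assumption (N): $\nu$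 has a density $\rho\in C^1(\mathbb{R}^d_0,\mathbb{R}^+)$ and there exists $\alpha\in(0,2)$ such that $\rho(z)=\vartheta(z)/|z|^{d+\alpha}$ for all $z$ with $0<|z|<1$, where $\vartheta:\{0<|z|<1\}\to\mathbb{R}^+$ is a bounded $C^1$ function such that, for some constants $C>c>0$, $c\le|\nabla\vartheta(z)|\le C$ and $c\le\vartheta(z)\le C$ for all $0<|z|<1$. $[B,AB,\dots,A^nB]$ denotes the $d\times (n+1)d$ matrix obtained by concatenating the listed matrices. *)

theory Defs
  imports "HOL-Probability.Probability"
begin

section \<open>Smoothness and gradients\<close>

text \<open>
  Functions are total, so \<open>C\<^sup>k\<close> on \<open>S\<close> is meant for open \<open>S\<close>; values off \<open>S\<close> are irrelevant.
  \<open>frechet_derivative f (at x) v\<close> is the derivative of \<open>f\<close> at \<open>x\<close> in direction \<open>v\<close>.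
\<close>

primrec Ck_on :: "nat \<Rightarrow> 'a::real_normed_vector set \<Rightarrow> ('a \<Rightarrow> 'b::real_normed_vector) \<Rightarrow> bool" where
  "Ck_on 0 S f \<longleftrightarrow> continuous_on S f"
| "Ck_on (Suc k) S f \<longleftrightarrow>
     (\<forall>x\<in>S. f differentiable (at x)) \<and> (\<forall>v. Ck_on k S (\<lambda>x. frechet_derivative f (at x) v))"

definition smooth_on :: "'a::real_normed_vector set \<Rightarrow> ('a \<Rightarrow> 'b::real_normed_vector) \<Rightarrow> bool" where
  "smooth_on S f \<longleftrightarrow> (\<forall>k. Ck_on k S f)"

definition grad :: "(real ^ 'd \<Rightarrow> real) \<Rightarrow> real ^ 'd \<Rightarrow> real ^ 'd" where
  "grad f z = (\<chi> i. frechet_derivative f (at z) (axis i 1))"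


section \<open>The rank of a row of blocks\<close>

text \<open>
  The matrix \<open>[M 0, \<dots>, M n]\<close> has \<open>(n+1)\<close> times as many columns as each block, a number that cannot
  be the cardinality of an index type while \<open>n\<close> is a bound variable.  Its rank is therefore written
  out as the dimension of the space spanned by its columns, which are the columns of all the blocks.
  The lemma below confirms that it is the library's \<open>rank\<close> of the concatenated matrix
  whenever the block indices \<open>0, \<dots>, n\<close> are represented by a finite type.
\<close>

definition concat_rank :: "nat \<Rightarrow> (nat \<Rightarrow> real ^ 'c ^ 'r) \<Rightarrow> nat" where
  "concat_rank n M = dim (\<Union>k\<in>{..n}. columns (M k))"

lemma concat_rank_eq_rank:
  fixes e :: "'k::finite \<Rightarrow> nat" and M :: "nat \<Rightarrow> real ^ 'c ^ 'r"
  assumes "bij_betw e UNIV {..n}"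
  shows "concat_rank n M = rank ((\<chi> i p. M (e (fst p)) $ i $ snd p) :: real ^ ('k \<times> 'c) ^ 'r)"
proof -
  have e: "{..n} = range e"
    using assms by (auto simp: bij_betw_def)
  have "columns ((\<chi> i p. M (e (fst p)) $ i $ snd p) :: real ^ ('k \<times> 'c) ^ 'r)
      = (\<Union>k\<in>{..n}. columns (M k))"
    unfolding e by (auto simp: columns_def column_def)
  then show ?thesis
    by (simp add: concat_rank_def column_rank_def)
qed

text \<open>
  \<open>A\<^sup>k B\<close> for the matrix product.  The operator \<open>^\<close> on \<open>real ^ 'd ^ 'd\<close> would be
  the componentwise power.
\<close>

definition pow_mult :: "real ^ 'd ^ 'd \<Rightarrow> real ^ 'd ^ 'd \<Rightarrow> nat \<Rightarrow> real ^ 'd ^ 'd" where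
  "pow_mult A B k = (((**) A) ^^ k) B"


section \<open>Poisson random measures\<close>

text \<open>
  \<open>N\<close> is a random measure on the measurable space underlying its intensity \<open>\<mu>\<close>.
\<close>

definition poisson_random_measure ::
    "'w measure \<Rightarrow> 'e measure \<Rightarrow> ('w \<Rightarrow> 'e measure) \<Rightarrow> bool" where
  "poisson_random_measure M \<mu> N \<longleftrightarrow>
     (\<forall>\<omega>\<in>space M. sets (N \<omega>) = sets \<mu>) \<and>
     (\<forall>S\<in>sets \<mu>. (\<lambda>\<omega>. emeasure (N \<omega>) S) \<in> borel_measurable M) \<and>
     (\<forall>S\<in>sets \<mu>. emeasure \<mu> S < \<infinity> \<longrightarrow>
        (\<forall>k::nat. measure M {\<omega>\<in>space M. emeasure (N \<omega>) S = of_nat k} =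
           measure \<mu> S ^ k / fact k * exp (- measure \<mu> S))) \<and>
     (\<forall>S\<in>sets \<mu>. emeasure \<mu> S = \<infinity> \<longrightarrow> (AE \<omega> in M. emeasure (N \<omega>) S = \<infinity>)) \<and>
     (\<forall>F. finite F \<longrightarrow> F \<subseteq> sets \<mu> \<longrightarrow> disjoint F \<longrightarrow>
        prob_space.indep_vars M (\<lambda>_. borel) (\<lambda>S \<omega>. emeasure (N \<omega>) S) F)"


section \<open>Pure jump L\'evy processes\<close>

definition levy_measure :: "(real ^ 'd) measure \<Rightarrow> bool" where
  "levy_measure \<nu> \<longleftrightarrow>
     sets \<nu> = sets borel \<and> emeasure \<nu> {0} = 0 \<and>
     (\<integral>\<^sup>+ z. ennreal (min 1 ((norm z)\<^sup>2)) \<partial>\<nu>) < \<infinity>"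

definition jump_intensity :: "(real ^ 'd) measure \<Rightarrow> ((real ^ 'd) \<times> real) measure" where
  "jump_intensity \<nu> = restrict_space \<nu> (- {0}) \<Otimes>\<^sub>M restrict_space lborel {0..}"

definition large_jumps :: "('w \<Rightarrow> ((real ^ 'd) \<times> real) measure) \<Rightarrow> real \<Rightarrow> 'w \<Rightarrow> real ^ 'd" where
  "large_jumps N t \<omega> = (LINT p:{(z, s). 1 < norm z \<and> 0 < s \<and> s \<le> t} | N \<omega>. fst p)"

definition truncated_small_jumps ::
    "(real ^ 'd) measure \<Rightarrow> ('w \<Rightarrow> ((real ^ 'd) \<times> real) measure) \<Rightarrow> real \<Rightarrow> real \<Rightarrow> 'w \<Rightarrow> real ^ 'd" where
  "truncated_small_jumps \<nu> N \<epsilon> t \<omega> =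
     (LINT p:{(z, s). \<epsilon> < norm z \<and> norm z \<le> 1 \<and> 0 < s \<and> s \<le> t} | N \<omega>. fst p) -
     (LINT p:{(z, s). \<epsilon> < norm z \<and> norm z \<le> 1 \<and> 0 < s \<and> s \<le> t} | jump_intensity \<nu>. fst p)"

text \<open>
  The integral of \<open>z\<close> over \<open>{|z| \<le> 1} \<times> (0, t]\<close> against the compensated measure is in general not
  a pathwise integral; as usual it is the limit in \<open>L\<^sup>2\<close> of the truncations to \<open>\<epsilon> < |z| \<le> 1\<close>,
  which determines it up to almost sure equality.
\<close>

definition is_compensated_small_jumps ::
    "'w measure \<Rightarrow> (real ^ 'd) measure \<Rightarrow> ('w \<Rightarrow> ((real ^ 'd) \<times> real) measure) \<Rightarrow> real \<Rightarrow>
     ('w \<Rightarrow> real ^ 'd) \<Rightarrow> bool" where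
  "is_compensated_small_jumps M \<nu> N t J \<longleftrightarrow>
     J \<in> borel_measurable M \<and>
     ((\<lambda>\<epsilon>. \<integral>\<^sup>+ \<omega>. ennreal ((norm (truncated_small_jumps \<nu> N \<epsilon> t \<omega> - J \<omega>))\<^sup>2) \<partial>M) \<longlongrightarrow> 0)
       (at_right 0)"

definition cadlag :: "(real \<Rightarrow> 'a::topological_space) \<Rightarrow> bool" where
  "cadlag f \<longleftrightarrow>
     (\<forall>t\<ge>0. (f \<longlongrightarrow> f t) (at_right t)) \<and> (\<forall>t>0. \<exists>l. (f \<longlongrightarrow> l) (at_left t))"

definition pure_jump_levy_process ::
    "'w measure \<Rightarrow> (real ^ 'd) measure \<Rightarrow> (real \<Rightarrow> 'w \<Rightarrow> real ^ 'd) \<Rightarrow> bool" where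
  "pure_jump_levy_process M \<nu> L \<longleftrightarrow>
     prob_space M \<and> levy_measure \<nu> \<and>
     (\<forall>t\<ge>0. L t \<in> borel_measurable M) \<and>
     (AE \<omega> in M. cadlag (\<lambda>t. L t \<omega>)) \<and>
     (\<exists>N. poisson_random_measure M (jump_intensity \<nu>) N \<and>
        (\<forall>t\<ge>0. \<exists>J. is_compensated_small_jumps M \<nu> N t J \<and>
           (AE \<omega> in M. L t \<omega> = J \<omega> + large_jumps N t \<omega>)))"

definition assumption_N :: "(real ^ 'd) measure \<Rightarrow> bool" where
  "assumption_N \<nu> \<longleftrightarrow>
     (\<exists>\<rho> :: real ^ 'd \<Rightarrow> real.
        \<nu> = density lborel (\<lambda>z. ennreal (\<rho> z)) \<and>
        Ck_on 1 (- {0}) \<rho> \<and> (\<forall>z\<in>- {0}. 0 \<le> \<rho> z) \<and>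
        (\<exists>\<alpha> \<theta>. 0 < \<alpha> \<and> \<alpha> < 2 \<and>
           (\<forall>z. 0 < norm z \<and> norm z < 1 \<longrightarrow>
              \<rho> z = \<theta> z / norm z powr (real CARD('d) + \<alpha>)) \<and>
           Ck_on 1 {z. 0 < norm z \<and> norm z < 1} \<theta> \<and>
           (\<exists>c C. 0 < c \<and> c < C \<and>
              (\<forall>z. 0 < norm z \<and> norm z < 1 \<longrightarrow>
                 c \<le> norm (grad \<theta> z) \<and> norm (grad \<theta> z) \<le> C \<and> c \<le> \<theta> z \<and> \<theta> z \<le> C))))"


section \<open>The linear equation\<close>

text \<open>
  \<open>dX = A X dt + B dL\<close>, \<open>X\<^sub>0 = x\<close>, in integrated form; recall \<open>L\<^sub>0 = 0\<close> almost surely.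
\<close>

definition solves_linear_sde ::
    "'w measure \<Rightarrow> real ^ 'd ^ 'd \<Rightarrow> real ^ 'd ^ 'd \<Rightarrow> (real \<Rightarrow> 'w \<Rightarrow> real ^ 'd) \<Rightarrow>
     real ^ 'd \<Rightarrow> (real \<Rightarrow> 'w \<Rightarrow> real ^ 'd) \<Rightarrow> bool" where
  "solves_linear_sde M A B L x X \<longleftrightarrow>
     (\<forall>t\<ge>0. X t \<in> borel_measurable M) \<and>
     (AE \<omega> in M. cadlag (\<lambda>t. X t \<omega>) \<and>
        (\<forall>t\<ge>0. (\<lambda>s. A *v X s \<omega>) integrable_on {0..t} \<and>
           X t \<omega> = x + integral {0..t} (\<lambda>s. A *v X s \<omega>) + B *v L t \<omega>))"

text \<open>A measure on the Borel sets with a \<open>C\<^sup>\<infinity>\<close> density with respect to Lebesgue measure.\<close>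

definition has_smooth_density :: "(real ^ 'd) measure \<Rightarrow> bool" where
  "has_smooth_density P \<longleftrightarrow>
     (\<exists>p. (\<forall>y. 0 \<le> p y) \<and> smooth_on UNIV p \<and> P = density lborel (\<lambda>y. ennreal (p y)))"

end

theory Submission
  imports Defs
begin

text \<open>
  The law of \<open>X\<^sub>t\<close> is studied through its characteristic function \<open>\<phi>\<close>.  It suffices that \<open>\<phi>\<close> decays
  faster than any power: by Fourier inversion the law then has a density, given by an integral that
  may be differentiated arbitrarily often
  (\<open>fourier_inversion_measure\<close>, \<open>Re_fourier_Ck\<close>, \<open>smooth_density_of_rapidly_decreasing_char\<close>).

  By variation of constants, \<open>\<xi> \<bullet> X\<^sub>t\<close> is a constant plus the integral of \<open>B\<^sup>T q\<close> against \<open>L\<close>, where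
  \<open>q s = exp ((t - s) A\<^sup>T) \<xi>\<close>.  Since the jumps of \<open>L\<close> form a Poisson random measure of intensity
  \<open>\<nu> (dz) ds\<close>, the Levy-Khinchin formula gives formally
  \<open>\<bar>\<phi> \<xi>\<bar> = exp (- \<integral>\<^sub>0\<^sup>t \<integral> (1 - cos (B\<^sup>T q s \<bullet> z)) \<nu> (dz) ds)\<close>.
  Only an upper bound is established, and jumps outside a well chosen set \<open>E\<close> of sizes and times may be
  dropped because their contribution to the exponent has the right sign.  This avoids
  stochastic integration altogether: the integral is a pathwise limit of Riemann sums
  (\<open>linear_ode_discretization\<close>); a Riemann sum is a linear combination of values of \<open>L\<close>, and such
  a combination is a limit of integrals of bounded functions over sets of finite intensity,
  for which the formula is elementary (\<open>char_integral\<close>).  The bound only involves \<open>E\<close>, so it is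
  preserved by all these limits (\<open>char_linear_combination_levy\<close>).

  The set \<open>E\<close> comes from the two hypotheses.  The rank condition says that \<open>B\<^sup>T (A\<^sup>T)\<^sup>k \<xi>\<close> is nonzero for
  some \<open>k\<close>, so \<open>B\<^sup>T q\<close> does not vanish identically; by compactness of the unit sphere there are
  \<open>\<kappa>\<close> and \<open>\<tau>\<close> such that, for every \<open>\<xi>\<close>, the vector \<open>B\<^sup>T q\<close> stays close to some \<open>w\<close> with
  \<open>norm w \<ge> \<kappa> norm \<xi>\<close> during a time \<open>\<tau> / 2\<close> (\<open>linear_flow_observable\<close>, \<open>kalman_observable\<close>).  The
  lower bound of the density of \<open>\<nu>\<close> near zero gives mass at least \<open>k norm w powr \<alpha>\<close> to a ball of jumps
  of size about \<open>1 / norm w\<close> on which \<open>w \<bullet> z\<close> is bounded away from the zeros of \<open>1 - cos\<close>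
  (\<open>assumption_N_ball_lower_bound\<close>).  Together, \<open>\<bar>\<phi> \<xi>\<bar> \<le> exp (- c norm \<xi> powr \<alpha>)\<close> for large \<open>\<xi>\<close>
  (\<open>char_solution_bound\<close>).
\<close>

section \<open>Fourier inversion and smooth densities\<close>

text \<open>
  This plays the role of the Schwartz class: it contains the characteristic functions considered
  below, and it is closed under multiplication by linear functions, which is what differentiating
  under the Fourier integral produces.
\<close>

definition moments_integrable :: "('a::euclidean_space \<Rightarrow> complex) \<Rightarrow> bool" where
  "moments_integrable \<psi> \<longleftrightarrow> \<psi> \<in> borel_measurable borel \<and> (\<forall>k. integrable lborel (\<lambda>\<xi>. norm \<xi> ^ k * cmod (\<psi> \<xi>)))"

text \<open>
  With this sign, the transform of a characteristic function is, up to a normalising factor, the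
  density of the measure.
\<close>

definition fourier :: "('a::euclidean_space \<Rightarrow> complex) \<Rightarrow> 'a \<Rightarrow> complex" where
  "fourier \<psi> y = (\<integral>\<xi>. iexp (- (\<xi> \<bullet> y)) * \<psi> \<xi> \<partial>lborel)"

lemma moments_integrable_mult_inner:
  assumes "moments_integrable \<psi>"
  shows "moments_integrable (\<lambda>\<xi>. - \<i> * of_real (\<xi> \<bullet> v) * \<psi> \<xi>)"
  unfolding moments_integrable_def
proof (intro conjI allI)
  have m[measurable]: "\<psi> \<in> borel_measurable borel" using assms by (simp add: moments_integrable_def)
  show "(\<lambda>\<xi>. - \<i> * of_real (\<xi> \<bullet> v) * \<psi> \<xi>) \<in> borel_measurable borel" by measurable
  fix k
  have "integrable lborel (\<lambda>\<xi>. norm v * (norm \<xi> ^ Suc k * cmod (\<psi> \<xi>)))"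
    using assms unfolding moments_integrable_def by (intro integrable_mult_right) blast
  then show "integrable lborel (\<lambda>\<xi>. norm \<xi> ^ k * cmod (- \<i> * of_real (\<xi> \<bullet> v) * \<psi> \<xi>))"
  proof (rule Bochner_Integration.integrable_bound)
    show "AE \<xi> in lborel. norm (norm \<xi> ^ k * cmod (- \<i> * of_real (\<xi> \<bullet> v) * \<psi> \<xi>))
        \<le> norm (norm v * (norm \<xi> ^ Suc k * cmod (\<psi> \<xi>)))"
    proof (rule AE_I2)
      fix \<xi> :: 'a
      have "norm \<xi> ^ k * \<bar>\<xi> \<bullet> v\<bar> * cmod (\<psi> \<xi>) \<le> norm \<xi> ^ k * (norm \<xi> * norm v) * cmod (\<psi> \<xi>)"
        by (intro mult_mono mult_nonneg_nonneg Cauchy_Schwarz_ineq2) auto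
      then show "norm (norm \<xi> ^ k * cmod (- \<i> * of_real (\<xi> \<bullet> v) * \<psi> \<xi>))
        \<le> norm (norm v * (norm \<xi> ^ Suc k * cmod (\<psi> \<xi>)))"
        by (simp add: norm_mult abs_mult mult_ac)
    qed
  qed measurable
qed

lemma integrable_fourier_integrand:
  assumes "moments_integrable \<psi>"
  shows "integrable lborel (\<lambda>\<xi>. iexp (- (\<xi> \<bullet> y)) * \<psi> \<xi>)"
proof -
  have [measurable]: "\<psi> \<in> borel_measurable borel" using assms by (simp add: moments_integrable_def)
  have "integrable lborel (\<lambda>\<xi>. norm \<xi> ^ 0 * cmod (\<psi> \<xi>))"
    using assms unfolding moments_integrable_def by blast
  then show ?thesis
    by (rule Bochner_Integration.integrable_bound) (auto simp: norm_mult)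
qed

text \<open>
  The error of the linear approximation of \<open>iexp\<close> is quadratic, so the remainder of the transform is
  at most the second absolute moment of \<open>\<psi>\<close> times \<open>(norm (z - y))\<^sup>2\<close>.  No limit has to be exchanged
  with the integral.
\<close>

lemma fourier_has_derivative:
  assumes \<psi>: "moments_integrable \<psi>"
  shows "(fourier \<psi> has_derivative (\<lambda>v. fourier (\<lambda>\<xi>. - \<i> * of_real (\<xi> \<bullet> v) * \<psi> \<xi>) y)) (at y)"
proof -
  note int = integrable_fourier_integrand[OF \<psi>] integrable_fourier_integrand[OF moments_integrable_mult_inner[OF \<psi>]]
  define D where "D v = fourier (\<lambda>\<xi>. - \<i> * of_real (\<xi> \<bullet> v) * \<psi> \<xi>) y" for v
  have mom: "integrable lborel (\<lambda>\<xi>. norm \<xi> ^ k * cmod (\<psi> \<xi>))" for k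
    using \<psi> by (simp add: moments_integrable_def)
  define K where "K k = (\<integral>\<xi>. norm \<xi> ^ k * cmod (\<psi> \<xi>) \<partial>lborel)" for k
  have K: "K k \<ge> 0" for k unfolding K_def by (intro integral_nonneg_AE) auto
  have "bounded_linear D"
  proof (rule bounded_linear_intro[where K="K 1"])
    show "D (v + w) = D v + D w" for v w
    proof -
      have "D v + D w = (\<integral>\<xi>. iexp (- (\<xi> \<bullet> y)) * (- \<i> * of_real (\<xi> \<bullet> v) * \<psi> \<xi>) +
          iexp (- (\<xi> \<bullet> y)) * (- \<i> * of_real (\<xi> \<bullet> w) * \<psi> \<xi>) \<partial>lborel)"
        unfolding D_def fourier_def by (rule Bochner_Integration.integral_add[OF int(2) int(2), symmetric])
      also have "\<dots> = D (v + w)"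
        unfolding D_def fourier_def
        by (intro Bochner_Integration.integral_cong refl) (simp add: inner_add_right algebra_simps)
      finally show ?thesis ..
    qed
    show "D (r *\<^sub>R v) = r *\<^sub>R D v" for r v
    proof -
      have "r *\<^sub>R D v = (\<integral>\<xi>. r *\<^sub>R (iexp (- (\<xi> \<bullet> y)) * (- \<i> * of_real (\<xi> \<bullet> v) * \<psi> \<xi>)) \<partial>lborel)"
        unfolding D_def fourier_def by (rule integral_scaleR_right[symmetric])
      also have "\<dots> = D (r *\<^sub>R v)"
        unfolding D_def fourier_def
        by (intro Bochner_Integration.integral_cong refl) (simp add: scaleR_conv_of_real mult_ac)
      finally show ?thesis ..
    qed
    show "cmod (D v) \<le> norm v * K 1" for v
    proof -
      have "cmod (D v) \<le> (\<integral>\<xi>. norm v * (norm \<xi> ^ 1 * cmod (\<psi> \<xi>)) \<partial>lborel)"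
        unfolding D_def fourier_def
      proof (rule Bochner_Integration.integral_norm_bound_integral[OF int(2)])
        show "integrable lborel (\<lambda>\<xi>. norm v * (norm \<xi> ^ 1 * cmod (\<psi> \<xi>)))"
          using mom[of 1] by (rule integrable_mult_right)
        fix \<xi> :: 'a
        have "\<bar>\<xi> \<bullet> v\<bar> * cmod (\<psi> \<xi>) \<le> (norm \<xi> * norm v) * cmod (\<psi> \<xi>)"
          by (intro mult_right_mono Cauchy_Schwarz_ineq2) auto
        then show "cmod (iexp (- (\<xi> \<bullet> y)) * (- \<i> * of_real (\<xi> \<bullet> v) * \<psi> \<xi>))
            \<le> norm v * (norm \<xi> ^ 1 * cmod (\<psi> \<xi>))"
          by (simp add: norm_mult mult_ac)
      qed
      then show ?thesis by (simp add: K_def)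
    qed
  qed
  moreover have rem: "cmod (fourier \<psi> z - fourier \<psi> y - D (z - y)) \<le> K 2 * (norm (z - y))\<^sup>2" for z
  proof -
    have "fourier \<psi> z - fourier \<psi> y - D (z - y) = (\<integral>\<xi>. iexp (- (\<xi> \<bullet> z)) * \<psi> \<xi> -
        iexp (- (\<xi> \<bullet> y)) * \<psi> \<xi> - iexp (- (\<xi> \<bullet> y)) * (- \<i> * of_real (\<xi> \<bullet> (z - y)) * \<psi> \<xi>) \<partial>lborel)"
      unfolding D_def fourier_def
      by (simp only: Bochner_Integration.integral_diff[OF Bochner_Integration.integrable_diff[OF int(1) int(1)] int(2)]
            Bochner_Integration.integral_diff[OF int(1) int(1)])
    also have "cmod \<dots> \<le> (\<integral>\<xi>. (norm (z - y))\<^sup>2 * (norm \<xi> ^ 2 * cmod (\<psi> \<xi>)) \<partial>lborel)"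
    proof (rule Bochner_Integration.integral_norm_bound_integral)
      fix \<xi> :: 'a
      let ?x = "- (\<xi> \<bullet> (z - y))"
      have "iexp (- (\<xi> \<bullet> z)) * \<psi> \<xi> - iexp (- (\<xi> \<bullet> y)) * \<psi> \<xi> -
          iexp (- (\<xi> \<bullet> y)) * (- \<i> * of_real (\<xi> \<bullet> (z - y)) * \<psi> \<xi>) =
          iexp (- (\<xi> \<bullet> y)) * (iexp ?x - (1 + \<i> * ?x)) * \<psi> \<xi>"
      proof -
        have "iexp (- (\<xi> \<bullet> z)) = iexp (- (\<xi> \<bullet> y)) * iexp ?x"
          by (simp add: exp_add[symmetric] inner_diff_right algebra_simps)
        then show ?thesis by (simp add: algebra_simps)
      qed
      also have "cmod \<dots> = cmod (iexp ?x - (1 + \<i> * ?x)) * cmod (\<psi> \<xi>)"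
        by (simp add: norm_mult)
      also have "\<dots> \<le> (?x\<^sup>2) * cmod (\<psi> \<xi>)"
      proof (intro mult_right_mono)
        have "cmod (iexp ?x - (1 + \<i> * ?x)) \<le> \<bar>?x\<bar> ^ 2 / 2"
          using iexp_approx1[of ?x 1] by (simp add: numeral_2_eq_2)
        also have "\<dots> \<le> ?x\<^sup>2" by simp
        finally show "cmod (iexp ?x - (1 + \<i> * ?x)) \<le> ?x\<^sup>2" .
      qed simp
      also have "\<dots> \<le> ((norm \<xi> * norm (z - y))\<^sup>2) * cmod (\<psi> \<xi>)"
        using Cauchy_Schwarz_ineq2[of \<xi> "z - y"]
        by (intro mult_right_mono) (auto simp: abs_le_square_iff[symmetric])
      finally show "cmod (iexp (- (\<xi> \<bullet> z)) * \<psi> \<xi> - iexp (- (\<xi> \<bullet> y)) * \<psi> \<xi> -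
          iexp (- (\<xi> \<bullet> y)) * (- \<i> * of_real (\<xi> \<bullet> (z - y)) * \<psi> \<xi>))
          \<le> (norm (z - y))\<^sup>2 * (norm \<xi> ^ 2 * cmod (\<psi> \<xi>))"
        by (simp add: power_mult_distrib mult_ac)
    next
      show "integrable lborel (\<lambda>\<xi>. (norm (z - y))\<^sup>2 * (norm \<xi> ^ 2 * cmod (\<psi> \<xi>)))"
        using mom[of 2] by (rule integrable_mult_right)
      show "integrable lborel (\<lambda>\<xi>. iexp (- (\<xi> \<bullet> z)) * \<psi> \<xi> - iexp (- (\<xi> \<bullet> y)) * \<psi> \<xi> -
          iexp (- (\<xi> \<bullet> y)) * (- \<i> * of_real (\<xi> \<bullet> (z - y)) * \<psi> \<xi>))"
        by (rule Bochner_Integration.integrable_diff[OF Bochner_Integration.integrable_diff[OF int(1) int(1)] int(2)])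
    qed
    finally show ?thesis by (simp add: K_def mult.commute)
  qed
  moreover have "((\<lambda>z. norm (fourier \<psi> z - fourier \<psi> y - D (z - y)) / norm (z - y)) \<longlongrightarrow> 0) (at y)"
  proof (rule Lim_null_comparison)
    show "\<forall>\<^sub>F z in at y. norm (norm (fourier \<psi> z - fourier \<psi> y - D (z - y)) / norm (z - y))
        \<le> K 2 * norm (z - y)"
    proof (intro always_eventually allI)
      fix z
      have "norm (fourier \<psi> z - fourier \<psi> y - D (z - y)) / norm (z - y) \<le> K 2 * norm (z - y)"
      proof (cases "z = y")
        case False
        with rem[of z] show ?thesis by (simp add: divide_le_eq power2_eq_square mult.assoc)
      qed simp
      then show "norm (norm (fourier \<psi> z - fourier \<psi> y - D (z - y)) / norm (z - y)) \<le> K 2 * norm (z - y)"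
        by simp
    qed
    show "((\<lambda>z. K 2 * norm (z - y)) \<longlongrightarrow> 0) (at y)"
      by (auto intro!: tendsto_eq_intros)
  qed
  ultimately show ?thesis
    unfolding D_def by (simp add: has_derivative_iff_norm)
qed

lemma Re_fourier_has_derivative:
  assumes "moments_integrable \<psi>"
  shows "((\<lambda>y. Re (c * fourier \<psi> y)) has_derivative
      (\<lambda>v. Re (c * fourier (\<lambda>\<xi>. - \<i> * of_real (\<xi> \<bullet> v) * \<psi> \<xi>) y))) (at y)"
  by (intro has_derivative_Re has_derivative_mult_right fourier_has_derivative assms)

text \<open>
  A directional derivative of such a function is again of this form, with a new \<open>\<psi>\<close>; hence the
  induction over all \<open>\<psi>\<close> at once.
\<close>

lemma Re_fourier_Ck:
  assumes "moments_integrable \<psi>"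
  shows "Ck_on k UNIV (\<lambda>y. Re (c * fourier \<psi> y))"
  using assms
proof (induct k arbitrary: \<psi>)
  case 0
  have "isCont (\<lambda>y. Re (c * fourier \<psi> y)) y" for y
    using Re_fourier_has_derivative[OF 0] by (rule has_derivative_continuous)
  then show ?case
    unfolding Ck_on.simps by (intro continuous_at_imp_continuous_on) blast
next
  case (Suc k)
  have D: "frechet_derivative (\<lambda>y. Re (c * fourier \<psi> y)) (at y) v =
      Re (c * fourier (\<lambda>\<xi>. - \<i> * of_real (\<xi> \<bullet> v) * \<psi> \<xi>) y)" for y v
    unfolding frechet_derivative_at[OF Re_fourier_has_derivative[OF Suc(2), of c y], symmetric] ..
  have "(\<lambda>y. Re (c * fourier \<psi> y)) differentiable (at y)" for y
    unfolding differentiable_def using Re_fourier_has_derivative[OF Suc(2)] by blast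
  then show ?case
    unfolding Ck_on.simps D using Suc(1)[OF moments_integrable_mult_inner[OF Suc(2)]] by blast
qed

lemma integral_lborel_prod:
  fixes f :: "'a::euclidean_space \<Rightarrow> real \<Rightarrow> complex"
  assumes f: "\<And>b. b \<in> Basis \<Longrightarrow> integrable lborel (f b)"
  shows "(\<integral>x. (\<Prod>b\<in>Basis. f b (x \<bullet> b)) \<partial>lborel) = (\<Prod>b\<in>Basis. \<integral>x. f b x \<partial>lborel)"
proof -
  interpret product_sigma_finite "\<lambda>_::'a. lborel :: real measure" ..
  have [measurable]: "b \<in> Basis \<Longrightarrow> f b \<in> borel_measurable borel" for b using f by auto
  have "(\<integral>x. (\<Prod>b\<in>Basis. f b (x \<bullet> b)) \<partial>(lborel :: 'a measure)) =
    (\<integral>x. (\<Prod>b\<in>Basis. f b (x b)) \<partial>(\<Pi>\<^sub>M b\<in>(Basis::'a set). lborel))"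
    by (subst lborel_eq, subst integral_distr) (auto intro!: Bochner_Integration.integral_cong prod.cong)
  also have "\<dots> = (\<Prod>b\<in>Basis. \<integral>x. f b x \<partial>lborel)"
    using f by (intro product_integral_prod) auto
  finally show ?thesis .
qed

lemma integral_lborel_affine:
  fixes f :: "'a::euclidean_space \<Rightarrow> 'b::{banach, second_countable_topology}"
  assumes c: "c > 0" and [measurable]: "f \<in> borel_measurable borel"
  shows "(\<integral>x. f x \<partial>lborel) = c ^ DIM('a) *\<^sub>R (\<integral>x. f (t + c *\<^sub>R x) \<partial>lborel)"
  using c by (subst lborel_affine[of c t])
    (auto simp: integral_density integral_distr)

text \<open>
  The standard Gaussian density.  The product form reduces its integrals to the real line, where the
  characteristic function of the normal distribution is known.
\<close>

definition gauss :: "'a::euclidean_space \<Rightarrow> real" where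
  "gauss z = (\<Prod>b\<in>Basis. std_normal_density (z \<bullet> b))"

lemma gauss_nonneg[simp]: "0 \<le> gauss z"
  unfolding gauss_def by (intro prod_nonneg) auto

lemma gauss_minus[simp]: "gauss (- z) = gauss z"
  by (simp add: gauss_def std_normal_density_def)

lemma gauss_measurable[measurable]: "gauss \<in> borel_measurable borel"
  unfolding gauss_def[abs_def] by measurable

lemma continuous_on_gauss: "continuous_on UNIV gauss"
  unfolding gauss_def std_normal_density_def by (intro continuous_intros) auto

lemma integral_char_std_normal:
  "(\<integral>x. iexp (t * x) * std_normal_density x \<partial>lborel) = exp (- (t\<^sup>2) / 2)"
  (is "?L = _")
  "integrable lborel (\<lambda>x. iexp (t * x) * std_normal_density x)"
proof -
  have "?L = char std_normal_distribution t"
    unfolding char_def by (subst integral_density) (auto simp: scaleR_conv_of_real mult.commute)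
  then show "?L = exp (- (t\<^sup>2) / 2)" by (simp add: char_std_normal_distribution)
  have "integrable lborel std_normal_density" by auto
  then show "integrable lborel (\<lambda>x. iexp (t * x) * std_normal_density x)"
    by (rule Bochner_Integration.integrable_bound) (auto simp: norm_mult)
qed

definition gauss_const :: "'a::euclidean_space itself \<Rightarrow> real" where
  "gauss_const _ = (1 / sqrt (2 * pi)) ^ DIM('a)"

lemma gauss_eq:
  "gauss (u :: 'a::euclidean_space) = gauss_const TYPE('a) * (\<Prod>b\<in>Basis. exp (- ((u \<bullet> b)\<^sup>2) / 2))"
  by (simp only: gauss_def gauss_const_def std_normal_density_def prod.distrib prod_constant)

lemma gauss_le: "gauss (u :: 'a::euclidean_space) \<le> gauss_const TYPE('a)"
proof -
  have "(\<Prod>b\<in>Basis. exp (- ((u \<bullet> b)\<^sup>2) / 2)) \<le> 1"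
    by (intro prod_le_1) auto
  then show ?thesis
    unfolding gauss_eq by (intro mult_right_le_one_le prod_nonneg) (auto simp: gauss_const_def)
qed

text \<open>
  The Gaussian is its own Fourier transform up to a constant.  This identity is the source of the inversion formula:
  it writes a smoothing kernel as a superposition of characters.
\<close>

lemma gauss_fourier:
  fixes u :: "'a::euclidean_space"
  shows "complex_of_real (gauss u) = gauss_const TYPE('a) * (\<integral>z. iexp (u \<bullet> z) * gauss z \<partial>lborel)"
proof -
  have "iexp (u \<bullet> z) * gauss z =
      (\<Prod>b\<in>Basis. iexp ((u \<bullet> b) * (z \<bullet> b)) * std_normal_density (z \<bullet> b))" for z
  proof -
    have "iexp (u \<bullet> z) = exp (\<Sum>b\<in>Basis. \<i> * of_real ((u \<bullet> b) * (z \<bullet> b)))"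
      unfolding euclidean_inner[of u z] by (simp only: of_real_sum sum_distrib_left)
    then show ?thesis
      by (simp only: gauss_def prod.distrib of_real_prod exp_sum[OF finite_Basis])
  qed
  then have "(\<integral>z. iexp (u \<bullet> z) * gauss z \<partial>lborel) =
      (\<integral>z. (\<Prod>b\<in>Basis. iexp ((u \<bullet> b) * (z \<bullet> b)) * std_normal_density (z \<bullet> b)) \<partial>lborel)"
    by (simp only:)
  also have "\<dots> = (\<Prod>b\<in>Basis. \<integral>x. iexp ((u \<bullet> b) * x) * std_normal_density x \<partial>lborel)"
    by (rule integral_lborel_prod) (rule integral_char_std_normal(2))
  also have "\<dots> = of_real (\<Prod>b\<in>Basis. exp (- ((u \<bullet> b)\<^sup>2) / 2))"
    by (simp only: integral_char_std_normal(1) of_real_prod)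
  finally show ?thesis by (simp only: gauss_eq of_real_mult)
qed

lemma gauss_integrable: "integrable lborel (gauss :: 'a::euclidean_space \<Rightarrow> real)"
  and gauss_integral: "(\<integral>z. gauss z \<partial>(lborel :: 'a measure)) = 1"
proof -
  have "(\<integral>\<^sup>+z. ennreal (gauss z) \<partial>(lborel :: 'a measure)) =
      (\<integral>\<^sup>+z. (\<Prod>b\<in>Basis. ennreal (std_normal_density (z \<bullet> b))) \<partial>(lborel :: 'a measure))"
    by (simp add: gauss_def prod_ennreal)
  also have "\<dots> = (\<Prod>b\<in>(Basis :: 'a set). \<integral>\<^sup>+x. ennreal (std_normal_density x) \<partial>lborel)"
    by (intro nn_integral_lborel_prod) auto
  also have "(\<integral>\<^sup>+x. ennreal (std_normal_density x) \<partial>lborel) = 1"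
    using prob_space.emeasure_space_1[OF prob_space_normal_density[OF zero_less_one, of 0]]
    by (subst (asm) emeasure_density) auto
  finally have *: "(\<integral>\<^sup>+z. ennreal (gauss z) \<partial>(lborel :: 'a measure)) = 1" by simp
  then show "integrable lborel (gauss :: 'a \<Rightarrow> real)"
    by (intro integrableI_nonneg) auto
  show "(\<integral>z. gauss z \<partial>(lborel :: 'a measure)) = 1"
    by (subst integral_eq_nn_integral) (auto simp: *)
qed

text \<open>
  The density of a centred Gaussian vector with standard deviation \<open>\<sigma>\<close> in every direction.
\<close>

definition gauss_kernel :: "real \<Rightarrow> 'a::euclidean_space \<Rightarrow> real" where
  "gauss_kernel \<sigma> w = gauss (w /\<^sub>R \<sigma>) / \<sigma> ^ DIM('a)"

lemma gauss_kernel_measurable[measurable]: "gauss_kernel \<sigma> \<in> borel_measurable borel"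
  unfolding gauss_kernel_def[abs_def] by measurable

lemma gauss_scaled_integrable:
  assumes "\<sigma> > 0"
  shows "integrable lborel (\<lambda>z::'a::euclidean_space. gauss (t + \<sigma> *\<^sub>R z))"
proof -
  have "integrable (density (distr lborel borel (\<lambda>x::'a. t + \<sigma> *\<^sub>R x)) (\<lambda>_. \<bar>\<sigma>\<bar>^DIM('a))) gauss"
    by (subst lborel_affine[symmetric]) (use assms gauss_integrable in auto)
  then show ?thesis
    using assms by (simp add: integrable_density integrable_distr_eq)
qed

lemma gauss_kernel_fourier:
  fixes w :: "'a::euclidean_space"
  assumes \<sigma>: "\<sigma> > 0"
  shows "complex_of_real (gauss_kernel \<sigma> w) =
    gauss_const TYPE('a) * (\<integral>\<xi>. iexp (w \<bullet> \<xi>) * gauss (\<sigma> *\<^sub>R \<xi>) \<partial>lborel)"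
proof -
  have "complex_of_real (gauss (w /\<^sub>R \<sigma>)) =
      gauss_const TYPE('a) * (\<integral>z. iexp ((w /\<^sub>R \<sigma>) \<bullet> z) * gauss z \<partial>lborel)"
    by (rule gauss_fourier)
  also have "(\<integral>z. iexp ((w /\<^sub>R \<sigma>) \<bullet> z) * gauss z \<partial>lborel) =
      \<sigma> ^ DIM('a) *\<^sub>R (\<integral>\<xi>. iexp ((w /\<^sub>R \<sigma>) \<bullet> (0 + \<sigma> *\<^sub>R \<xi>)) * gauss (0 + \<sigma> *\<^sub>R \<xi>) \<partial>lborel)"
    using \<sigma> by (intro integral_lborel_affine) measurable
  finally show ?thesis
    using \<sigma> by (simp add: gauss_kernel_def scaleR_conv_of_real field_simps)
qed

lemma gauss_kernel_convolution:
  fixes f :: "'a::euclidean_space \<Rightarrow> real"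
  assumes \<sigma>: "\<sigma> > 0" and [measurable]: "f \<in> borel_measurable borel"
  shows "(\<integral>y. f y * gauss_kernel \<sigma> (x - y) \<partial>lborel) = (\<integral>z. f (x + \<sigma> *\<^sub>R z) * gauss z \<partial>lborel)"
proof -
  have "(\<integral>y. f y * gauss_kernel \<sigma> (x - y) \<partial>lborel) =
    \<sigma> ^ DIM('a) *\<^sub>R (\<integral>z. f (x + \<sigma> *\<^sub>R z) * gauss_kernel \<sigma> (x - (x + \<sigma> *\<^sub>R z)) \<partial>lborel)"
    using \<sigma> by (intro integral_lborel_affine) measurable
  also have "\<dots> = (\<integral>z. f (x + \<sigma> *\<^sub>R z) * gauss z \<partial>lborel)"
    using \<sigma> by (subst integral_scaleR_right[symmetric]) (simp add: gauss_kernel_def)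
  finally show ?thesis .
qed

lemma gauss_kernel_convolution_tendsto:
  fixes f :: "'a::euclidean_space \<Rightarrow> real"
  assumes cont: "continuous_on UNIV f" and bnd: "\<And>x. \<bar>f x\<bar> \<le> K" and \<sigma>: "\<sigma> \<longlonglongrightarrow> 0"
  shows "(\<lambda>n. \<integral>z. f (x + \<sigma> n *\<^sub>R z) * gauss z \<partial>lborel) \<longlonglongrightarrow> f x"
proof -
  have [measurable]: "f \<in> borel_measurable borel" using cont by (rule borel_measurable_continuous_onI)
  have "(\<lambda>n. \<integral>z. f (x + \<sigma> n *\<^sub>R z) * gauss z \<partial>lborel) \<longlonglongrightarrow> (\<integral>z. f x * gauss (z::'a) \<partial>lborel)"
  proof (rule integral_dominated_convergence[where w="\<lambda>z::'a. K * gauss z"])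
    show "integrable lborel (\<lambda>z::'a. K * gauss z)"
      using gauss_integrable by (rule integrable_mult_right)
    show "AE z in lborel. (\<lambda>n. f (x + \<sigma> n *\<^sub>R z) * gauss z) \<longlonglongrightarrow> f x * gauss z"
    proof (intro AE_I2 tendsto_mult tendsto_const)
      fix z
      have "(\<lambda>n. x + \<sigma> n *\<^sub>R z) \<longlonglongrightarrow> x + 0 *\<^sub>R z" by (intro tendsto_intros \<sigma>)
      then show "(\<lambda>n. f (x + \<sigma> n *\<^sub>R z)) \<longlonglongrightarrow> f x"
        using cont by (intro continuous_on_tendsto_compose[of UNIV f]) auto
    qed
    show "AE z in lborel. norm (f (x + \<sigma> n *\<^sub>R z) * gauss z) \<le> K * gauss z" for n
      using bnd by (intro AE_I2) (auto simp: abs_mult intro!: mult_right_mono)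
  qed measurable
  then show ?thesis
    by (simp add: gauss_integral)
qed

text \<open>
  Smoothing \<open>P\<close> with a Gaussian kernel of width \<open>\<sigma>\<close> gives a measure with density \<open>q\<close>.  By Fubini,
  \<open>q\<close> is the inversion integral damped by a Gaussian factor, and the factor disappears as \<open>\<sigma> \<rightarrow> 0\<close>
  because the characteristic function is integrable.  So \<open>q\<close> converges to \<open>p\<close>, boundedly; in
  particular \<open>p\<close> is nonnegative at every point, as a limit of densities.  On the other hand the
  smoothed measures converge weakly to \<open>P\<close>.  Comparing the two limits on continuous integrable test
  functions, and then on boxes, identifies \<open>P\<close>.
\<close>

theorem fourier_inversion_measure:
  fixes P :: "'a::euclidean_space measure"
  assumes "prob_space P" and sP[measurable_cong]: "sets P = sets borel"
    and int: "integrable lborel (\<lambda>\<xi>. \<integral>x. iexp (\<xi> \<bullet> x) \<partial>P)"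
  defines "p \<equiv> \<lambda>y. Re ((gauss_const TYPE('a))\<^sup>2 * fourier (\<lambda>\<xi>. \<integral>x. iexp (\<xi> \<bullet> x) \<partial>P) y)"
  assumes cont: "continuous_on UNIV p"
  shows "\<And>y. 0 \<le> p y" and "P = density lborel (\<lambda>y. ennreal (p y))"
proof -
  interpret prob_space P by fact
  interpret pair_sigma_finite P "lborel :: 'a measure" ..
  define \<phi> where "\<phi> \<xi> = (\<integral>x. iexp (\<xi> \<bullet> x) \<partial>P)" for \<xi>
  define \<kappa> where "\<kappa> = gauss_const TYPE('a)"
  have \<phi>[measurable]: "\<phi> \<in> borel_measurable borel" and i\<phi>: "integrable lborel \<phi>"
    using int by (auto simp: \<phi>_def[abs_def])
  have spP[simp]: "space P = UNIV" using sets_eq_imp_space_eq[OF sP] by simp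
  have \<kappa>: "0 < \<kappa>" by (simp add: \<kappa>_def gauss_const_def)
  define \<sigma> where "\<sigma> n = inverse (real (Suc n))" for n
  have \<sigma>: "\<sigma> n > 0" for n by (simp add: \<sigma>_def)
  have \<sigma>0: "\<sigma> \<longlonglongrightarrow> 0" unfolding \<sigma>_def[abs_def] by (rule LIMSEQ_inverse_real_of_nat)
  (* the density of P smoothed at scale sigma n *)
  define q where "q n y = (\<integral>x. gauss_kernel (\<sigma> n) (x - y) \<partial>P)" for n y
  have g0: "gauss (0::'a) = \<kappa>" by (simp add: gauss_def std_normal_density_def \<kappa>_def gauss_const_def)
  have gle: "gauss z \<le> \<kappa>" for z :: 'a
    unfolding \<kappa>_def by (rule gauss_le)
  have q_nonneg: "0 \<le> q n y" for n y
    unfolding q_def using \<sigma>[of n] by (intro integral_nonneg_AE AE_I2) (auto simp: gauss_kernel_def)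
  have q_fourier: "complex_of_real (q n y) = \<kappa> * (\<integral>\<xi>. iexp (- (\<xi> \<bullet> y)) * \<phi> \<xi> * gauss (\<sigma> n *\<^sub>R \<xi>) \<partial>lborel)" for n y
  proof -
    have gi: "integrable lborel (\<lambda>\<xi>::'a. gauss (\<sigma> n *\<^sub>R \<xi>))"
      using gauss_scaled_integrable[OF \<sigma>[of n], of 0] by simp
    have "complex_of_real (q n y) = (\<integral>x. complex_of_real (gauss_kernel (\<sigma> n) (x - y)) \<partial>P)"
      unfolding q_def by simp
    also have "\<dots> = \<kappa> * (\<integral>x. (\<integral>\<xi>. iexp ((x - y) \<bullet> \<xi>) * gauss (\<sigma> n *\<^sub>R \<xi>) \<partial>lborel) \<partial>P)"
      unfolding gauss_kernel_fourier[OF \<sigma>] \<kappa>_def by simp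
    also have "(\<integral>x. (\<integral>\<xi>. iexp ((x - y) \<bullet> \<xi>) * gauss (\<sigma> n *\<^sub>R \<xi>) \<partial>lborel) \<partial>P) =
        (\<integral>\<xi>. (\<integral>x. iexp ((x - y) \<bullet> \<xi>) * gauss (\<sigma> n *\<^sub>R \<xi>) \<partial>P) \<partial>lborel)"
    proof (rule Fubini_integral[symmetric], rule Fubini_integrable)
      show "integrable P (\<lambda>x. \<integral>\<xi>. norm (case (x, \<xi>) of (x, \<xi>) \<Rightarrow> iexp ((x - y) \<bullet> \<xi>) * gauss (\<sigma> n *\<^sub>R \<xi>)) \<partial>lborel)"
        by (simp add: norm_mult)
      show "AE x in P. integrable lborel (\<lambda>\<xi>. case (x, \<xi>) of (x, \<xi>) \<Rightarrow> iexp ((x - y) \<bullet> \<xi>) * gauss (\<sigma> n *\<^sub>R \<xi>))"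
        by (intro AE_I2 Bochner_Integration.integrable_bound[OF gi]) (auto simp: norm_mult)
    qed measurable
    also have "(\<lambda>\<xi>. \<integral>x. iexp ((x - y) \<bullet> \<xi>) * gauss (\<sigma> n *\<^sub>R \<xi>) \<partial>P) =
        (\<lambda>\<xi>. iexp (- (\<xi> \<bullet> y)) * \<phi> \<xi> * gauss (\<sigma> n *\<^sub>R \<xi>))"
    proof
      fix \<xi>
      have "iexp ((x - y) \<bullet> \<xi>) * gauss (\<sigma> n *\<^sub>R \<xi>) = (iexp (- (\<xi> \<bullet> y)) * gauss (\<sigma> n *\<^sub>R \<xi>)) * iexp (\<xi> \<bullet> x)" for x
      proof -
        have "iexp ((x - y) \<bullet> \<xi>) = iexp (- (\<xi> \<bullet> y)) * iexp (\<xi> \<bullet> x)"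
          by (simp add: exp_add[symmetric] inner_diff_left inner_commute algebra_simps)
        then show ?thesis by (simp only: mult_ac)
      qed
      then have "(\<integral>x. iexp ((x - y) \<bullet> \<xi>) * gauss (\<sigma> n *\<^sub>R \<xi>) \<partial>P) =
          (\<integral>x. (iexp (- (\<xi> \<bullet> y)) * gauss (\<sigma> n *\<^sub>R \<xi>)) * iexp (\<xi> \<bullet> x) \<partial>P)"
        by (simp only:)
      also have "\<dots> = (iexp (- (\<xi> \<bullet> y)) * gauss (\<sigma> n *\<^sub>R \<xi>)) * \<phi> \<xi>"
        unfolding \<phi>_def by (rule integral_mult_right_zero)
      finally show "(\<integral>x. iexp ((x - y) \<bullet> \<xi>) * gauss (\<sigma> n *\<^sub>R \<xi>) \<partial>P) = iexp (- (\<xi> \<bullet> y)) * \<phi> \<xi> * gauss (\<sigma> n *\<^sub>R \<xi>)"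
        by (simp only: mult_ac)
    qed
    finally show ?thesis .
  qed
  have i1: "integrable lborel (\<lambda>\<xi>. \<kappa> * cmod (\<phi> \<xi>))"
    using i\<phi> by (intro integrable_mult_right integrable_norm)
  have b1: "cmod (iexp (- (\<xi> \<bullet> y)) * \<phi> \<xi> * gauss (\<sigma> n *\<^sub>R \<xi>)) \<le> \<kappa> * cmod (\<phi> \<xi>)" for n y \<xi>
  proof -
    have "cmod (\<phi> \<xi>) * gauss (\<sigma> n *\<^sub>R \<xi>) \<le> cmod (\<phi> \<xi>) * \<kappa>" by (intro mult_left_mono gle norm_ge_zero)
    then show ?thesis by (simp add: norm_mult mult.commute)
  qed
  have q_lim: "(\<lambda>n. q n y) \<longlonglongrightarrow> p y" for y
  proof -
    have "(\<lambda>n. \<integral>\<xi>. iexp (- (\<xi> \<bullet> y)) * \<phi> \<xi> * gauss (\<sigma> n *\<^sub>R \<xi>) \<partial>lborel) \<longlonglongrightarrow>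
        (\<integral>\<xi>. iexp (- (\<xi> \<bullet> y)) * \<phi> \<xi> * \<kappa> \<partial>lborel)"
    proof (rule integral_dominated_convergence[where w="\<lambda>\<xi>. \<kappa> * cmod (\<phi> \<xi>)"])
      show "integrable lborel (\<lambda>\<xi>. \<kappa> * cmod (\<phi> \<xi>))" by (rule i1)
      show "AE \<xi> in lborel. (\<lambda>n. iexp (- (\<xi> \<bullet> y)) * \<phi> \<xi> * complex_of_real (gauss (\<sigma> n *\<^sub>R \<xi>))) \<longlonglongrightarrow>
          iexp (- (\<xi> \<bullet> y)) * \<phi> \<xi> * complex_of_real \<kappa>"
      proof (intro AE_I2 tendsto_mult tendsto_const tendsto_of_real)
        fix \<xi> :: 'a
        have "(\<lambda>n. \<sigma> n *\<^sub>R \<xi>) \<longlonglongrightarrow> 0 *\<^sub>R \<xi>" by (intro tendsto_intros \<sigma>0)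
        then have "(\<lambda>n. gauss (\<sigma> n *\<^sub>R \<xi>)) \<longlonglongrightarrow> gauss (0 *\<^sub>R \<xi>)"
          using continuous_on_gauss by (intro continuous_on_tendsto_compose[of UNIV gauss]) auto
        then show "(\<lambda>n. gauss (\<sigma> n *\<^sub>R \<xi>)) \<longlonglongrightarrow> \<kappa>" by (simp add: g0)
      qed
      show "AE \<xi> in lborel. norm (iexp (- (\<xi> \<bullet> y)) * \<phi> \<xi> * complex_of_real (gauss (\<sigma> n *\<^sub>R \<xi>))) \<le> \<kappa> * cmod (\<phi> \<xi>)" for n
        by (intro AE_I2 b1)
    qed measurable
    then have "(\<lambda>n. Re (\<kappa> * (\<integral>\<xi>. iexp (- (\<xi> \<bullet> y)) * \<phi> \<xi> * gauss (\<sigma> n *\<^sub>R \<xi>) \<partial>lborel))) \<longlonglongrightarrow>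
      Re (\<kappa> * (\<integral>\<xi>. iexp (- (\<xi> \<bullet> y)) * \<phi> \<xi> * \<kappa> \<partial>lborel))"
      by (intro tendsto_intros)
    moreover have "\<kappa> * (\<integral>\<xi>. iexp (- (\<xi> \<bullet> y)) * \<phi> \<xi> * \<kappa> \<partial>lborel) = (gauss_const TYPE('a))\<^sup>2 * fourier \<phi> y"
      unfolding integral_mult_left_zero fourier_def \<kappa>_def power2_eq_square by (simp only: mult_ac of_real_mult)
    moreover have "p y = Re ((gauss_const TYPE('a))\<^sup>2 * fourier \<phi> y)"
      by (simp only: p_def \<phi>_def[abs_def])
    ultimately show ?thesis
      unfolding q_fourier[symmetric] by (simp only: Re_complex_of_real)
  qed
  show p_nonneg: "0 \<le> p y" for y
    using q_lim[of y] by (rule LIMSEQ_le_const) (use q_nonneg in auto)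
  define C where "C = \<kappa>\<^sup>2 * (\<integral>\<xi>. cmod (\<phi> \<xi>) \<partial>lborel)"
  have q_bound: "q n y \<le> C" for n y
  proof -
    have i2: "integrable lborel (\<lambda>\<xi>. iexp (- (\<xi> \<bullet> y)) * \<phi> \<xi> * gauss (\<sigma> n *\<^sub>R \<xi>))"
    proof (rule Bochner_Integration.integrable_bound[OF i1])
      show "AE \<xi> in lborel. norm (iexp (- (\<xi> \<bullet> y)) * \<phi> \<xi> * gauss (\<sigma> n *\<^sub>R \<xi>)) \<le> norm (\<kappa> * cmod (\<phi> \<xi>))"
        using order_trans[OF b1 abs_ge_self] by (intro AE_I2) (simp only: real_norm_def)
    qed measurable
    have "q n y = cmod (complex_of_real (q n y))" using q_nonneg by simp
    also have "\<dots> = \<kappa> * cmod (\<integral>\<xi>. iexp (- (\<xi> \<bullet> y)) * \<phi> \<xi> * gauss (\<sigma> n *\<^sub>R \<xi>) \<partial>lborel)"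
      unfolding q_fourier norm_mult using \<kappa> by simp
    also have "\<dots> \<le> \<kappa> * (\<integral>\<xi>. \<kappa> * cmod (\<phi> \<xi>) \<partial>lborel)"
      by (rule mult_left_mono[OF Bochner_Integration.integral_norm_bound_integral[OF i2 i1 b1] less_imp_le[OF \<kappa>]])
    finally show ?thesis by (simp add: C_def power2_eq_square)
  qed
  have pC: "p y \<le> C" for y using q_lim[of y] by (rule LIMSEQ_le_const2) (use q_bound in auto)
  have [measurable]: "p \<in> borel_measurable borel" using cont by (rule borel_measurable_continuous_onI)
  have [measurable]: "q n \<in> borel_measurable borel" for n
    unfolding q_def[abs_def] by measurable
  (* the weak limit of the smoothed measures, computed in two ways *)
  have test: "(\<integral>x. f x \<partial>P) = (\<integral>y. f y * p y \<partial>lborel)"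
    if f: "continuous_on UNIV f" "integrable lborel f" "\<And>x. \<bar>f x\<bar> \<le> K" for f :: "'a \<Rightarrow> real" and K
  proof -
    have [measurable]: "f \<in> borel_measurable borel" using f(1) by (rule borel_measurable_continuous_onI)
    have "(\<lambda>n. \<integral>y. f y * q n y \<partial>lborel) \<longlonglongrightarrow> (\<integral>y. f y * p y \<partial>lborel)"
    proof (rule integral_dominated_convergence[where w="\<lambda>y. C * \<bar>f y\<bar>"])
      show "integrable lborel (\<lambda>y. C * \<bar>f y\<bar>)"
        using f(2) by (intro integrable_mult_right) auto
      show "AE y in lborel. (\<lambda>n. f y * q n y) \<longlonglongrightarrow> f y * p y"
        by (intro AE_I2 tendsto_intros q_lim)
      show "AE y in lborel. norm (f y * q n y) \<le> C * \<bar>f y\<bar>" for n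
      proof (rule AE_I2)
        fix y
        have "q n y * \<bar>f y\<bar> \<le> C * \<bar>f y\<bar>" by (intro mult_right_mono q_bound) simp
        then show "norm (f y * q n y) \<le> C * \<bar>f y\<bar>" using q_nonneg[of n y] by (simp add: abs_mult mult.commute)
      qed
    qed measurable
    moreover have "(\<integral>y. f y * q n y \<partial>lborel) = (\<integral>x. (\<integral>z. f (x + \<sigma> n *\<^sub>R z) * gauss z \<partial>lborel) \<partial>P)" for n
    proof -
      have "(\<integral>y. f y * q n y \<partial>lborel) = (\<integral>y. (\<integral>x. f y * gauss_kernel (\<sigma> n) (x - y) \<partial>P) \<partial>lborel)"
        unfolding q_def by simp
      also have "\<dots> = (\<integral>x. (\<integral>y. f y * gauss_kernel (\<sigma> n) (x - y) \<partial>lborel) \<partial>P)"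
      proof (rule Fubini_integral, rule Fubini_integrable)
        have ki: "integrable lborel (\<lambda>y. \<bar>f y\<bar> * (\<kappa> / \<sigma> n ^ DIM('a)))"
          using f(2) by (intro integrable_mult_left) auto
        have kb: "norm (f y * gauss_kernel (\<sigma> n) (x - y)) \<le> \<bar>f y\<bar> * (\<kappa> / \<sigma> n ^ DIM('a))" for x y
          using gle \<sigma>[of n] by (auto simp: abs_mult gauss_kernel_def intro!: mult_left_mono divide_right_mono)
        have int1: "integrable lborel (\<lambda>y. f y * gauss_kernel (\<sigma> n) (x - y))" for x
        proof (rule Bochner_Integration.integrable_bound[OF ki])
          show "AE y in lborel. norm (f y * gauss_kernel (\<sigma> n) (x - y)) \<le> norm (\<bar>f y\<bar> * (\<kappa> / \<sigma> n ^ DIM('a)))"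
            using order_trans[OF kb abs_ge_self] by (intro AE_I2) auto
        qed measurable
        then show "AE x in P. integrable lborel (\<lambda>y. case (x, y) of (x, y) \<Rightarrow> f y * gauss_kernel (\<sigma> n) (x - y))"
          by simp
        have "norm (\<integral>y. norm (f y * gauss_kernel (\<sigma> n) (x - y)) \<partial>lborel) \<le> (\<integral>y. \<bar>f y\<bar> * (\<kappa> / \<sigma> n ^ DIM('a)) \<partial>lborel)" for x
          using kb int1 ki by (intro Bochner_Integration.integral_norm_bound_integral integrable_norm) auto
        then show "integrable P (\<lambda>x. \<integral>y. norm (case (x, y) of (x, y) \<Rightarrow> f y * gauss_kernel (\<sigma> n) (x - y)) \<partial>lborel)"
          by (intro integrable_const_bound) (auto intro!: AE_I2)
      qed measurable
      finally show ?thesis by (simp add: gauss_kernel_convolution[OF \<sigma>])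
    qed
    moreover have "(\<lambda>n. \<integral>x. (\<integral>z. f (x + \<sigma> n *\<^sub>R z) * gauss z \<partial>lborel) \<partial>P) \<longlonglongrightarrow> (\<integral>x. f x \<partial>P)"
    proof (rule integral_dominated_convergence[where w="\<lambda>x. K"])
      show "AE x in P. (\<lambda>n. \<integral>z. f (x + \<sigma> n *\<^sub>R z) * gauss z \<partial>lborel) \<longlonglongrightarrow> f x"
        by (intro AE_I2 gauss_kernel_convolution_tendsto[OF f(1,3) \<sigma>0])
      show "AE x in P. norm (\<integral>z. f (x + \<sigma> n *\<^sub>R z) * gauss z \<partial>lborel) \<le> K" for n
      proof (rule AE_I2)
        fix x
        have b: "norm (f (x + \<sigma> n *\<^sub>R z) * gauss z) \<le> K * gauss z" for z
          using f(3) by (auto simp: abs_mult intro!: mult_right_mono)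
        have "norm (\<integral>z. f (x + \<sigma> n *\<^sub>R z) * gauss z \<partial>lborel) \<le> (\<integral>z. K * gauss z \<partial>(lborel::'a measure))"
        proof (rule Bochner_Integration.integral_norm_bound_integral)
          show "integrable lborel (\<lambda>z::'a. K * gauss z)"
            using gauss_integrable by (rule integrable_mult_right)
          then show "integrable lborel (\<lambda>z. f (x + \<sigma> n *\<^sub>R z) * gauss z)"
            by (rule Bochner_Integration.integrable_bound) (use order_trans[OF b abs_ge_self] in auto)
        qed (rule b)
        then show "norm (\<integral>z. f (x + \<sigma> n *\<^sub>R z) * gauss z \<partial>lborel) \<le> K" by (simp add: gauss_integral)
      qed
      show "f \<in> borel_measurable P" by measurable
      show "integrable P (\<lambda>x. K)" by simp
      have "(\<lambda>x. \<integral>z. f (x + \<sigma> n *\<^sub>R z) * gauss z \<partial>lborel) \<in> borel_measurable borel" for n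
        by measurable
      then show "(\<lambda>x. \<integral>z. f (x + \<sigma> n *\<^sub>R z) * gauss z \<partial>lborel) \<in> borel_measurable P" for n
        by (simp cong: measurable_cong_sets add: sP)
    qed
    ultimately show ?thesis using LIMSEQ_unique by auto
  qed
  have box: "emeasure P (box a b) = emeasure (density lborel (\<lambda>y. ennreal (p y))) (box a b)" for a b
  proof -
    (* continuous functions that increase to the indicator of the open box *)
    define f where "f n x = min 1 (real n * infdist x (- box a b))" for n x
    have fc: "continuous_on UNIV (f n)" for n unfolding f_def by (intro continuous_intros)
    then have [measurable]: "f n \<in> borel_measurable borel" for n by (rule borel_measurable_continuous_onI)
    have fb: "0 \<le> f n x" "f n x \<le> 1" for n x by (auto simp: f_def infdist_nonneg)
    have f0: "f n x = 0" if "x \<notin> box a b" for n x using that by (simp add: f_def)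
    have ib: "integrable lborel (indicator (box a b) :: 'a \<Rightarrow> real)"
      using emeasure_lborel_box_finite[of a b] by (simp add: integrable_indicator_iff)
    have fi: "norm (f n x) \<le> indicator (box a b) x" for n x
      using fb[of n x] f0[of x n] by (auto simp: indicator_def)
    have fl: "(\<lambda>n. f n x) \<longlonglongrightarrow> indicator (box a b) x" for x
    proof (cases "x \<in> box a b")
      case True
      have "bounded (box a b)" by simp
      then have ne: "- box a b \<noteq> {}" using not_bounded_UNIV by (metis Compl_empty_eq double_complement)
      have "infdist x (- box a b) \<noteq> 0"
        using True ne in_closed_iff_infdist_zero[of "- box a b" x] by (auto simp: closed_Compl open_box)
      then have pos: "infdist x (- box a b) > 0" using infdist_nonneg[of x "- box a b"] by linarith
      have "eventually (\<lambda>n. f n x = 1) sequentially"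
        using eventually_ge_at_top[of "nat \<lceil>1 / infdist x (- box a b)\<rceil>"]
      proof eventually_elim
        case (elim n)
        then have "1 / infdist x (- box a b) \<le> real n" by linarith
        then show ?case using pos by (simp add: f_def divide_le_eq)
      qed
      then show ?thesis using True by (simp add: tendsto_eventually)
    qed (simp add: f0)
    have "(\<lambda>n. \<integral>x. f n x \<partial>P) \<longlonglongrightarrow> (\<integral>x. indicator (box a b) x \<partial>P)"
      by (rule integral_dominated_convergence[where w="\<lambda>x. 1"])
         (use fb fl in \<open>auto\<close>)
    moreover have "(\<lambda>n. \<integral>y. f n y * p y \<partial>lborel) \<longlonglongrightarrow> (\<integral>y. indicator (box a b) y * p y \<partial>lborel)"
    proof (rule integral_dominated_convergence[where w="\<lambda>x. indicator (box a b) x * C"])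
      show "AE x in lborel. norm (f n x * p x) \<le> indicator (box a b) x * C" for n
        using fi p_nonneg pC by (intro AE_I2) (auto simp: abs_mult intro!: mult_mono)
    qed (use ib fl in \<open>auto intro!: tendsto_intros\<close>)
    moreover have "(\<integral>x. f n x \<partial>P) = (\<integral>y. f n y * p y \<partial>lborel)" for n
    proof (rule test[OF fc])
      show "integrable lborel (f n)"
        by (rule Bochner_Integration.integrable_bound[OF ib]) (use fi in \<open>auto\<close>)
      show "\<bar>f n x\<bar> \<le> 1" for x using fb[of n x] by auto
    qed
    ultimately have eq: "(\<integral>x. indicator (box a b) x \<partial>P) = (\<integral>y. indicator (box a b) y * p y \<partial>lborel)"
      using LIMSEQ_unique by auto
    have ip: "integrable lborel (\<lambda>y. indicator (box a b) y * p y)"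
    proof (rule Bochner_Integration.integrable_bound[OF integrable_mult_left[OF ib, of C]])
      have "C \<ge> 0" using pC[of 0] p_nonneg[of 0] by linarith
      then show "AE x in lborel. norm (indicator (box a b) x * p x) \<le> norm (indicator (box a b) x * C)"
        using p_nonneg pC by (intro AE_I2) (auto simp: abs_mult intro!: mult_mono)
    qed measurable
    have "emeasure P (box a b) = ennreal (\<integral>x. indicator (box a b) x \<partial>P)"
      by (simp add: emeasure_eq_measure)
    also have "\<dots> = (\<integral>\<^sup>+y. ennreal (indicator (box a b) y * p y) \<partial>lborel)"
      unfolding eq using ip p_nonneg by (intro nn_integral_eq_integral[symmetric]) auto
    also have "\<dots> = emeasure (density lborel (\<lambda>y. ennreal (p y))) (box a b)"
      by (subst emeasure_density) (auto simp: indicator_def intro!: nn_integral_cong)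
    finally show ?thesis .
  qed
  show "P = density lborel (\<lambda>y. ennreal (p y))"
  proof (rule measure_eqI_generator_eq[where \<Omega>=UNIV and E="range (\<lambda>(a, b). box a b)"
        and A="\<lambda>n. box (- (real n *\<^sub>R One)) (real n *\<^sub>R One)"])
    show "Int_stable (range (\<lambda>(a, b). box a b :: 'a set))"
      by (rule Int_stableI) (clarsimp simp: box_Int_box image_def, blast)
    show "sets P = sigma_sets UNIV (range (\<lambda>(a, b). box a b))"
      "sets (density lborel (\<lambda>y. ennreal (p y))) = sigma_sets UNIV (range (\<lambda>(a, b). box a b :: 'a set))"
      by (simp_all add: sP borel_eq_box)
    show "(\<Union>i. box (- (real i *\<^sub>R One)) (real i *\<^sub>R One)) = (UNIV :: 'a set)"
      by (rule UN_box_eq_UNIV)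
    show "emeasure P (box (- (real i *\<^sub>R One)) (real i *\<^sub>R One)) \<noteq> \<infinity>" for i
      by (simp add: emeasure_eq_measure)
  qed (use box in auto)
qed

lemma integrable_prod_inverse_1_plus_square:
  "integrable lborel (\<lambda>\<xi>::'a::euclidean_space. \<Prod>b\<in>Basis. inverse (1 + (\<xi> \<bullet> b)\<^sup>2))"
proof -
  have 1: "integrable lborel (\<lambda>x::real. inverse (1 + x\<^sup>2))"
    using integrable_inverse_1_plus_square by (simp add: set_integrable_def)
  have "(\<integral>\<^sup>+\<xi>. ennreal (\<Prod>b\<in>Basis. inverse (1 + (\<xi> \<bullet> b)\<^sup>2)) \<partial>(lborel :: 'a measure)) =
    (\<integral>\<^sup>+\<xi>. (\<Prod>b\<in>Basis. ennreal (inverse (1 + (\<xi> \<bullet> b)\<^sup>2))) \<partial>(lborel :: 'a measure))"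
    by (simp add: prod_ennreal)
  also have "\<dots> = (\<Prod>b\<in>(Basis :: 'a set). \<integral>\<^sup>+x. ennreal (inverse (1 + x\<^sup>2)) \<partial>lborel)"
    by (intro nn_integral_lborel_prod) auto
  also have "\<dots> = (\<Prod>b\<in>(Basis :: 'a set). ennreal (\<integral>x. inverse (1 + x\<^sup>2) \<partial>lborel))"
    using 1 by (simp add: nn_integral_eq_integral)
  also have "\<dots> < \<infinity>"
    by (simp add: ennreal_power less_top[symmetric] integral_nonneg_AE)
  finally show ?thesis
    by (intro integrableI_nonneg) (auto intro!: prod_nonneg)
qed

text \<open>
  The product \<open>\<Prod>b. 1 / (1 + (\<xi> \<bullet> b)\<^sup>2)\<close> is an integrable majorant by reduction to the real line.  Its
  reciprocal is at most \<open>2^d (1 + norm \<xi>^(2 d))\<close>, so two of the polynomial bounds dominate any moment.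
\<close>

lemma moments_integrableI:
  fixes \<psi> :: "'a::euclidean_space \<Rightarrow> complex"
  assumes [measurable]: "\<psi> \<in> borel_measurable borel"
    and decay: "\<And>m. \<exists>K. \<forall>\<xi>. norm \<xi> ^ m * cmod (\<psi> \<xi>) \<le> K"
  shows "moments_integrable \<psi>"
  unfolding moments_integrable_def
proof (intro conjI allI)
  fix k
  let ?D = "DIM('a)"
  obtain K1 where K1: "\<And>\<xi>. norm \<xi> ^ k * cmod (\<psi> \<xi>) \<le> K1" using decay by blast
  obtain K2 where K2: "\<And>\<xi>. norm \<xi> ^ (k + 2 * ?D) * cmod (\<psi> \<xi>) \<le> K2" using decay by blast
  let ?K = "2 ^ ?D * (K1 + K2)"
  show "integrable lborel (\<lambda>\<xi>. norm \<xi> ^ k * cmod (\<psi> \<xi>))"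
  proof (rule Bochner_Integration.integrable_bound)
    show "integrable lborel (\<lambda>\<xi>::'a. ?K * (\<Prod>b\<in>Basis. inverse (1 + (\<xi> \<bullet> b)\<^sup>2)))"
      using integrable_prod_inverse_1_plus_square by (rule integrable_mult_right)
    show "AE \<xi> in lborel. norm (norm \<xi> ^ k * cmod (\<psi> \<xi>)) \<le> norm (?K * (\<Prod>b\<in>Basis. inverse (1 + (\<xi> \<bullet> b)\<^sup>2)))"
    proof (rule AE_I2)
      fix \<xi> :: 'a
      let ?F = "norm \<xi> ^ k * cmod (\<psi> \<xi>)" and ?p = "\<Prod>b\<in>Basis. (1 + (\<xi> \<bullet> b)\<^sup>2)"
      have p: "0 < ?p" by (intro prod_pos) (auto simp: add_pos_nonneg)
      have "?p \<le> (\<Prod>b\<in>(Basis::'a set). 1 + (norm \<xi>)\<^sup>2)"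
        by (intro prod_mono) (auto simp: abs_le_square_iff[symmetric] Basis_le_norm)
      also have "\<dots> = (1 + (norm \<xi>)\<^sup>2) ^ ?D" by simp
      also have "\<dots> \<le> (2 * max 1 ((norm \<xi>)\<^sup>2)) ^ ?D"
        by (intro power_mono) auto
      also have "\<dots> = 2 ^ ?D * max 1 ((norm \<xi>)\<^sup>2) ^ ?D" by (simp add: power_mult_distrib)
      also have "max 1 ((norm \<xi>)\<^sup>2) ^ ?D \<le> 1 + norm \<xi> ^ (2 * ?D)"
        by (simp add: max_def power_mult)
      finally have "?p \<le> 2 ^ ?D * (1 + norm \<xi> ^ (2 * ?D))" by simp
      then have "?F * ?p \<le> ?F * (2 ^ ?D * (1 + norm \<xi> ^ (2 * ?D)))"
        by (intro mult_left_mono) auto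
      also have "\<dots> = 2 ^ ?D * (?F + norm \<xi> ^ (k + 2 * ?D) * cmod (\<psi> \<xi>))"
        by (simp add: algebra_simps power_add)
      also have "\<dots> \<le> ?K"
        by (intro mult_left_mono add_mono K1 K2) auto
      finally have "?F \<le> ?K / ?p" using p by (simp add: pos_le_divide_eq)
      also have "?K / ?p = ?K * (\<Prod>b\<in>Basis. inverse (1 + (\<xi> \<bullet> b)\<^sup>2))"
        by (simp add: divide_inverse prod_inversef[symmetric])
      finally show "norm ?F \<le> norm (?K * (\<Prod>b\<in>Basis. inverse (1 + (\<xi> \<bullet> b)\<^sup>2)))"
        by simp
    qed
  qed measurable
qed simp

theorem smooth_density_of_rapidly_decreasing_char:
  fixes P :: "(real ^ 'd) measure"
  assumes P: "prob_space P" "sets P = sets borel"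
    and decay: "\<And>m. \<exists>K. \<forall>\<xi>. norm \<xi> ^ m * cmod (\<integral>x. iexp (\<xi> \<bullet> x) \<partial>P) \<le> K"
  shows "has_smooth_density P"
proof -
  interpret prob_space P by fact
  let ?\<phi> = "\<lambda>\<xi>. \<integral>x. iexp (\<xi> \<bullet> x) \<partial>P"
  have [measurable_cong]: "sets P = sets borel" by fact
  have m: "?\<phi> \<in> borel_measurable borel"
    by (rule borel_measurable_lebesgue_integral) measurable
  have r: "moments_integrable ?\<phi>" using m decay by (rule moments_integrableI)
  have "integrable lborel (\<lambda>\<xi>. iexp (- (\<xi> \<bullet> 0)) * ?\<phi> \<xi>)"
    using r by (rule integrable_fourier_integrand)
  then have int: "integrable lborel ?\<phi>" by simp
  let ?p = "\<lambda>y. Re ((gauss_const TYPE(real ^ 'd))\<^sup>2 * fourier ?\<phi> y)"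
  have Ck: "Ck_on k UNIV ?p" for k using Re_fourier_Ck[OF r] .
  have cont: "continuous_on UNIV ?p" using Ck[of 0] by (simp only: Ck_on.simps)
  have inv: "\<And>y. 0 \<le> ?p y" "P = density lborel (\<lambda>y. ennreal (?p y))"
    using fourier_inversion_measure[OF P int cont] by blast+
  show ?thesis
    unfolding has_smooth_density_def smooth_on_def
    by (rule exI[where x="?p"], intro conjI allI; fact)
qed

text \<open>
  For \<open>r > 1\<close> compare with a single term of the exponential series, of an order \<open>n\<close> such that
  \<open>n \<alpha> \<ge> m\<close>.
\<close>

lemma power_exp_powr_bounded:
  assumes c: "0 < c" and \<alpha>: "0 < \<alpha>"
  shows "\<exists>K. \<forall>r::real. 0 \<le> r \<longrightarrow> r ^ m * exp (- (c * r powr \<alpha>)) \<le> K"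
proof -
  obtain n :: nat where n: "real m \<le> real n * \<alpha>"
    using real_arch_simple[of "real m / \<alpha>"] \<alpha> by (auto simp: divide_le_eq)
  have "r ^ m * exp (- (c * r powr \<alpha>)) \<le> max 1 (fact n / c ^ n)" if r: "0 \<le> r" for r
  proof (cases "r \<le> 1")
    case True
    have "r ^ m * exp (- (c * r powr \<alpha>)) \<le> 1 * 1"
      using True r c by (intro mult_mono power_le_one) auto
    then show ?thesis by simp
  next
    case False
    let ?y = "c * r powr \<alpha>"
    have y: "0 \<le> ?y" using c by simp
    have "(\<Sum>k\<in>{n}. inverse (fact k) * ?y ^ k) \<le> (\<Sum>k. inverse (fact k) * ?y ^ k)"
      using y summable_exp by (intro sum_le_suminf) auto
    then have "?y ^ n / fact n \<le> exp ?y"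
      by (simp add: exp_def divide_inverse mult.commute)
    moreover have "r ^ m \<le> (r powr \<alpha>) ^ n"
    proof -
      have "r ^ m = r powr real m" using False by (simp add: powr_realpow)
      also have "\<dots> \<le> r powr (real n * \<alpha>)" using False n by (intro powr_mono) auto
      also have "\<dots> = (r powr \<alpha>) ^ n" using False by (simp add: powr_realpow[symmetric] powr_powr mult.commute)
      finally show ?thesis .
    qed
    then have "c ^ n * r ^ m \<le> c ^ n * (r powr \<alpha>) ^ n"
      using c by (intro mult_left_mono) auto
    ultimately have "c ^ n * r ^ m \<le> fact n * exp ?y"
      by (simp add: power_mult_distrib divide_le_eq mult.commute)
    then have "r ^ m * exp (- ?y) \<le> fact n / c ^ n"
      using c by (simp add: exp_minus field_simps)
    then show ?thesis by simp
  qed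
  then show ?thesis by blast
qed

section \<open>Integrals against Poisson random measures\<close>

text \<open>
  A random measure is measurable set by set; the three lemmas below pass from sets to integrals.
  The measures \<open>N \<omega>\<close> need not be finite, so the Giry monad of subprobabilities does not apply.
\<close>

lemma nn_integral_random_measure_measurable:
  assumes sets: "\<And>\<omega>. \<omega> \<in> space M \<Longrightarrow> sets (N \<omega>) = sets \<mu>"
    and meas: "\<And>S. S \<in> sets \<mu> \<Longrightarrow> (\<lambda>\<omega>. emeasure (N \<omega>) S) \<in> borel_measurable M"
    and f: "f \<in> borel_measurable \<mu>"
  shows "(\<lambda>\<omega>. \<integral>\<^sup>+x. f x \<partial>N \<omega>) \<in> borel_measurable M"
  using f
proof (induct rule: borel_measurable_induct)
  case (cong f g)
  have "(\<integral>\<^sup>+x. f x \<partial>N \<omega>) = (\<integral>\<^sup>+x. g x \<partial>N \<omega>)" if "\<omega> \<in> space M" for \<omega>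
    using cong sets_eq_imp_space_eq[OF sets[OF that]] by (intro nn_integral_cong) auto
  with cong(4) show ?case
    by (simp cong: measurable_cong)
next
  case (set A)
  have "(\<integral>\<^sup>+x. indicator A x \<partial>N \<omega>) = emeasure (N \<omega>) A" if "\<omega> \<in> space M" for \<omega>
    using set sets[OF that] by (intro nn_integral_indicator) auto
  with meas[OF set] show ?case
    by (simp cong: measurable_cong)
next
  case (mult u c)
  have "(\<integral>\<^sup>+x. c * u x \<partial>N \<omega>) = c * (\<integral>\<^sup>+x. u x \<partial>N \<omega>)" if "\<omega> \<in> space M" for \<omega>
    using mult sets[OF that] by (intro nn_integral_cmult) (auto cong: measurable_cong_sets)
  then have "(\<lambda>\<omega>. \<integral>\<^sup>+x. c * u x \<partial>N \<omega>) \<in> borel_measurable M \<longleftrightarrow>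
      (\<lambda>\<omega>. c * (\<integral>\<^sup>+x. u x \<partial>N \<omega>)) \<in> borel_measurable M"
    by (intro measurable_cong) auto
  with mult show ?case by simp
next
  case (add u v)
  have "(\<integral>\<^sup>+x. v x + u x \<partial>N \<omega>) = (\<integral>\<^sup>+x. v x \<partial>N \<omega>) + (\<integral>\<^sup>+x. u x \<partial>N \<omega>)" if "\<omega> \<in> space M" for \<omega>
    using add sets[OF that] by (intro nn_integral_add) (auto cong: measurable_cong_sets)
  then have "(\<lambda>\<omega>. \<integral>\<^sup>+x. v x + u x \<partial>N \<omega>) \<in> borel_measurable M \<longleftrightarrow>
      (\<lambda>\<omega>. (\<integral>\<^sup>+x. v x \<partial>N \<omega>) + (\<integral>\<^sup>+x. u x \<partial>N \<omega>)) \<in> borel_measurable M"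
    by (intro measurable_cong) auto
  with add show ?case by simp
next
  case (seq U)
  have "(\<integral>\<^sup>+x. (SUP i. U i) x \<partial>N \<omega>) = (SUP i. \<integral>\<^sup>+x. U i x \<partial>N \<omega>)" if "\<omega> \<in> space M" for \<omega>
    unfolding SUP_apply using seq sets[OF that]
    by (intro nn_integral_monotone_convergence_SUP) (auto cong: measurable_cong_sets)
  then have "(\<lambda>\<omega>. \<integral>\<^sup>+x. (SUP i. U i) x \<partial>N \<omega>) \<in> borel_measurable M \<longleftrightarrow>
      (\<lambda>\<omega>. (SUP i. \<integral>\<^sup>+x. U i x \<partial>N \<omega>)) \<in> borel_measurable M"
    by (intro measurable_cong) auto
  with seq show ?case by simp
qed

lemma real_integral_random_measure_measurable:
  fixes f :: "'e \<Rightarrow> real"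
  assumes sets: "\<And>\<omega>. \<omega> \<in> space M \<Longrightarrow> sets (N \<omega>) = sets \<mu>"
    and meas: "\<And>S. S \<in> sets \<mu> \<Longrightarrow> (\<lambda>\<omega>. emeasure (N \<omega>) S) \<in> borel_measurable M"
    and f[measurable]: "f \<in> borel_measurable \<mu>"
  shows "(\<lambda>\<omega>. if integrable (N \<omega>) f then integral\<^sup>L (N \<omega>) f else 0) \<in> borel_measurable M"
    and "{\<omega> \<in> space M. integrable (N \<omega>) f} \<in> sets M"
proof -
  note m = nn_integral_random_measure_measurable[OF sets meas]
  have int: "integrable (N \<omega>) f \<longleftrightarrow> (\<integral>\<^sup>+x. ennreal (norm (f x)) \<partial>N \<omega>) < \<infinity>" if "\<omega> \<in> space M" for \<omega>
    using sets[OF that] f by (auto simp: integrable_iff_bounded cong: measurable_cong_sets)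
  have [measurable]: "(\<lambda>\<omega>. \<integral>\<^sup>+x. ennreal (norm (f x)) \<partial>N \<omega>) \<in> borel_measurable M"
    "(\<lambda>\<omega>. \<integral>\<^sup>+x. ennreal (f x) \<partial>N \<omega>) \<in> borel_measurable M"
    "(\<lambda>\<omega>. \<integral>\<^sup>+x. ennreal (- f x) \<partial>N \<omega>) \<in> borel_measurable M"
    by (auto intro!: m)
  have "{\<omega> \<in> space M. integrable (N \<omega>) f} =
      {\<omega> \<in> space M. (\<integral>\<^sup>+x. ennreal (norm (f x)) \<partial>N \<omega>) < \<infinity>}"
    using int by auto
  also have "\<dots> \<in> sets M" by measurable
  finally show "{\<omega> \<in> space M. integrable (N \<omega>) f} \<in> sets M" .
  have "(\<lambda>\<omega>. if integrable (N \<omega>) f then integral\<^sup>L (N \<omega>) f else 0) \<in> borel_measurable M \<longleftrightarrow>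
    (\<lambda>\<omega>. if (\<integral>\<^sup>+x. ennreal (norm (f x)) \<partial>N \<omega>) < \<infinity>
      then enn2real (\<integral>\<^sup>+x. ennreal (f x) \<partial>N \<omega>) - enn2real (\<integral>\<^sup>+x. ennreal (- f x) \<partial>N \<omega>) else 0)
      \<in> borel_measurable M"
    by (intro measurable_cong) (auto simp: int real_lebesgue_integral_def)
  also have "\<dots>" by measurable
  finally show "(\<lambda>\<omega>. if integrable (N \<omega>) f then integral\<^sup>L (N \<omega>) f else 0) \<in> borel_measurable M" .
qed

lemma integral_random_measure_measurable:
  fixes f :: "'e \<Rightarrow> 'a::euclidean_space"
  assumes sets: "\<And>\<omega>. \<omega> \<in> space M \<Longrightarrow> sets (N \<omega>) = sets \<mu>"
    and meas: "\<And>S. S \<in> sets \<mu> \<Longrightarrow> (\<lambda>\<omega>. emeasure (N \<omega>) S) \<in> borel_measurable M"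
    and f[measurable]: "f \<in> borel_measurable \<mu>"
  shows "(\<lambda>\<omega>. integral\<^sup>L (N \<omega>) f) \<in> borel_measurable M"
proof -
  have int: "integrable (N \<omega>) f \<longleftrightarrow> integrable (N \<omega>) (\<lambda>x. norm (f x))" if "\<omega> \<in> space M" for \<omega>
    using sets[OF that] f by (auto simp: integrable_norm_iff cong: measurable_cong_sets)
  note r = real_integral_random_measure_measurable[OF sets meas]
  have [measurable]: "{\<omega> \<in> space M. integrable (N \<omega>) (\<lambda>x. norm (f x))} \<in> sets M"
    by (intro r) auto
  have "(\<lambda>\<omega>. integral\<^sup>L (N \<omega>) f \<bullet> b) \<in> borel_measurable M" for b
  proof -
    have [measurable]: "(\<lambda>\<omega>. if integrable (N \<omega>) (\<lambda>x. f x \<bullet> b) then \<integral>x. f x \<bullet> b \<partial>N \<omega> else 0)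
        \<in> borel_measurable M"
      by (intro r) auto
    have "(\<lambda>\<omega>. integral\<^sup>L (N \<omega>) f \<bullet> b) \<in> borel_measurable M \<longleftrightarrow>
      (\<lambda>\<omega>. if integrable (N \<omega>) (\<lambda>x. norm (f x)) then
          (if integrable (N \<omega>) (\<lambda>x. f x \<bullet> b) then \<integral>x. f x \<bullet> b \<partial>N \<omega> else 0) else 0)
      \<in> borel_measurable M"
      by (intro measurable_cong) (auto simp: int[symmetric] not_integrable_integral_eq)
    then show ?thesis by simp
  qed
  then show ?thesis
    by (subst borel_measurable_euclidean_space) auto
qed

locale poisson_measure = prob_space M for M :: "'w measure" +
  fixes \<mu> :: "'e measure" and N :: "'w \<Rightarrow> 'e measure"
  assumes prm: "poisson_random_measure M \<mu> N"
begin

lemma sets_N: "\<omega> \<in> space M \<Longrightarrow> sets (N \<omega>) = sets \<mu>"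
  using prm by (simp add: poisson_random_measure_def)

lemma space_N: "\<omega> \<in> space M \<Longrightarrow> space (N \<omega>) = space \<mu>"
  using sets_eq_imp_space_eq[OF sets_N] .

lemma count_measurable: "S \<in> sets \<mu> \<Longrightarrow> (\<lambda>\<omega>. emeasure (N \<omega>) S) \<in> borel_measurable M"
  using prm by (simp add: poisson_random_measure_def)

lemma measurable_N: "\<omega> \<in> space M \<Longrightarrow> f \<in> borel_measurable \<mu> \<Longrightarrow> f \<in> borel_measurable (N \<omega>)"
  using sets_N by (auto cong: measurable_cong_sets)

lemma integral_N_measurable:
  fixes f :: "'e \<Rightarrow> 'a::euclidean_space"
  shows "f \<in> borel_measurable \<mu> \<Longrightarrow> (\<lambda>\<omega>. integral\<^sup>L (N \<omega>) f) \<in> borel_measurable M"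
  by (intro integral_random_measure_measurable[where \<mu>=\<mu>] sets_N count_measurable)

lemma prob_count:
  "S \<in> sets \<mu> \<Longrightarrow> emeasure \<mu> S < \<infinity> \<Longrightarrow>
    prob {\<omega> \<in> space M. emeasure (N \<omega>) S = of_nat k} = measure \<mu> S ^ k / fact k * exp (- measure \<mu> S)"
  using prm by (simp add: poisson_random_measure_def)

lemma indep_counts:
  "finite F \<Longrightarrow> F \<subseteq> sets \<mu> \<Longrightarrow> disjoint F \<Longrightarrow>
    indep_vars (\<lambda>_. borel) (\<lambda>S \<omega>. emeasure (N \<omega>) S) F"
  using prm by (simp add: poisson_random_measure_def)

text \<open>
  The point probabilities of the Poisson distribution add up to one, so the count of a set of finite
  intensity is almost surely a natural number.
\<close>

lemma AE_count_nat:
  assumes S: "S \<in> sets \<mu>" "emeasure \<mu> S < \<infinity>"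
  shows "AE \<omega> in M. \<omega> \<in> (\<Union>k::nat. {\<omega> \<in> space M. emeasure (N \<omega>) S = of_nat k})"
proof -
  note [measurable] = count_measurable[OF S(1)]
  let ?A = "\<lambda>k::nat. {\<omega> \<in> space M. emeasure (N \<omega>) S = of_nat k}"
  have "(\<lambda>k. prob (?A k)) sums prob (\<Union>k. ?A k)"
    by (intro finite_measure_UNION) (auto simp: disjoint_family_on_def)
  moreover have "(\<lambda>k. prob (?A k)) sums (exp (measure \<mu> S) * exp (- measure \<mu> S))"
    unfolding prob_count[OF S]
    by (intro sums_mult2) (use exp_converges[of "measure \<mu> S"] in \<open>simp add: divide_inverse mult.commute\<close>)
  ultimately have "prob (\<Union>k. ?A k) = 1"
    by (simp add: sums_iff exp_minus)
  then show ?thesis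
    by (subst (asm) prob_eq_1) auto
qed

lemma AE_count_finite:
  assumes S: "S \<in> sets \<mu>" "emeasure \<mu> S < \<infinity>"
  shows "AE \<omega> in M. emeasure (N \<omega>) S < \<infinity>"
  using AE_count_nat[OF S] by eventually_elim (auto simp: ennreal_of_nat_eq_real_of_nat)

lemma char_count:
  assumes S: "S \<in> sets \<mu>" "emeasure \<mu> S < \<infinity>"
  shows "(\<integral>\<omega>. iexp (u * measure (N \<omega>) S) \<partial>M) = exp (measure \<mu> S * (iexp u - 1))"
proof -
  note [measurable] = count_measurable[OF S(1)]
  have [measurable]: "(\<lambda>\<omega>. measure (N \<omega>) S) \<in> borel_measurable M"
    unfolding measure_def by measurable
  let ?A = "\<lambda>k::nat. {\<omega> \<in> space M. emeasure (N \<omega>) S = of_nat k}"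
  let ?f = "\<lambda>\<omega>. iexp (u * measure (N \<omega>) S)"
  have int: "integrable M ?f"
    by (intro integrable_const_bound[of _ 1]) auto
  have "(\<integral>\<omega>. ?f \<omega> \<partial>M) = (LINT \<omega>:(\<Union>k. ?A k)|M. ?f \<omega>)"
    unfolding set_lebesgue_integral_def
  proof (intro integral_cong_AE eventually_mono[OF AE_count_nat[OF S]])
    fix \<omega> assume "\<omega> \<in> (\<Union>k. ?A k)"
    then have "indicator (\<Union>k. ?A k) \<omega> = (1::real)" by (rule indicator_simps)
    then show "?f \<omega> = indicator (\<Union>k. ?A k) \<omega> *\<^sub>R ?f \<omega>" by (simp only: scaleR_one)
  qed auto
  also have "\<dots> = (\<Sum>k. LINT \<omega>:?A k|M. ?f \<omega>)"
  proof (intro lebesgue_integral_countable_add)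
    show "set_integrable M (\<Union>k. ?A k) ?f"
      unfolding set_integrable_def by (intro integrable_mult_indicator int) measurable
  qed auto
  also have "(\<lambda>k. LINT \<omega>:?A k|M. ?f \<omega>) =
      (\<lambda>k. (iexp u * measure \<mu> S) ^ k /\<^sub>R fact k * exp (- measure \<mu> S))"
  proof
    fix k
    have "(LINT \<omega>:?A k|M. ?f \<omega>) = (\<integral>\<omega>. indicator (?A k) \<omega> *\<^sub>R iexp (u * k) \<partial>M)"
      unfolding set_lebesgue_integral_def
      by (intro Bochner_Integration.integral_cong) (auto simp: measure_def indicator_def)
    also have "\<dots> = prob (?A k) *\<^sub>R iexp (u * k)"
      by (subst integral_scaleR_left) (auto simp: integrable_indicator_iff less_top[symmetric])
    also have "iexp (u * k) = iexp u ^ k"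
      by (simp add: exp_of_nat_mult[symmetric] mult_ac)
    finally show "(LINT \<omega>:?A k|M. ?f \<omega>) = (iexp u * measure \<mu> S) ^ k /\<^sub>R fact k * exp (- measure \<mu> S)"
      by (simp add: prob_count[OF S] power_mult_distrib scaleR_conv_of_real divide_inverse mult_ac exp_of_real)
  qed
  also have "(\<Sum>k. (iexp u * measure \<mu> S) ^ k /\<^sub>R fact k * exp (- measure \<mu> S)) =
      exp (iexp u * measure \<mu> S) * exp (- measure \<mu> S)"
    by (intro sums_unique[symmetric] sums_mult2 exp_converges)
  finally show ?thesis
    by (simp add: exp_add[symmetric] exp_of_real[symmetric] algebra_simps)
qed

lemma char_counts:
  assumes F: "finite F" "F \<subseteq> sets \<mu>" "disjoint F" "\<And>T. T \<in> F \<Longrightarrow> emeasure \<mu> T < \<infinity>"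
  shows "cmod (\<integral>\<omega>. iexp (\<Sum>T\<in>F. c T * measure (N \<omega>) T) \<partial>M) =
    exp (- (\<Sum>T\<in>F. measure \<mu> T * (1 - cos (c T))))"
proof -
  have indep: "indep_vars (\<lambda>_. borel) (\<lambda>T \<omega>. iexp (c T * measure (N \<omega>) T)) F"
    unfolding measure_def by (rule indep_vars_compose2[OF indep_counts[OF F(1-3)]]) measurable
  have meas: "(\<lambda>\<omega>. iexp (c T * measure (N \<omega>) T)) \<in> borel_measurable M" if "T \<in> F" for T
    using indep that by (auto simp: indep_vars_def)
  have "(\<integral>\<omega>. iexp (\<Sum>T\<in>F. c T * measure (N \<omega>) T) \<partial>M) =
      (\<integral>\<omega>. (\<Prod>T\<in>F. iexp (c T * measure (N \<omega>) T)) \<partial>M)"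
    by (simp add: exp_sum[OF F(1), symmetric] sum_distrib_left)
  also have "\<dots> = (\<Prod>T\<in>F. \<integral>\<omega>. iexp (c T * measure (N \<omega>) T) \<partial>M)"
    using meas by (intro indep_vars_lebesgue_integral F indep integrable_const_bound[of _ 1]) auto
  also have "\<dots> = (\<Prod>T\<in>F. exp (measure \<mu> T * (iexp (c T) - 1)))"
    using F by (intro prod.cong refl char_count) auto
  also have "cmod \<dots> = (\<Prod>T\<in>F. exp (- (measure \<mu> T * (1 - cos (c T)))))"
    by (simp add: prod_norm[symmetric] Re_exp algebra_simps)
  also have "\<dots> = exp (- (\<Sum>T\<in>F. measure \<mu> T * (1 - cos (c T))))"
    using F by (simp add: exp_sum sum_negf[symmetric])
  finally show ?thesis .
qed

text \<open>
  A simple function takes each nonzero value on one of finitely many disjoint sets, so its integral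
  is a linear combination of independent Poisson counts.
\<close>

lemma char_simple_integral:
  fixes g :: "'e \<Rightarrow> real"
  assumes g: "simple_function \<mu> g" and fin: "emeasure \<mu> {x \<in> space \<mu>. g x \<noteq> 0} < \<infinity>"
  shows "cmod (\<integral>\<omega>. iexp (\<integral>x. g x \<partial>N \<omega>) \<partial>M) = exp (- (\<integral>x. 1 - cos (g x) \<partial>\<mu>))"
proof -
  define T where "T y = {x \<in> space \<mu>. g x = y}" for y
  define V where "V = g ` space \<mu> - {0}"
  have V: "finite V" using g by (auto simp: V_def simple_function_def)
  have g_meas[measurable]: "g \<in> borel_measurable \<mu>" using g by (rule borel_measurable_simple_function)
  have T_sets[measurable]: "T y \<in> sets \<mu>" for y unfolding T_def by measurable
  have T_fin: "emeasure \<mu> (T y) < \<infinity>" if "y \<in> V" for y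
    using that by (intro le_less_trans[OF emeasure_mono fin]) (auto simp: V_def T_def)
  have inj: "inj_on T V"
    by (auto simp: inj_on_def T_def V_def)
  have T_inv: "inv_into V T (T y) = y" if "y \<in> V" for y
    using inv_into_f_f[OF inj that] .
  have lin: "(\<integral>x. h (g x) \<partial>R) = (\<Sum>y\<in>V. measure R (T y) * h y)"
    if R: "sets R = sets \<mu>" "emeasure R {x \<in> space \<mu>. g x \<noteq> 0} < \<infinity>" and h: "h 0 = 0" for R and h :: "real \<Rightarrow> real"
  proof -
    have sp: "space R = space \<mu>" by (rule sets_eq_imp_space_eq) fact
    have sg: "simple_function R g" using g R(1) sp by (simp add: simple_function_def)
    have sb: "Bochner_Integration.simple_bochner_integrable R (\<lambda>x. h (g x))"
      unfolding simple_bochner_integrable.simps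
    proof
      show "simple_function R (\<lambda>x. h (g x))"
        using sg by (rule simple_function_compose1)
      have "emeasure R {x \<in> space R. h (g x) \<noteq> 0} \<le> emeasure R {x \<in> space \<mu>. g x \<noteq> 0}"
        using h R(1) by (intro emeasure_mono) (auto simp: sp)
      then show "emeasure R {x \<in> space R. h (g x) \<noteq> 0} \<noteq> \<infinity>" using R(2) by (auto simp: top_unique)
    qed
    have "(\<integral>x. h (g x) \<partial>R) = (\<Sum>y\<in>g ` space \<mu>. measure R (T y) *\<^sub>R h y)"
      unfolding simple_bochner_integrable_eq_integral[OF sb, symmetric] T_def sp[symmetric]
      by (intro simple_bochner_integral_partition sb sg) auto
    also have "\<dots> = (\<Sum>y\<in>V. measure R (T y) *\<^sub>R h y)"
      using g h by (intro sum.mono_neutral_right) (auto simp: V_def simple_function_def)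
    finally show ?thesis by simp
  qed
  have "AE \<omega> in M. emeasure (N \<omega>) {x \<in> space \<mu>. g x \<noteq> 0} < \<infinity>"
    using fin by (intro AE_count_finite) auto
  define Z where "Z \<omega> = (\<Sum>S\<in>T ` V. inv_into V T S * measure (N \<omega>) S)" for \<omega>
  from \<open>AE \<omega> in M. emeasure (N \<omega>) _ < \<infinity>\<close> have "AE \<omega> in M. (\<integral>x. g x \<partial>N \<omega>) = Z \<omega>"
    using AE_space
    by eventually_elim
       (use lin[of "N _" "\<lambda>x. x"] in \<open>simp add: Z_def sets_N sum.reindex[OF inj] T_inv mult.commute\<close>)
  moreover have [measurable]: "Z \<in> borel_measurable M"
    using count_measurable[OF T_sets] unfolding Z_def measure_def by (intro borel_measurable_sum) auto
  ultimately have "(\<integral>\<omega>. iexp (\<integral>x. g x \<partial>N \<omega>) \<partial>M) =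
      (\<integral>\<omega>. iexp (Z \<omega>) \<partial>M)"
    using integral_N_measurable[OF g_meas]
    by (intro integral_cong_AE) (auto elim!: eventually_mono)
  also have "cmod \<dots> = exp (- (\<Sum>S\<in>T ` V. measure \<mu> S * (1 - cos (inv_into V T S))))"
    unfolding Z_def using V T_fin by (intro char_counts) (auto simp: disjoint_def T_def)
  also have "(\<Sum>S\<in>T ` V. measure \<mu> S * (1 - cos (inv_into V T S))) = (\<integral>x. 1 - cos (g x) \<partial>\<mu>)"
    using lin[OF refl fin, of "\<lambda>x. 1 - cos x"] by (simp add: sum.reindex[OF inj] T_inv)
  finally show ?thesis .
qed

text \<open>
  The Levy-Khinchin formula for a compound Poisson variable, in absolute value.  Simple functions
  approximate \<open>h\<close>, and dominated convergence applies under \<open>N\<close> and under the intensity alike, because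
  \<open>h\<close> is bounded and \<open>S\<close> has finite measure under both, almost surely in the case of \<open>N\<close>.
\<close>

lemma char_integral:
  fixes h :: "'e \<Rightarrow> real"
  assumes h[measurable]: "h \<in> borel_measurable \<mu>" and S[measurable]: "S \<in> sets \<mu>" "emeasure \<mu> S < \<infinity>"
    and supp: "\<And>x. x \<notin> S \<Longrightarrow> h x = 0" and bnd: "\<And>x. \<bar>h x\<bar> \<le> K"
  shows "cmod (\<integral>\<omega>. iexp (\<integral>x. h x \<partial>N \<omega>) \<partial>M) = exp (- (\<integral>x. 1 - cos (h x) \<partial>\<mu>))"
proof -
  obtain g where g: "\<And>i. simple_function \<mu> (g i)" "\<And>x. x \<in> space \<mu> \<Longrightarrow> (\<lambda>i. g i x) \<longlonglongrightarrow> h x"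
    and gh: "\<And>i x. x \<in> space \<mu> \<Longrightarrow> \<bar>g i x\<bar> \<le> 2 * \<bar>h x\<bar>"
    using borel_measurable_implies_sequence_metric[OF h, of 0]
    unfolding dist_norm diff_zero real_norm_def by metis
  have [measurable]: "g i \<in> borel_measurable \<mu>" for i
    using g(1) by (rule borel_measurable_simple_function)
  have g0: "g i x = 0" if "x \<notin> S" "x \<in> space \<mu>" for i x
    using gh[OF that(2), of i] supp[OF that(1)] by simp
  have K: "0 \<le> K" using bnd[of undefined] by linarith
  have gK: "\<bar>g i x\<bar> \<le> 2 * K * indicator S x" if "x \<in> space \<mu>" for i x
    using gh[OF that, of i] bnd[of x] g0[of x i] that by (auto simp: indicator_def)
  have "AE \<omega> in M. emeasure (N \<omega>) S < \<infinity>"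
    by (intro AE_count_finite S)
  then have lim: "AE \<omega> in M. (\<lambda>i. \<integral>x. g i x \<partial>N \<omega>) \<longlonglongrightarrow> (\<integral>x. h x \<partial>N \<omega>)"
    using AE_space
  proof eventually_elim
    case (elim \<omega>)
    note measurable_N[OF elim(2), measurable]
    have [measurable]: "S \<in> sets (N \<omega>)" using S sets_N[OF elim(2)] by simp
    show ?case
    proof (rule integral_dominated_convergence[where w="\<lambda>x. 2 * K * indicator S x"])
      show "integrable (N \<omega>) (\<lambda>x. 2 * K * indicator S x)"
        using elim by (intro integrable_mult_right) (auto simp: integrable_indicator_iff)
      show "AE x in N \<omega>. (\<lambda>i. g i x) \<longlonglongrightarrow> h x"
        using g(2) space_N[OF elim(2)] by (intro AE_I2) auto
      show "AE x in N \<omega>. norm (g i x) \<le> 2 * K * indicator S x" for i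
        using gK space_N[OF elim(2)] by (intro AE_I2) auto
    qed measurable
  qed
  have "(\<lambda>i. \<integral>\<omega>. iexp (\<integral>x. g i x \<partial>N \<omega>) \<partial>M) \<longlonglongrightarrow> (\<integral>\<omega>. iexp (\<integral>x. h x \<partial>N \<omega>) \<partial>M)"
  proof (rule integral_dominated_convergence[where w="\<lambda>x. 1"])
    show "AE \<omega> in M. (\<lambda>i. iexp (\<integral>x. g i x \<partial>N \<omega>)) \<longlonglongrightarrow> iexp (\<integral>x. h x \<partial>N \<omega>)"
      using lim by eventually_elim (intro tendsto_intros)
  qed (use integral_N_measurable[of h] integral_N_measurable[of "g _"] in auto)
  then have "(\<lambda>i. cmod (\<integral>\<omega>. iexp (\<integral>x. g i x \<partial>N \<omega>) \<partial>M)) \<longlonglongrightarrow> cmod (\<integral>\<omega>. iexp (\<integral>x. h x \<partial>N \<omega>) \<partial>M)"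
    by (rule tendsto_norm)
  moreover have "cmod (\<integral>\<omega>. iexp (\<integral>x. g i x \<partial>N \<omega>) \<partial>M) = exp (- (\<integral>x. 1 - cos (g i x) \<partial>\<mu>))" for i
    using g0 by (intro char_simple_integral g(1) le_less_trans[OF emeasure_mono S(2)]) auto
  moreover have "(\<lambda>i. exp (- (\<integral>x. 1 - cos (g i x) \<partial>\<mu>))) \<longlonglongrightarrow> exp (- (\<integral>x. 1 - cos (h x) \<partial>\<mu>))"
  proof (intro tendsto_intros integral_dominated_convergence[where w="\<lambda>x. 2 * indicator S x"])
    show "integrable \<mu> (\<lambda>x. 2 * indicator S x :: real)"
      using S by (intro integrable_mult_right) (auto simp: integrable_indicator_iff)
    show "AE x in \<mu>. (\<lambda>i. 1 - cos (g i x)) \<longlonglongrightarrow> 1 - cos (h x)"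
      using g(2) by (intro AE_I2 tendsto_intros) auto
    show "AE x in \<mu>. norm (1 - cos (g i x)) \<le> 2 * indicator S x" for i
    proof (rule AE_I2)
      fix x assume "x \<in> space \<mu>"
      then show "norm (1 - cos (g i x)) \<le> 2 * indicator S x"
        using g0[of x i] abs_cos_le_one[of "g i x"] by (auto simp: indicator_def)
    qed
  qed measurable
  ultimately show ?thesis
    using LIMSEQ_unique by auto
qed

end

section \<open>Linear combinations of the values of a pure jump process\<close>

text \<open>
  Jumps of size in \<open>(\<delta>, R]\<close> up to time \<open>t\<close>.  Such a set has finite intensity as soon as \<open>\<delta> > 0\<close>.
\<close>

definition slab :: "real \<Rightarrow> real \<Rightarrow> real \<Rightarrow> ('a::real_normed_vector \<times> real) set" where
  "slab \<delta> R t = {(z, s). \<delta> < norm z \<and> norm z \<le> R \<and> 0 < s \<and> s \<le> t}"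

lemma slab_times: "slab \<delta> R t = {z. \<delta> < norm z \<and> norm z \<le> R} \<times> {0<..t}"
  by (auto simp: slab_def)

lemma sets_jump_intensity_Times:
  assumes \<nu>: "levy_measure \<nu>" and A: "A \<in> sets borel" "0 \<notin> A" and a: "0 \<le> a"
  shows "A \<times> {a<..b} \<in> sets (jump_intensity \<nu>)"
proof -
  have s: "sets \<nu> = sets borel" using \<nu> by (simp add: levy_measure_def)
  have "A \<in> sets (restrict_space \<nu> (- {0}))"
    using A s by (auto simp: sets_restrict_space_iff)
  moreover have "{a<..b} \<in> sets (restrict_space lborel {0..})"
    using a by (subst sets_restrict_space_iff) auto
  ultimately show ?thesis
    unfolding jump_intensity_def by (intro pair_measureI)
qed

lemma emeasure_jump_intensity_Times:
  assumes \<nu>: "levy_measure \<nu>" and A: "A \<in> sets borel" "0 \<notin> A" and a: "0 \<le> a" "a \<le> b"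
  shows "emeasure (jump_intensity \<nu>) (A \<times> {a<..b}) = emeasure \<nu> A * ennreal (b - a)"
proof -
  have s: "sets \<nu> = sets borel" using \<nu> by (simp add: levy_measure_def)
  have sA: "A \<in> sets (restrict_space \<nu> (- {0}))"
    using A s by (auto simp: sets_restrict_space_iff)
  have sI: "{a<..b} \<in> sets (restrict_space lborel {0..})"
    using a by (subst sets_restrict_space_iff) auto
  interpret sigma_finite_measure "restrict_space lborel {0::real..}"
    by (intro sigma_finite_measure_restrict_space lborel.sigma_finite_measure_axioms) auto
  have "emeasure (jump_intensity \<nu>) (A \<times> {a<..b}) =
      emeasure (restrict_space \<nu> (- {0})) A * emeasure (restrict_space lborel {0..}) {a<..b}"
    unfolding jump_intensity_def by (rule emeasure_pair_measure_Times[OF sA sI])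
  also have "emeasure (restrict_space \<nu> (- {0})) A = emeasure \<nu> A"
    using A s by (intro emeasure_restrict_space) auto
  also have "emeasure (restrict_space lborel {0..}) {a<..b} = ennreal (b - a)"
    using a by (subst emeasure_restrict_space) auto
  finally show ?thesis .
qed

lemma measurable_fst_jump_intensity: "levy_measure \<nu> \<Longrightarrow> fst \<in> borel_measurable (jump_intensity \<nu>)"
  unfolding jump_intensity_def levy_measure_def
  by (rule measurable_compose[OF measurable_fst], rule measurable_restrict_space1)
     (auto cong: measurable_cong_sets)

lemma levy_measure_tail_finite:
  assumes \<nu>: "levy_measure \<nu>" and \<delta>: "0 < \<delta>"
  shows "emeasure \<nu> {z. \<delta> < norm z} < \<infinity>"
proof -
  have s[measurable_cong]: "sets \<nu> = sets borel"
    and fin: "(\<integral>\<^sup>+ z. ennreal (min 1 ((norm z)\<^sup>2)) \<partial>\<nu>) < \<infinity>"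
    using \<nu> by (auto simp: levy_measure_def)
  have sp: "space \<nu> = UNIV" using sets_eq_imp_space_eq[OF s] by simp
  have [measurable]: "{z. \<delta> < norm z} \<in> sets borel" by measurable
  let ?m = "min 1 (\<delta>\<^sup>2)"
  have m: "0 < ?m" using \<delta> by simp
  have "ennreal ?m * emeasure \<nu> {z. \<delta> < norm z} = (\<integral>\<^sup>+ z. ennreal ?m * indicator {z. \<delta> < norm z} z \<partial>\<nu>)"
    by (subst nn_integral_cmult_indicator) (auto simp: s)
  also have "\<dots> \<le> (\<integral>\<^sup>+ z. ennreal (min 1 ((norm z)\<^sup>2)) \<partial>\<nu>)"
  proof (rule nn_integral_mono)
    fix z
    have "\<delta>\<^sup>2 \<le> (norm z)\<^sup>2" if "\<delta> < norm z" using that \<delta> by (intro power_mono) auto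
    then show "ennreal ?m * indicator {z. \<delta> < norm z} z \<le> ennreal (min 1 ((norm z)\<^sup>2))"
      by (auto simp: indicator_def intro!: ennreal_leI)
  qed
  finally have "ennreal ?m * emeasure \<nu> {z. \<delta> < norm z} < \<infinity>" using fin by (rule le_less_trans)
  then show ?thesis using m by (auto simp: ennreal_mult_less_top)
qed

lemma slab_sets: "levy_measure \<nu> \<Longrightarrow> 0 \<le> \<delta> \<Longrightarrow> slab \<delta> R t \<in> sets (jump_intensity \<nu>)"
  unfolding slab_times by (rule sets_jump_intensity_Times) auto

lemma emeasure_slab_le:
  fixes \<nu> :: "(real ^ 'd) measure"
  assumes "levy_measure \<nu>" "0 < \<delta>" "0 \<le> t"
  shows "emeasure (jump_intensity \<nu>) (slab \<delta> R t) \<le> emeasure \<nu> {z. \<delta> < norm z} * ennreal t"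
proof -
  have s: "sets \<nu> = sets borel" using assms by (simp add: levy_measure_def)
  have m: "{z :: real ^ 'd. \<delta> < norm z} \<in> sets borel" by measurable
  have m': "{z :: real ^ 'd. \<delta> < norm z \<and> norm z \<le> R} \<in> sets borel" by measurable
  have "emeasure \<nu> {z. \<delta> < norm z \<and> norm z \<le> R} \<le> emeasure \<nu> {z. \<delta> < norm z}"
    using m s by (intro emeasure_mono) auto
  then have "emeasure \<nu> {z. \<delta> < norm z \<and> norm z \<le> R} * ennreal t \<le> emeasure \<nu> {z. \<delta> < norm z} * ennreal t"
    by (rule mult_right_mono) simp
  moreover have "emeasure (jump_intensity \<nu>) (slab \<delta> R t) = emeasure \<nu> {z. \<delta> < norm z \<and> norm z \<le> R} * ennreal t"
    unfolding slab_times using emeasure_jump_intensity_Times[OF assms(1) m' _ order_refl assms(3)] assms(2) by simp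
  ultimately show ?thesis by simp
qed

lemma emeasure_slab_finite:
  assumes "levy_measure \<nu>" "0 < \<delta>" "0 \<le> t"
  shows "emeasure (jump_intensity \<nu>) (slab \<delta> R t) < \<infinity>"
  using emeasure_slab_le[OF assms, of R] levy_measure_tail_finite[OF assms(1,2)]
  by (intro le_less_trans[OF emeasure_slab_le[OF assms, of R]]) (auto simp: ennreal_mult_less_top)

lemma levy_measure_tail_tendsto_0:
  assumes \<nu>: "levy_measure \<nu>"
  shows "(\<lambda>n. emeasure \<nu> {z. real n + 1 < norm z}) \<longlonglongrightarrow> 0"
proof -
  have s: "sets \<nu> = sets borel" using \<nu> by (auto simp: levy_measure_def)
  have m: "{z :: real ^ 'a. real n + 1 < norm z} \<in> sets borel" for n by measurable
  have "(\<lambda>n. emeasure \<nu> {z. real n + 1 < norm z}) \<longlonglongrightarrow> emeasure \<nu> (\<Inter>n. {z. real n + 1 < norm z})"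
  proof (rule Lim_emeasure_decseq)
    show "range (\<lambda>n. {z. real n + 1 < norm z}) \<subseteq> sets \<nu>" unfolding s using m by blast
    show "decseq (\<lambda>n. {z :: real ^ 'a. real n + 1 < norm z})" by (auto simp: decseq_def)
    show "emeasure \<nu> {z. real n + 1 < norm z} \<noteq> \<infinity>" for n
      using levy_measure_tail_finite[OF \<nu>, of "real n + 1"] by simp
  qed
  moreover have "(\<Inter>n. {z :: real ^ 'a. real n + 1 < norm z}) = {}"
  proof (rule equals0I)
    fix z :: "real ^ 'a" assume z: "z \<in> (\<Inter>n. {z. real n + 1 < norm z})"
    have *: "real n + 1 < norm z" for n using INT_D[OF z UNIV_I, of n] by simp
    obtain n where "norm z \<le> real n" using real_arch_simple by blast
    with *[of n] show False by simp
  qed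
  ultimately show ?thesis by simp
qed

locale levy_noise = poisson_measure M "jump_intensity \<nu>" N
  for M :: "'w measure" and \<nu> :: "(real ^ 'd) measure" and N +
  assumes levy: "levy_measure \<nu>"
begin

abbreviation \<mu> :: "((real ^ 'd) \<times> real) measure" where
  "\<mu> \<equiv> jump_intensity \<nu>"

lemmas measurable_fst_mu[measurable] = measurable_fst_jump_intensity[OF levy]

lemma slab_sets_mu: "0 \<le> \<delta> \<Longrightarrow> slab \<delta> R t \<in> sets \<mu>"
  by (rule slab_sets[OF levy])

definition jumps :: "real \<Rightarrow> real \<Rightarrow> real \<Rightarrow> 'w \<Rightarrow> real ^ 'd" where
  "jumps \<delta> R t \<omega> = (LINT p:slab \<delta> R t | N \<omega>. fst p)"

lemma jumps_measurable[measurable]: "0 \<le> \<delta> \<Longrightarrow> jumps \<delta> R t \<in> borel_measurable M"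
  unfolding jumps_def[abs_def] set_lebesgue_integral_def
  by (intro integral_N_measurable borel_measurable_scaleR borel_measurable_indicator slab_sets_mu measurable_fst_mu)

lemma slab_integrable:
  assumes \<omega>: "\<omega> \<in> space M" and \<delta>: "0 \<le> \<delta>" and R: "0 \<le> R" and fin: "emeasure (N \<omega>) (slab \<delta> R t) < \<infinity>"
  shows "integrable (N \<omega>) (\<lambda>p. indicator (slab \<delta> R t) p *\<^sub>R fst p)"
proof (rule Bochner_Integration.integrable_bound)
  have s: "slab \<delta> R t \<in> sets (N \<omega>)" using slab_sets_mu[OF \<delta>] sets_N[OF \<omega>] by simp
  show "integrable (N \<omega>) (\<lambda>p. R * indicator (slab \<delta> R t) p)"
    using s fin by (intro integrable_mult_right) (auto simp: integrable_indicator_iff)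
  show "(\<lambda>p. indicator (slab \<delta> R t) p *\<^sub>R fst p) \<in> borel_measurable (N \<omega>)"
    by (intro measurable_N[OF \<omega>] borel_measurable_scaleR borel_measurable_indicator slab_sets_mu measurable_fst_mu \<delta>)
  show "AE p in N \<omega>. norm (indicator (slab \<delta> R t) p *\<^sub>R fst p) \<le> norm (R * indicator (slab \<delta> R t) p)"
    using R by (intro AE_I2) (auto simp: indicator_def slab_def)
qed

lemma AE_slab_finite:
  assumes "0 < \<delta>" "0 \<le> t" shows "AE \<omega> in M. emeasure (N \<omega>) (slab \<delta> R t) < \<infinity>"
  using assms by (intro AE_count_finite slab_sets_mu emeasure_slab_finite levy) auto

text \<open>
  Almost surely there is no jump beyond some size, since the intensity of the jumps larger than \<open>n\<close>
  tends to zero.  From there on, cutting the large jumps off at \<open>n\<close> changes nothing, and the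
  integrability of the jump size need not be discussed.
\<close>

lemma AE_large_jumps_eventually:
  assumes t: "0 \<le> t"
  shows "AE \<omega> in M. eventually (\<lambda>n. jumps 1 (real n + 1) t \<omega> = large_jumps N t \<omega>) sequentially"
proof -
  define G where "G n = {z :: real ^ 'd. real n + 1 < norm z} \<times> {0<..t}" for n
  have G[measurable]: "G n \<in> sets \<mu>" for n
    unfolding G_def by (intro sets_jump_intensity_Times levy) auto
  have eG: "emeasure \<mu> (G n) = emeasure \<nu> {z. real n + 1 < norm z} * ennreal t" for n
    unfolding G_def by (subst emeasure_jump_intensity_Times[OF levy]) (use t in auto)
  have fG: "emeasure \<mu> (G n) < \<infinity>" for n
    unfolding eG using levy_measure_tail_finite[OF levy, of "real n + 1"] by (simp add: ennreal_mult_less_top)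
  have "(\<lambda>n. emeasure \<mu> (G n)) \<longlonglongrightarrow> 0 * ennreal t"
    unfolding eG by (intro tendsto_mult_ennreal tendsto_const levy_measure_tail_tendsto_0 levy) auto
  then have "(\<lambda>n. enn2real (emeasure \<mu> (G n))) \<longlonglongrightarrow> enn2real 0"
    by (intro tendsto_enn2real) auto
  then have mG: "(\<lambda>n. measure \<mu> (G n)) \<longlonglongrightarrow> 0"
    by (simp add: measure_def)
  have Gdec: "G m \<subseteq> G n" if "n \<le> m" for n m using that unfolding G_def by (force dest: of_nat_mono[where 'a=real])
  let ?B = "{\<omega> \<in> space M. \<forall>n. emeasure (N \<omega>) (G n) \<noteq> 0}"
  note [measurable] = count_measurable[OF G]
  have Bm: "?B \<in> sets M" by measurable
  have "prob ?B \<le> 1 - exp (- measure \<mu> (G n))" for n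
  proof -
    have "prob ?B \<le> prob (space M - {\<omega> \<in> space M. emeasure (N \<omega>) (G n) = of_nat 0})"
      by (intro finite_measure_mono) auto
    also have "\<dots> = 1 - prob {\<omega> \<in> space M. emeasure (N \<omega>) (G n) = of_nat 0}"
      by (rule prob_compl) measurable
    finally show ?thesis unfolding prob_count[OF G fG] by simp
  qed
  moreover have "(\<lambda>n. 1 - exp (- measure \<mu> (G n))) \<longlonglongrightarrow> 1 - exp (- 0)"
    by (intro tendsto_intros mG)
  ultimately have "prob ?B \<le> 1 - exp (- 0)"
    by (intro LIMSEQ_le_const[rotated]) auto
  then have "prob ?B = 0" using measure_nonneg[of M ?B] by simp
  then have "AE \<omega> in M. \<omega> \<notin> ?B"
    using Bm by (intro AE_not_in) (auto simp: null_sets_def emeasure_eq_measure)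
  then show ?thesis
    using AE_space
  proof eventually_elim
    case (elim \<omega>)
    then obtain n0 where n0: "emeasure (N \<omega>) (G n0) = 0" by auto
    show ?case
      using eventually_ge_at_top[of n0]
    proof eventually_elim
      case (elim n)
      have GN: "G n \<in> sets (N \<omega>)" for n using G sets_N[OF \<open>\<omega> \<in> space M\<close>] by simp
      have "emeasure (N \<omega>) (G n) = 0"
        using emeasure_mono[OF Gdec[OF elim] GN[of n0]] n0 by simp
      then have "AE p in N \<omega>. p \<notin> G n"
        using GN by (intro AE_not_in) (auto simp: null_sets_def)
      then have ae: "AE p in N \<omega>. indicator (slab 1 (real n + 1) t) p *\<^sub>R fst p =
          indicator {(z, s). 1 < norm z \<and> 0 < s \<and> s \<le> t} p *\<^sub>R fst p"
      proof eventually_elim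
        case (elim p)
        obtain z s where p: "p = (z, s)" by (cases p)
        have "p \<in> slab 1 (real n + 1) t \<longleftrightarrow> p \<in> {(z, s). 1 < norm z \<and> 0 < s \<and> s \<le> t}"
          using elim by (auto simp: p G_def slab_def)
        then show ?case by (simp only: indicator_def)
      qed
      have sl: "{(z :: real ^ 'd, s). 1 < norm z \<and> 0 < s \<and> s \<le> t} = {z. 1 < norm z} \<times> {0<..t}"
        by auto
      have A: "{z :: real ^ 'd. 1 < norm z} \<in> sets borel" by measurable
      have "{(z :: real ^ 'd, s). 1 < norm z \<and> 0 < s \<and> s \<le> t} \<in> sets \<mu>"
        unfolding sl by (rule sets_jump_intensity_Times[OF levy A]) auto
      then show "jumps 1 (real n + 1) t \<omega> = large_jumps N t \<omega>"
        unfolding jumps_def large_jumps_def set_lebesgue_integral_def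
        by (intro integral_cong_AE ae measurable_N[OF \<open>\<omega> \<in> space M\<close>]
              borel_measurable_scaleR borel_measurable_indicator slab_sets_mu measurable_fst_mu) auto
    qed
  qed
qed

end

lemma cmod_iexp_diff_le: "cmod (iexp a - iexp b) \<le> \<bar>a - b\<bar>"
proof -
  have "iexp a - iexp b = iexp b * (iexp (a - b) - 1)"
    by (simp add: algebra_simps exp_add[symmetric])
  then have "cmod (iexp a - iexp b) = cmod (iexp (a - b) - 1)"
    by (simp add: norm_mult)
  also have "\<dots> \<le> \<bar>a - b\<bar>"
    using iexp_approx1[of "a - b" 0] by simp
  finally show ?thesis .
qed

context levy_noise
begin

definition comp_small :: "real \<Rightarrow> real \<Rightarrow> real ^ 'd" where
  "comp_small \<delta> t = (LINT p:slab \<delta> 1 t | \<mu>. fst p)"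

lemma truncated_small_jumps_eq:
  "truncated_small_jumps \<nu> N \<delta> t \<omega> = jumps \<delta> 1 t \<omega> - comp_small \<delta> t"
  by (simp add: truncated_small_jumps_def jumps_def comp_small_def slab_def)

lemma jumps_split:
  assumes \<omega>: "\<omega> \<in> space M" and \<delta>: "0 < \<delta>" "\<delta> \<le> 1" and R: "1 \<le> R"
    and fin: "emeasure (N \<omega>) (slab \<delta> R t) < \<infinity>"
  shows "jumps \<delta> R t \<omega> = jumps \<delta> 1 t \<omega> + jumps 1 R t \<omega>"
proof -
  have s: "slab a b t \<in> sets (N \<omega>)" if "0 \<le> a" for a b t
    using slab_sets_mu[OF that] sets_N[OF \<omega>] by simp
  have f1: "emeasure (N \<omega>) (slab \<delta> 1 t) < \<infinity>"
    using fin s[of \<delta> R t] \<delta> R by (intro le_less_trans[OF emeasure_mono fin]) (auto simp: slab_def)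
  have f2: "emeasure (N \<omega>) (slab 1 R t) < \<infinity>"
    using fin s[of \<delta> R t] \<delta> R by (intro le_less_trans[OF emeasure_mono fin]) (auto simp: slab_def)
  have "jumps \<delta> 1 t \<omega> + jumps 1 R t \<omega> =
     (\<integral>p. indicator (slab \<delta> 1 t) p *\<^sub>R fst p + indicator (slab 1 R t) p *\<^sub>R fst p \<partial>N \<omega>)"
    unfolding jumps_def set_lebesgue_integral_def
    using slab_integrable[OF \<omega> _ _ f1] slab_integrable[OF \<omega> _ _ f2] \<delta> R
    by (intro Bochner_Integration.integral_add[symmetric]) auto
  also have "\<dots> = jumps \<delta> R t \<omega>"
    unfolding jumps_def set_lebesgue_integral_def
    using \<delta> R by (intro Bochner_Integration.integral_cong) (auto simp: indicator_def slab_def)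
  finally show ?thesis ..
qed

text \<open>
  A linear combination of the truncated sums is the integral of one function against \<open>N\<close>.  Discarding
  the jumps outside \<open>E\<close> can only increase the modulus of the characteristic function, since
  \<open>1 - cos\<close> is nonnegative.
\<close>

lemma char_linear_combination_jumps:
  fixes c :: "'i \<Rightarrow> real ^ 'd"
  assumes F: "finite F" and \<tau>: "\<And>j. j \<in> F \<Longrightarrow> 0 \<le> \<tau> j \<and> \<tau> j \<le> T" and T: "0 \<le> T"
    and \<delta>: "0 < \<delta>" and R: "0 \<le> R"
    and E: "E \<in> sets \<mu>" "E \<subseteq> slab \<delta> R T"
    and \<kappa>: "\<And>z s. (z, s) \<in> E \<Longrightarrow> \<kappa> \<le> 1 - cos (\<Sum>j\<in>F. indicator {0<..\<tau> j} s * (c j \<bullet> z))"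
  shows "cmod (\<integral>\<omega>. iexp (\<Sum>j\<in>F. c j \<bullet> jumps \<delta> R (\<tau> j) \<omega>) \<partial>M) \<le> exp (- (\<kappa> * measure \<mu> E))"
proof -
  let ?S = "slab \<delta> R T"
  define h where "h p = (\<Sum>j\<in>F. c j \<bullet> (indicator (slab \<delta> R (\<tau> j)) p *\<^sub>R fst p))" for p
  have Sm[measurable]: "?S \<in> sets \<mu>" using \<delta> by (intro slab_sets_mu) simp
  have fS: "emeasure \<mu> ?S < \<infinity>" using \<delta> T by (intro emeasure_slab_finite levy)
  have hm[measurable]: "h \<in> borel_measurable \<mu>"
    unfolding h_def[abs_def] using \<delta>
    by (intro borel_measurable_sum borel_measurable_inner borel_measurable_const borel_measurable_scaleR
          borel_measurable_indicator slab_sets_mu measurable_fst_mu) auto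
  have h0: "h p = 0" if "p \<notin> ?S" for p
    unfolding h_def using that \<tau> by (intro sum.neutral) (force simp: slab_def indicator_def)
  have hb: "\<bar>h p\<bar> \<le> (\<Sum>j\<in>F. norm (c j) * R)" for p
    unfolding h_def
  proof (rule order_trans[OF sum_abs], rule sum_mono)
    fix j
    have "\<bar>c j \<bullet> (indicator (slab \<delta> R (\<tau> j)) p *\<^sub>R fst p)\<bar> \<le> norm (c j) * norm (indicator (slab \<delta> R (\<tau> j)) p *\<^sub>R fst p)"
      by (rule Cauchy_Schwarz_ineq2)
    also have "\<dots> \<le> norm (c j) * R"
      using R by (intro mult_left_mono) (auto simp: indicator_def slab_def)
    finally show "\<bar>c j \<bullet> (indicator (slab \<delta> R (\<tau> j)) p *\<^sub>R fst p)\<bar> \<le> norm (c j) * R" .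
  qed
  have hN: "(\<Sum>j\<in>F. c j \<bullet> jumps \<delta> R (\<tau> j) \<omega>) = (\<integral>p. h p \<partial>N \<omega>)"
    if \<omega>: "\<omega> \<in> space M" and fin: "emeasure (N \<omega>) ?S < \<infinity>" for \<omega>
  proof -
    have SN: "?S \<in> sets (N \<omega>)" using Sm sets_N[OF \<omega>] by simp
    have i: "integrable (N \<omega>) (\<lambda>p. indicator (slab \<delta> R (\<tau> j)) p *\<^sub>R fst p)" if "j \<in> F" for j
    proof (rule slab_integrable[OF \<omega>])
      have "emeasure (N \<omega>) (slab \<delta> R (\<tau> j)) \<le> emeasure (N \<omega>) ?S"
        using SN \<tau>[OF that] by (intro emeasure_mono) (auto simp: slab_def)
      then show "emeasure (N \<omega>) (slab \<delta> R (\<tau> j)) < \<infinity>" using fin by (rule le_less_trans)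
    qed (use \<delta> R in auto)
    have "(\<integral>p. h p \<partial>N \<omega>) = (\<Sum>j\<in>F. \<integral>p. c j \<bullet> (indicator (slab \<delta> R (\<tau> j)) p *\<^sub>R fst p) \<partial>N \<omega>)"
      unfolding h_def by (rule Bochner_Integration.integral_sum) (rule integrable_inner_right, rule i)
    also have "\<dots> = (\<Sum>j\<in>F. c j \<bullet> jumps \<delta> R (\<tau> j) \<omega>)"
      unfolding jumps_def set_lebesgue_integral_def
      by (intro sum.cong refl integral_inner_right i)
    finally show ?thesis ..
  qed
  have "(\<integral>\<omega>. iexp (\<Sum>j\<in>F. c j \<bullet> jumps \<delta> R (\<tau> j) \<omega>) \<partial>M) = (\<integral>\<omega>. iexp (\<integral>p. h p \<partial>N \<omega>) \<partial>M)"
  proof (rule integral_cong_AE)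
    have jm: "(\<lambda>\<omega>. \<Sum>j\<in>F. c j \<bullet> jumps \<delta> R (\<tau> j) \<omega>) \<in> borel_measurable M"
      using \<delta> by (intro borel_measurable_sum borel_measurable_inner borel_measurable_const jumps_measurable) auto
    show "(\<lambda>\<omega>. iexp (\<Sum>j\<in>F. c j \<bullet> jumps \<delta> R (\<tau> j) \<omega>)) \<in> borel_measurable M"
      by (rule measurable_compose[OF jm]) measurable
    show "(\<lambda>\<omega>. iexp (\<integral>p. h p \<partial>N \<omega>)) \<in> borel_measurable M"
      by (rule measurable_compose[OF integral_N_measurable[OF hm]]) measurable
    show "AE \<omega> in M. iexp (\<Sum>j\<in>F. c j \<bullet> jumps \<delta> R (\<tau> j) \<omega>) = iexp (\<integral>p. h p \<partial>N \<omega>)"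
      using AE_slab_finite[OF \<delta> T, of R] AE_space by eventually_elim (simp only: hN)
  qed
  also have "cmod \<dots> = exp (- (\<integral>p. 1 - cos (h p) \<partial>\<mu>))"
    by (rule char_integral[OF hm Sm fS h0 hb])
  also have "\<dots> \<le> exp (- (\<kappa> * measure \<mu> E))"
  proof -
    have fE: "emeasure \<mu> E < \<infinity>" using E Sm by (intro le_less_trans[OF emeasure_mono fS]) auto
    have "\<kappa> * measure \<mu> E = (\<integral>p. \<kappa> * indicator E p \<partial>\<mu>)"
      using E fE by simp
    also have "\<dots> \<le> (\<integral>p. 1 - cos (h p) \<partial>\<mu>)"
    proof (rule integral_mono)
      show "integrable \<mu> (\<lambda>p. \<kappa> * indicator E p)"
        using E(1) fE by (intro integrable_mult_right) (auto simp: integrable_indicator_iff)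
      show "integrable \<mu> (\<lambda>p. 1 - cos (h p))"
      proof (rule Bochner_Integration.integrable_bound)
        show "integrable \<mu> (\<lambda>p. 2 * indicator ?S p :: real)"
          using fS by (intro integrable_mult_right) (auto simp: integrable_indicator_iff)
        show "AE p in \<mu>. norm (1 - cos (h p)) \<le> norm (2 * indicator ?S p :: real)"
        proof (rule AE_I2)
          fix p show "norm (1 - cos (h p)) \<le> norm (2 * indicator ?S p :: real)"
            using h0[of p] abs_cos_le_one[of "h p"] by (auto simp: indicator_def)
        qed
      qed measurable
      fix p
      show "\<kappa> * indicator E p \<le> 1 - cos (h p)"
      proof (cases "p \<in> E")
        case True
        obtain z s where p: "p = (z, s)" by (cases p)
        have zs: "\<delta> < norm z" "norm z \<le> R" using True E(2) by (auto simp: p slab_def)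
        have "h p = (\<Sum>j\<in>F. indicator {0<..\<tau> j} s * (c j \<bullet> z))"
          unfolding h_def p using zs by (intro sum.cong refl) (auto simp: indicator_def slab_def)
        then show ?thesis using \<kappa>[of z s] True by (simp add: p)
      qed simp
    qed
    finally show ?thesis by simp
  qed
  finally show ?thesis .
qed

text \<open>
  The bound does not depend on the truncation levels, so it survives both limits: \<open>\<delta> \<rightarrow> 0\<close> in the
  compensated small jumps, where the definition provides convergence in the quadratic mean, and
  \<open>R \<rightarrow> \<infinity>\<close> in the large jumps, where the truncated sums are eventually constant.  Compensation is
  a deterministic shift and does not affect the modulus.
\<close>

lemma char_linear_combination_levy:
  fixes c :: "'i \<Rightarrow> real ^ 'd"
  assumes L: "\<And>t. 0 \<le> t \<Longrightarrow> L t \<in> borel_measurable M"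
    and dec: "\<And>t. 0 \<le> t \<Longrightarrow> \<exists>J. is_compensated_small_jumps M \<nu> N t J \<and> (AE \<omega> in M. L t \<omega> = J \<omega> + large_jumps N t \<omega>)"
    and F: "finite F" and \<tau>: "\<And>j. j \<in> F \<Longrightarrow> 0 \<le> \<tau> j \<and> \<tau> j \<le> T" and T: "0 \<le> T"
    and \<delta>0: "0 < \<delta>0" "\<delta>0 \<le> 1"
    and E: "E \<in> sets \<mu>" "E \<subseteq> slab \<delta>0 1 T"
    and \<kappa>: "\<And>z s. (z, s) \<in> E \<Longrightarrow> \<kappa> \<le> 1 - cos (\<Sum>j\<in>F. indicator {0<..\<tau> j} s * (c j \<bullet> z))"
  shows "cmod (\<integral>\<omega>. iexp (\<Sum>j\<in>F. c j \<bullet> L (\<tau> j) \<omega>) \<partial>M) \<le> exp (- (\<kappa> * measure \<mu> E))"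
proof -
  let ?B = "exp (- (\<kappa> * measure \<mu> E))"
  have "\<forall>j\<in>F. \<exists>J. is_compensated_small_jumps M \<nu> N (\<tau> j) J \<and> (AE \<omega> in M. L (\<tau> j) \<omega> = J \<omega> + large_jumps N (\<tau> j) \<omega>)"
    using dec \<tau> by blast
  then obtain J where J: "\<And>j. j \<in> F \<Longrightarrow> is_compensated_small_jumps M \<nu> N (\<tau> j) (J j)"
    and LJ: "\<And>j. j \<in> F \<Longrightarrow> AE \<omega> in M. L (\<tau> j) \<omega> = J j \<omega> + large_jumps N (\<tau> j) \<omega>"
    by metis
  have Jm: "J j \<in> borel_measurable M" if "j \<in> F" for j using J[OF that] by (simp add: is_compensated_small_jumps_def)
  define D where "D \<delta> j \<omega> = truncated_small_jumps \<nu> N \<delta> (\<tau> j) \<omega> - J j \<omega>" for \<delta> j \<omega>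
  let ?S = "\<lambda>\<delta> j. \<integral>\<^sup>+ \<omega>. ennreal ((norm (D \<delta> j \<omega>))\<^sup>2) \<partial>M"
  have D2: "((\<lambda>\<delta>. ?S \<delta> j) \<longlongrightarrow> 0) (at_right 0)" if "j \<in> F" for j
    using J[OF that] by (simp add: is_compensated_small_jumps_def D_def)
  have trm: "truncated_small_jumps \<nu> N \<delta> t \<in> borel_measurable M" if "0 \<le> \<delta>" for \<delta> t
    unfolding truncated_small_jumps_eq[abs_def]
    by (intro borel_measurable_diff borel_measurable_const jumps_measurable that)
  have Dm: "D \<delta> j \<in> borel_measurable M" if "0 \<le> \<delta>" "j \<in> F" for \<delta> j
    unfolding D_def[abs_def] by (intro borel_measurable_diff trm Jm that)
  (* both truncations in place, and then only the one of the large jumps *)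
  define Y where "Y \<delta> R \<omega> = (\<Sum>j\<in>F. c j \<bullet> (truncated_small_jumps \<nu> N \<delta> (\<tau> j) \<omega> + jumps 1 R (\<tau> j) \<omega>))" for \<delta> R \<omega>
  define V where "V R \<omega> = (\<Sum>j\<in>F. c j \<bullet> (J j \<omega> + jumps 1 R (\<tau> j) \<omega>))" for R \<omega>
  have Ym: "Y \<delta> R \<in> borel_measurable M" if "0 \<le> \<delta>" for \<delta> R
    unfolding Y_def[abs_def]
    by (intro borel_measurable_sum borel_measurable_inner borel_measurable_const borel_measurable_add trm that jumps_measurable) auto
  have Vm: "V R \<in> borel_measurable M" for R
    unfolding V_def[abs_def]
    by (intro borel_measurable_sum borel_measurable_inner borel_measurable_const borel_measurable_add Jm jumps_measurable) auto
  have iexp_m: "(\<lambda>\<omega>. iexp (f \<omega>)) \<in> borel_measurable M" if "f \<in> borel_measurable M" for f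
    using that by measurable
  have iexp_i: "integrable M (\<lambda>\<omega>. iexp (f \<omega>))" if "f \<in> borel_measurable M" for f
    using iexp_m[OF that] by (intro integrable_const_bound[of _ 1]) auto
  have Ybound: "cmod (\<integral>\<omega>. iexp (Y \<delta> R \<omega>) \<partial>M) \<le> ?B" if \<delta>: "0 < \<delta>" "\<delta> \<le> \<delta>0" and R: "1 \<le> R" for \<delta> R
  proof -
    define Z where "Z \<omega> = (\<Sum>j\<in>F. c j \<bullet> jumps \<delta> R (\<tau> j) \<omega>)" for \<omega>
    define k where "k = (\<Sum>j\<in>F. c j \<bullet> comp_small \<delta> (\<tau> j))"
    have Zm: "Z \<in> borel_measurable M"
      unfolding Z_def[abs_def] using \<delta>
      by (intro borel_measurable_sum borel_measurable_inner borel_measurable_const jumps_measurable) simp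
    have "AE \<omega> in M. Y \<delta> R \<omega> = Z \<omega> - k"
      using AE_slab_finite[OF \<delta>(1) T, of R] AE_space
    proof eventually_elim
      case (elim \<omega>)
      have "jumps \<delta> R (\<tau> j) \<omega> = jumps \<delta> 1 (\<tau> j) \<omega> + jumps 1 R (\<tau> j) \<omega>" if "j \<in> F" for j
      proof (rule jumps_split)
        have "slab \<delta> R T \<in> sets (N \<omega>)" using slab_sets_mu[of \<delta> R T] sets_N[OF elim(2)] \<delta> by simp
        then have "emeasure (N \<omega>) (slab \<delta> R (\<tau> j)) \<le> emeasure (N \<omega>) (slab \<delta> R T)"
          using \<tau>[OF that] by (intro emeasure_mono) (auto simp: slab_def)
        then show "emeasure (N \<omega>) (slab \<delta> R (\<tau> j)) < \<infinity>" using elim(1) by (rule le_less_trans)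
      qed (use elim \<delta> \<delta>0 R in auto)
      then have "Z \<omega> - k = (\<Sum>j\<in>F. c j \<bullet> (jumps \<delta> 1 (\<tau> j) \<omega> + jumps 1 R (\<tau> j) \<omega> - comp_small \<delta> (\<tau> j)))"
        unfolding Z_def k_def sum_subtractf[symmetric] by (intro sum.cong refl) (simp add: inner_diff_right)
      also have "\<dots> = Y \<delta> R \<omega>"
        unfolding Y_def truncated_small_jumps_eq by (simp add: algebra_simps)
      finally show ?case ..
    qed
    then have "(\<integral>\<omega>. iexp (Y \<delta> R \<omega>) \<partial>M) = (\<integral>\<omega>. iexp (- k) * iexp (Z \<omega>) \<partial>M)"
    proof (intro integral_cong_AE iexp_m Ym borel_measurable_times borel_measurable_const Zm, goal_cases)
      case 2
      then show ?case
      proof eventually_elim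
        case (elim \<omega>)
        have "iexp (- k) * iexp (Z \<omega>) = iexp (Z \<omega> - k)" by (simp add: exp_add[symmetric] algebra_simps)
        then show ?case using elim by (simp only:)
      qed
    qed (use \<delta> in simp)
    also have "\<dots> = iexp (- k) * (\<integral>\<omega>. iexp (Z \<omega>) \<partial>M)" by (rule integral_mult_right_zero)
    also have "cmod \<dots> = cmod (\<integral>\<omega>. iexp (Z \<omega>) \<partial>M)" by (simp only: norm_mult norm_exp_i_times mult_1)
    also have "\<dots> \<le> ?B"
      unfolding Z_def
    proof (rule char_linear_combination_jumps[OF F \<tau> T \<delta>(1) _ E(1) _ \<kappa>])
      show "E \<subseteq> slab \<delta> R T" using E(2) \<delta> R by (auto simp: slab_def)
    qed (use R in auto)
    finally show ?thesis .
  qed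
  have Vbound: "cmod (\<integral>\<omega>. iexp (V R \<omega>) \<partial>M) \<le> ?B" if R: "1 \<le> R" for R
  proof -
    (* an upper bound for the distance of the two characteristic functions *)
    define a where "a \<delta> = (\<Sum>j\<in>F. norm (c j) * sqrt (enn2real (?S \<delta> j)))" for \<delta>
    have a0: "(a \<longlongrightarrow> 0) (at_right 0)"
    proof -
      have "((\<lambda>\<delta>. \<Sum>j\<in>F. norm (c j) * sqrt (enn2real (?S \<delta> j)))
          \<longlongrightarrow> (\<Sum>j\<in>F. norm (c j) * sqrt (enn2real 0))) (at_right 0)"
        by (intro tendsto_sum tendsto_mult tendsto_const tendsto_real_sqrt tendsto_enn2real) (auto intro: D2)
      then show ?thesis by (simp add: a_def[abs_def])
    qed
    have fin: "eventually (\<lambda>\<delta>. \<forall>j\<in>F. ?S \<delta> j < \<infinity>) (at_right 0)"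
      using F by (intro eventually_ball_finite ballI order_tendstoD(2)[OF D2]) auto
    have "eventually (\<lambda>\<delta>. cmod (\<integral>\<omega>. iexp (V R \<omega>) \<partial>M) \<le> ?B + a \<delta>) (at_right 0)"
      using fin eventually_at_right_real[OF \<delta>0(1)]
    proof (eventually_elim)
      case (elim \<delta>)
      then have \<delta>: "0 < \<delta>" "\<delta> \<le> \<delta>0" by auto
      have Dn: "(\<lambda>\<omega>. norm (D \<delta> j \<omega>)) \<in> borel_measurable M" if "j \<in> F" for j
        using measurable_compose[OF Dm[of \<delta> j] borel_measurable_norm] \<delta> that by simp
      have i2: "integrable M (\<lambda>\<omega>. (norm (D \<delta> j \<omega>))\<^sup>2)" if "j \<in> F" for j
        using elim(1) that Dn[OF that] by (intro integrableI_nonneg) auto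
      have i1: "integrable M (\<lambda>\<omega>. norm (D \<delta> j \<omega>))" if "j \<in> F" for j
        by (rule square_integrable_imp_integrable[OF Dn[OF that] i2[OF that]])
      have n1: "(\<integral>\<omega>. norm (D \<delta> j \<omega>) \<partial>M) \<le> sqrt (enn2real (?S \<delta> j))"
        if "j \<in> F" for j
      proof -
        have "0 \<le> variance (\<lambda>\<omega>. norm (D \<delta> j \<omega>))" by (rule variance_positive)
        then have "(\<integral>\<omega>. norm (D \<delta> j \<omega>) \<partial>M)\<^sup>2 \<le> (\<integral>\<omega>. (norm (D \<delta> j \<omega>))\<^sup>2 \<partial>M)"
          unfolding variance_eq[OF i1[OF that] i2[OF that]] by simp
        also have "\<dots> = enn2real (?S \<delta> j)"
          using i2[OF that] by (intro integral_eq_nn_integral) auto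
        finally show ?thesis by (rule real_le_rsqrt)
      qed
      have iV: "integrable M (\<lambda>\<omega>. iexp (V R \<omega>))" and iY: "integrable M (\<lambda>\<omega>. iexp (Y \<delta> R \<omega>))"
        using \<delta> by (auto intro!: iexp_i Vm Ym simp del: of_real_mult)
      have pt: "cmod (iexp (V R \<omega>) - iexp (Y \<delta> R \<omega>)) \<le> (\<Sum>j\<in>F. norm (c j) * norm (D \<delta> j \<omega>))" for \<omega>
      proof -
        have "cmod (iexp (V R \<omega>) - iexp (Y \<delta> R \<omega>)) \<le> \<bar>V R \<omega> - Y \<delta> R \<omega>\<bar>" by (rule cmod_iexp_diff_le)
        also have "V R \<omega> - Y \<delta> R \<omega> = (\<Sum>j\<in>F. - (c j \<bullet> D \<delta> j \<omega>))"
          unfolding V_def Y_def D_def sum_subtractf[symmetric]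
          by (intro sum.cong refl) (simp add: inner_diff_right inner_add_right)
        also have "\<bar>\<dots>\<bar> \<le> (\<Sum>j\<in>F. norm (c j) * norm (D \<delta> j \<omega>))"
          by (rule order_trans[OF sum_abs], rule sum_mono) (simp add: Cauchy_Schwarz_ineq2)
        finally show ?thesis .
      qed
      have "cmod ((\<integral>\<omega>. iexp (V R \<omega>) \<partial>M) - (\<integral>\<omega>. iexp (Y \<delta> R \<omega>) \<partial>M)) =
          cmod (\<integral>\<omega>. iexp (V R \<omega>) - iexp (Y \<delta> R \<omega>) \<partial>M)"
        by (simp only: Bochner_Integration.integral_diff[OF iV iY])
      also have "\<dots> \<le> (\<integral>\<omega>. (\<Sum>j\<in>F. norm (c j) * norm (D \<delta> j \<omega>)) \<partial>M)"
      proof (rule order_trans[OF integral_norm_bound integral_mono])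
        show "integrable M (\<lambda>\<omega>. cmod (iexp (V R \<omega>) - iexp (Y \<delta> R \<omega>)))"
          by (rule integrable_norm) (rule Bochner_Integration.integrable_diff[OF iV iY])
        show "integrable M (\<lambda>\<omega>. \<Sum>j\<in>F. norm (c j) * norm (D \<delta> j \<omega>))"
          by (rule Bochner_Integration.integrable_sum) (rule integrable_mult_right, rule i1)
      qed (rule pt)
      also have "\<dots> = (\<Sum>j\<in>F. \<integral>\<omega>. norm (c j) * norm (D \<delta> j \<omega>) \<partial>M)"
        by (rule Bochner_Integration.integral_sum) (rule integrable_mult_right, rule i1)
      also have "\<dots> = (\<Sum>j\<in>F. norm (c j) * (\<integral>\<omega>. norm (D \<delta> j \<omega>) \<partial>M))"
        by simp
      also have "\<dots> \<le> a \<delta>"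
        unfolding a_def by (intro sum_mono mult_left_mono n1) auto
      finally have d: "cmod ((\<integral>\<omega>. iexp (V R \<omega>) \<partial>M) - (\<integral>\<omega>. iexp (Y \<delta> R \<omega>) \<partial>M)) \<le> a \<delta>" .
      have "cmod (\<integral>\<omega>. iexp (V R \<omega>) \<partial>M) \<le>
          cmod (\<integral>\<omega>. iexp (Y \<delta> R \<omega>) \<partial>M) + cmod ((\<integral>\<omega>. iexp (V R \<omega>) \<partial>M) - (\<integral>\<omega>. iexp (Y \<delta> R \<omega>) \<partial>M))"
        by (rule norm_triangle_sub)
      with d Ybound[OF \<delta> R] show ?case by linarith
    qed
    moreover have "((\<lambda>\<delta>. ?B + a \<delta>) \<longlongrightarrow> ?B + 0) (at_right 0)"
      by (intro tendsto_intros a0)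
    ultimately show ?thesis
      by (intro tendsto_lowerbound[of "\<lambda>\<delta>. ?B + a \<delta>" ?B "at_right 0"]) auto
  qed
  have "(\<lambda>n. \<integral>\<omega>. iexp (V (real n + 1) \<omega>) \<partial>M) \<longlonglongrightarrow> (\<integral>\<omega>. iexp (\<Sum>j\<in>F. c j \<bullet> L (\<tau> j) \<omega>) \<partial>M)"
  proof (rule integral_dominated_convergence[where w="\<lambda>_. 1"])
    show "(\<lambda>\<omega>. iexp (\<Sum>j\<in>F. c j \<bullet> L (\<tau> j) \<omega>)) \<in> borel_measurable M"
      using \<tau> by (intro iexp_m borel_measurable_sum borel_measurable_inner borel_measurable_const L) blast
    show "(\<lambda>\<omega>. iexp (V (real n + 1) \<omega>)) \<in> borel_measurable M" for n
      by (intro iexp_m Vm)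
    have "AE \<omega> in M. \<forall>j\<in>F. L (\<tau> j) \<omega> = J j \<omega> + large_jumps N (\<tau> j) \<omega>"
      using F LJ by (intro AE_finite_allI) auto
    moreover have "AE \<omega> in M. \<forall>j\<in>F. eventually (\<lambda>n. jumps 1 (real n + 1) (\<tau> j) \<omega> = large_jumps N (\<tau> j) \<omega>) sequentially"
      using F \<tau> by (intro AE_finite_allI AE_large_jumps_eventually) auto
    ultimately show "AE \<omega> in M. (\<lambda>n. iexp (V (real n + 1) \<omega>)) \<longlonglongrightarrow> iexp (\<Sum>j\<in>F. c j \<bullet> L (\<tau> j) \<omega>)"
    proof eventually_elim
      case (elim \<omega>)
      have "eventually (\<lambda>n. \<forall>j\<in>F. jumps 1 (real n + 1) (\<tau> j) \<omega> = large_jumps N (\<tau> j) \<omega>) sequentially"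
        using F elim(2) by (intro eventually_ball_finite) auto
      then have "eventually (\<lambda>n. iexp (V (real n + 1) \<omega>) = iexp (\<Sum>j\<in>F. c j \<bullet> L (\<tau> j) \<omega>)) sequentially"
        by eventually_elim (use elim(1) in \<open>simp add: V_def\<close>)
      then show ?case by (rule tendsto_eventually)
    qed
  qed auto
  then have "(\<lambda>n. cmod (\<integral>\<omega>. iexp (V (real n + 1) \<omega>) \<partial>M)) \<longlonglongrightarrow> cmod (\<integral>\<omega>. iexp (\<Sum>j\<in>F. c j \<bullet> L (\<tau> j) \<omega>) \<partial>M)"
    by (rule tendsto_norm)
  then show ?thesis
    by (rule LIMSEQ_le_const2) (auto intro!: exI[of _ 0] Vbound)
qed

end

section \<open>Linear flows and the Kalman rank condition\<close>

text \<open>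
  The exponential \<open>exp (r T) v\<close>.  As a series of vectors it needs no norm on the space of linear maps.
\<close>

definition linear_flow :: "('a::euclidean_space \<Rightarrow> 'a) \<Rightarrow> real \<Rightarrow> 'a \<Rightarrow> 'a" where
  "linear_flow T r v = (\<Sum>k. (r ^ k /\<^sub>R fact k) *\<^sub>R (T ^^ k) v)"

context
  fixes T :: "'a::euclidean_space \<Rightarrow> 'a"
  assumes T: "bounded_linear T"
begin

lemma norm_funpow_le: "norm ((T ^^ k) v) \<le> onorm T ^ k * norm v"
proof (induct k)
  case (Suc k)
  have "norm ((T ^^ Suc k) v) \<le> onorm T * norm ((T ^^ k) v)" using onorm[OF T] by simp
  also have "\<dots> \<le> onorm T * (onorm T ^ k * norm v)"
    using Suc onorm_pos_le[OF T] by (rule mult_left_mono)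
  finally show ?case by (simp add: mult.assoc)
qed simp

lemma norm_flow_term_le:
  "norm ((r ^ k /\<^sub>R fact k) *\<^sub>R (T ^^ k) v) \<le> ((onorm T * \<bar>r\<bar>) ^ k /\<^sub>R fact k) * norm v"
proof -
  have "norm ((r ^ k /\<^sub>R fact k) *\<^sub>R (T ^^ k) v) = (\<bar>r\<bar> ^ k / fact k) * norm ((T ^^ k) v)"
    by (simp add: abs_mult power_abs divide_inverse mult.commute)
  also have "\<dots> \<le> (\<bar>r\<bar> ^ k / fact k) * (onorm T ^ k * norm v)"
    by (intro mult_left_mono norm_funpow_le) simp
  finally show ?thesis by (simp add: power_mult_distrib divide_inverse mult_ac)
qed

lemma summable_flow_bound: "summable (\<lambda>k. ((onorm T * \<bar>r\<bar>) ^ k /\<^sub>R fact k) * norm v)"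
  by (intro summable_mult2 summable_exp_generic)

lemma summable_flow: "summable (\<lambda>k. (r ^ k /\<^sub>R fact k) *\<^sub>R (T ^^ k) v)"
  by (rule summable_comparison_test'[OF summable_flow_bound[of r v]]) (rule norm_flow_term_le)

lemma norm_linear_flow_le: "norm (linear_flow T r v) \<le> exp (onorm T * \<bar>r\<bar>) * norm v"
proof -
  have "norm (linear_flow T r v) \<le> (\<Sum>k. ((onorm T * \<bar>r\<bar>) ^ k /\<^sub>R fact k) * norm v)"
    unfolding linear_flow_def by (intro norm_suminf_le summable_flow_bound norm_flow_term_le)
  also have "\<dots> = exp (onorm T * \<bar>r\<bar>) * norm v"
    unfolding exp_def by (intro suminf_mult2[symmetric] summable_exp_generic)
  finally show ?thesis .
qed

lemma linear_funpow: "linear (T ^^ k)"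
  by (induct k) (auto intro!: linear_compose[of "T ^^ _" T, unfolded o_def] bounded_linear.linear[OF T] linearI
      simp: linear_add[OF bounded_linear.linear[OF T]] linear_scale[OF bounded_linear.linear[OF T]] linear_add linear_scale)

lemma linear_linear_flow: "linear (linear_flow T r)"
proof (rule linearI)
  show "linear_flow T r (v + w) = linear_flow T r v + linear_flow T r w" for v w
    unfolding linear_flow_def
    by (subst suminf_add[OF summable_flow summable_flow])
       (simp add: linear_add[OF linear_funpow] scaleR_add_right)
  show "linear_flow T r (c *\<^sub>R v) = c *\<^sub>R linear_flow T r v" for c v
    unfolding linear_flow_def
    by (subst suminf_scaleR_right[OF summable_flow])
       (simp add: linear_scale[OF linear_funpow] mult_ac)
qed

lemma linear_flow_0: "linear_flow T 0 v = v"
proof -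
  have "linear_flow T 0 v = (\<Sum>k\<in>{0}. ((0::real) ^ k /\<^sub>R fact k) *\<^sub>R (T ^^ k) v)"
    unfolding linear_flow_def by (rule suminf_finite) auto
  then show ?thesis by simp
qed

lemma linear_flow_commute: "T (linear_flow T r v) = linear_flow T r (T v)"
proof -
  have "T (linear_flow T r v) = (\<Sum>k. T ((r ^ k /\<^sub>R fact k) *\<^sub>R (T ^^ k) v))"
    unfolding linear_flow_def by (rule bounded_linear.suminf[OF T summable_flow])
  then show ?thesis
    unfolding linear_flow_def by (simp add: linear_scale[OF bounded_linear.linear[OF T]] funpow_swap1)
qed

text \<open>
  Every component is a real power series in \<open>r\<close>, which may be differentiated term by term.
\<close>

lemma linear_flow_has_vector_derivative:
  "((\<lambda>r. linear_flow T r v) has_vector_derivative linear_flow T r (T v)) (at r within S)"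
proof -
  have inner: "linear_flow T r v \<bullet> b = (\<Sum>k. ((T ^^ k) v \<bullet> b / fact k) * r ^ k)"
    and summ: "summable (\<lambda>k. ((T ^^ k) v \<bullet> b / fact k) * r ^ k)" for r v b
    using bounded_linear.suminf[OF bounded_linear_inner_left[of b] summable_flow[of r v]]
      bounded_linear.summable[OF bounded_linear_inner_left[of b] summable_flow[of r v]]
    by (simp_all add: linear_flow_def divide_inverse mult_ac)
  have "((\<lambda>r. linear_flow T r v \<bullet> b) has_real_derivative (linear_flow T r (T v) \<bullet> b)) (at r within S)" for b
  proof -
    have "diffs (\<lambda>k. (T ^^ k) v \<bullet> b / fact k) = (\<lambda>k. (T ^^ k) (T v) \<bullet> b / fact k)"
      by (auto simp: diffs_def fun_eq_iff funpow_swap1 field_simps simp del: of_nat_Suc)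
    then show ?thesis
      unfolding inner
      using termdiffs_strong_converges_everywhere[where c="\<lambda>k. (T ^^ k) v \<bullet> b / fact k", OF summ]
      by (auto intro: DERIV_subset)
  qed
  then show ?thesis
    unfolding has_vector_derivative_def has_derivative_componentwise_within[of "\<lambda>r. linear_flow T r v"]
    by (auto simp: has_field_derivative_def mult.commute[of _ "_ \<bullet> _"] mult_commute_abs)
qed

lemma linear_flow_lipschitz:
  assumes "0 \<le> a" "0 \<le> b" "a \<le> t" "b \<le> t"
  shows "norm (linear_flow T b v - linear_flow T a v) \<le> 3 * (exp (onorm T * t) * onorm T * norm v) * \<bar>b - a\<bar>"
proof -
  let ?K = "exp (onorm T * t) * onorm T * norm v"
  have n: "norm (linear_flow T r (T v)) \<le> ?K" if "r \<in> {0..t}" for r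
  proof -
    have "norm (linear_flow T r (T v)) \<le> exp (onorm T * \<bar>r\<bar>) * norm (T v)" by (rule norm_linear_flow_le)
    also have "\<dots> \<le> exp (onorm T * t) * (onorm T * norm v)"
      using that onorm_pos_le[OF T] onorm[OF T, of v] by (intro mult_mono) (auto intro!: mult_left_mono)
    finally show ?thesis by (simp add: mult_ac)
  qed
  have "norm (linear_flow T b v - linear_flow T a v - (b - a) *\<^sub>R linear_flow T a (T v)) \<le> norm (b - a) * (?K + ?K)"
  proof (rule vector_differentiable_bound_linearization[where S="{0..t}" and f'="\<lambda>r. linear_flow T r (T v)"])
    show "closed_segment a b \<subseteq> {0..t}" using assms by (auto simp: closed_segment_eq_real_ivl)
    show "norm (linear_flow T r (T v) - linear_flow T a (T v)) \<le> ?K + ?K" if "r \<in> {0..t}" for r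
    proof -
      have "norm (linear_flow T a (T v)) \<le> ?K" using assms by (intro n) auto
      then show ?thesis
        using norm_triangle_ineq4[of "linear_flow T r (T v)" "linear_flow T a (T v)"] n[OF that] by linarith
    qed
  qed (use assms in \<open>auto intro: linear_flow_has_vector_derivative\<close>)
  moreover have "norm ((b - a) *\<^sub>R linear_flow T a (T v)) \<le> norm (b - a) * ?K"
    using n[of a] assms by (auto intro!: mult_left_mono)
  moreover have "norm (linear_flow T b v - linear_flow T a v) \<le>
      norm ((b - a) *\<^sub>R linear_flow T a (T v)) + norm (linear_flow T b v - linear_flow T a v - (b - a) *\<^sub>R linear_flow T a (T v))"
    by (rule norm_triangle_sub)
  ultimately show ?thesis by (simp add: algebra_simps)
qed

lemma linear_flow_taylor:
  assumes t: "0 \<le> t"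
  shows "\<exists>C\<ge>0. \<forall>a b. 0 \<le> a \<longrightarrow> 0 \<le> b \<longrightarrow> a \<le> t \<longrightarrow> b \<le> t \<longrightarrow>
    norm (linear_flow T b v - linear_flow T a v - (b - a) *\<^sub>R linear_flow T a (T v)) \<le> C * (b - a)\<^sup>2"
proof -
  let ?C = "3 * (exp (onorm T * t) * onorm T * norm (T v))"
  have C: "?C \<ge> 0" using onorm_pos_le[OF T] by simp
  have "norm (linear_flow T b v - linear_flow T a v - (b - a) *\<^sub>R linear_flow T a (T v)) \<le> ?C * (b - a)\<^sup>2"
    if ab: "0 \<le> a" "0 \<le> b" "a \<le> t" "b \<le> t" for a b
  proof -
    have "norm (linear_flow T b v - linear_flow T a v - (b - a) *\<^sub>R linear_flow T a (T v)) \<le> norm (b - a) * (?C * \<bar>b - a\<bar>)"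
    proof (rule vector_differentiable_bound_linearization[where S="closed_segment a b" and f'="\<lambda>r. linear_flow T r (T v)"])
      fix r assume r: "r \<in> closed_segment a b"
      then have "r \<in> {0..t}" "\<bar>r - a\<bar> \<le> \<bar>b - a\<bar>" using ab by (auto simp: closed_segment_eq_real_ivl split: if_splits)
      then show "norm (linear_flow T r (T v) - linear_flow T a (T v)) \<le> ?C * \<bar>b - a\<bar>"
        using linear_flow_lipschitz[of a r t "T v"] ab C
        by (auto intro!: order_trans[OF linear_flow_lipschitz[of a r t "T v"]] mult_left_mono)
    qed (auto intro: linear_flow_has_vector_derivative)
    also have "\<dots> = ?C * (\<bar>b - a\<bar> * \<bar>b - a\<bar>)" by (simp only: real_norm_def mult_ac)
    also have "\<bar>b - a\<bar> * \<bar>b - a\<bar> = (b - a)\<^sup>2" by (simp add: power2_eq_square)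
    finally show ?thesis .
  qed
  with C show ?thesis by blast
qed

text \<open>
  Differentiating \<open>Q (linear_flow T r v) = 0\<close> in \<open>r\<close> replaces \<open>v\<close> by \<open>T v\<close>; after \<open>k\<close> steps put \<open>r = 0\<close>.
\<close>

lemma linear_flow_kernel:
  assumes Q: "bounded_linear Q" and t: "0 < t" and zero: "\<And>r. r \<in> {0..t} \<Longrightarrow> Q (linear_flow T r v) = 0"
  shows "Q ((T ^^ k) v) = 0"
proof -
  have step: "Q (linear_flow T r (T v)) = 0" if z: "\<And>r. r \<in> {0..t} \<Longrightarrow> Q (linear_flow T r v) = 0" and r: "r \<in> {0..t}" for v r
  proof (rule vector_derivative_unique_within_closed_interval[of 0 t r "\<lambda>r. Q (linear_flow T r v)"])
    show "((\<lambda>r. Q (linear_flow T r v)) has_vector_derivative Q (linear_flow T r (T v))) (at r within cbox 0 t)"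
      by (rule bounded_linear.has_vector_derivative[OF Q linear_flow_has_vector_derivative])
    have "((\<lambda>r. 0) has_vector_derivative 0) (at r within cbox 0 t)" by (rule has_vector_derivative_const)
    then show "((\<lambda>r. Q (linear_flow T r v)) has_vector_derivative 0) (at r within cbox 0 t)"
      by (rule has_vector_derivative_transform[rotated 2]) (use z r in auto)
  qed (use t r in auto)
  have "\<forall>r\<in>{0..t}. Q (linear_flow T r ((T ^^ k) v)) = 0"
  proof (induct k)
    case 0 then show ?case using zero by simp
  next
    case (Suc k) then show ?case using step[of "(T ^^ k) v"] by simp
  qed
  from bspec[OF this, of 0] show ?thesis using t by (simp add: linear_flow_0)
qed

text \<open>
  The hypothesis \<open>obs\<close> is observability of the pair \<open>(Q, T)\<close>, stated through the powers of \<open>T\<close>: no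
  nonzero vector has an output that vanishes identically.  Compactness of the unit sphere makes this uniform.
\<close>

lemma linear_flow_observable:
  assumes Q: "bounded_linear Q" and t: "0 < t"
    and obs: "\<And>v. (\<And>k. Q ((T ^^ k) v) = 0) \<Longrightarrow> v = 0"
  shows "\<exists>\<kappa>>0. \<forall>e. norm e = 1 \<longrightarrow> (\<exists>r\<in>{0..t}. \<kappa> \<le> norm (Q (linear_flow T r e)))"
proof (rule ccontr)
  assume neg: "\<not> ?thesis"
  have "\<exists>e. norm e = 1 \<and> (\<forall>r\<in>{0..t}. norm (Q (linear_flow T r e)) < inverse (real (Suc n)))" for n
  proof -
    have "inverse (real (Suc n)) > 0" by simp
    with neg show ?thesis by (meson not_le)
  qed
  then obtain e where e: "\<And>n. norm (e n) = 1"
    and small: "\<And>n r. r \<in> {0..t} \<Longrightarrow> norm (Q (linear_flow T r (e n))) < inverse (real (Suc n))"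
    by metis
  have "compact (sphere (0::'a) 1)" by simp
  then obtain l \<sigma> where l: "l \<in> sphere 0 1" and \<sigma>: "strict_mono \<sigma>" and lim: "(e \<circ> \<sigma>) \<longlonglongrightarrow> l"
    using e unfolding compact_def by (metis dist_0_norm mem_sphere)
  have "Q (linear_flow T r l) = 0" if r: "r \<in> {0..t}" for r
  proof -
    have bl: "bounded_linear (\<lambda>v. Q (linear_flow T r v))"
      by (rule bounded_linear_compose[OF Q]) (simp add: linear_conv_bounded_linear[symmetric] linear_linear_flow)
    have "(\<lambda>n. Q (linear_flow T r ((e \<circ> \<sigma>) n))) \<longlonglongrightarrow> Q (linear_flow T r l)"
      by (rule bounded_linear.tendsto[OF bl lim])
    moreover have "(\<lambda>n. Q (linear_flow T r ((e \<circ> \<sigma>) n))) \<longlonglongrightarrow> 0"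
    proof (rule Lim_null_comparison)
      have "norm (Q (linear_flow T r ((e \<circ> \<sigma>) n))) \<le> inverse (real (Suc (\<sigma> n)))" for n
        using small[OF r, of "\<sigma> n"] by simp
      then show "\<forall>\<^sub>F n in sequentially. norm (Q (linear_flow T r ((e \<circ> \<sigma>) n))) \<le> inverse (real (Suc (\<sigma> n)))"
        by simp
      show "(\<lambda>n. inverse (real (Suc (\<sigma> n)))) \<longlonglongrightarrow> 0"
        using LIMSEQ_subseq_LIMSEQ[OF LIMSEQ_inverse_real_of_nat \<sigma>] by (simp add: o_def)
    qed
    ultimately show ?thesis by (rule LIMSEQ_unique)
  qed
  then have "l = 0" using linear_flow_kernel[OF Q t] obs by blast
  with l show False by simp
qed

end

lemma transpose_pow_mult: "transpose (pow_mult A B k) *v v = transpose B *v (((*v) (transpose A)) ^^ k) v"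
proof (induct k arbitrary: v)
  case 0 then show ?case by (simp add: pow_mult_def)
next
  case (Suc k)
  have "pow_mult A B (Suc k) = A ** pow_mult A B k" by (simp add: pow_mult_def)
  then have "transpose (pow_mult A B (Suc k)) *v v = transpose (pow_mult A B k) *v (transpose A *v v)"
    by (simp only: matrix_transpose_mul matrix_vector_mul_assoc)
  then show ?case by (simp only: Suc[of "transpose A *v v"] funpow_Suc_right o_apply)
qed

text \<open>
  Controllability of \<open>(A, B)\<close> is observability of the transposed pair: a vector annihilated by all
  \<open>B\<^sup>T (A\<^sup>T)\<^sup>k\<close> is orthogonal to all columns of the blocks \<open>A\<^sup>k B\<close>, and these span the space.
\<close>

lemma kalman_observable:
  fixes A B :: "real ^ 'd ^ 'd"
  assumes rank: "concat_rank n (pow_mult A B) = CARD('d)"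
    and zero: "\<And>k. transpose B *v (((*v) (transpose A)) ^^ k) v = 0"
  shows "v = 0"
proof -
  let ?S = "\<Union>k\<in>{..n}. columns (pow_mult A B k)"
  have "dim ?S = DIM(real ^ 'd)" using rank by (simp add: concat_rank_def)
  then have sp: "span ?S = UNIV" by (simp only: dim_eq_full)
  have "orthogonal v w" if "w \<in> ?S" for w
  proof -
    obtain k j where w: "w = column j (pow_mult A B k)" using \<open>w \<in> ?S\<close> by (auto simp: columns_def)
    have "v \<bullet> w = (transpose (pow_mult A B k) *v v) $ j"
      by (simp add: w matrix_vector_mult_def inner_vec_def column_def transpose_def mult.commute)
    also have "\<dots> = 0" by (simp only: transpose_pow_mult zero zero_index)
    finally show ?thesis by (simp add: orthogonal_def)
  qed
  then have "orthogonal v v" using sp orthogonal_to_span[of v ?S v] by auto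
  then show ?thesis by (simp add: orthogonal_def)
qed

section \<open>Discretization of the linear equation\<close>

text \<open>
  One-sided limits make the path bounded near every time; the rest is compactness.
\<close>

lemma cadlag_bounded:
  fixes f :: "real \<Rightarrow> 'a::real_normed_vector"
  assumes f: "cadlag f"
  shows "\<exists>K\<ge>0. \<forall>s\<in>{0..t}. norm (f s) \<le> K"
proof -
  have loc: "\<exists>e>0. \<exists>K. \<forall>r\<in>{0..t}. \<bar>r - s\<bar> < e \<longrightarrow> norm (f r) \<le> K" if s: "s \<in> {0..t}" for s
  proof -
    have "(f \<longlongrightarrow> f s) (at_right s)" using f s by (auto simp: cadlag_def)
    then have "eventually (\<lambda>r. dist (f r) (f s) < 1) (at_right s)" by (rule tendstoD) simp
    then obtain e1 where e1: "e1 > s" "\<And>r. s < r \<Longrightarrow> r < e1 \<Longrightarrow> dist (f r) (f s) < 1"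
      unfolding eventually_at_right_field by blast
    obtain e2 K2 where e2: "e2 < s" "\<And>r. 0 \<le> r \<Longrightarrow> e2 < r \<Longrightarrow> r < s \<Longrightarrow> norm (f r) \<le> K2"
    proof (cases "s = 0")
      case True
      show ?thesis by (rule that[of "-1" 0]) (use True in auto)
    next
      case False
      then have "s > 0" using s by simp
      then obtain l where "(f \<longlongrightarrow> l) (at_left s)" using f by (auto simp: cadlag_def)
      then have "eventually (\<lambda>r. dist (f r) l < 1) (at_left s)" by (rule tendstoD) simp
      then obtain e2 where e2: "e2 < s" "\<And>r. e2 < r \<Longrightarrow> r < s \<Longrightarrow> dist (f r) l < 1"
        unfolding eventually_at_left_field by blast
      show ?thesis
      proof (rule that[OF e2(1)])
        fix r assume "e2 < r" "r < s"
        then have "dist (f r) l < 1" by (rule e2(2))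
        then show "norm (f r) \<le> norm l + 1"
          using norm_triangle_ineq2[of "f r" l] by (simp add: dist_norm)
      qed
    qed
    define e where "e = min (e1 - s) (s - e2)"
    define K where "K = max K2 (norm (f s) + 1)"
    have "norm (f r) \<le> K" if r: "r \<in> {0..t}" "\<bar>r - s\<bar> < e" for r
    proof -
      consider "r = s" | "r < s" | "s < r" by linarith
      then show ?thesis
      proof cases
        case 2
        then show ?thesis using e2(2)[of r] r by (auto simp: K_def e_def)
      next
        case 3
        then have "dist (f r) (f s) < 1" using e1(2)[of r] r by (auto simp: e_def)
        then show ?thesis
          using norm_triangle_ineq2[of "f r" "f s"] by (simp add: dist_norm K_def)
      qed (simp add: K_def)
    qed
    moreover have "e > 0" using e1 e2 by (simp add: e_def)
    ultimately show ?thesis by blast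
  qed
  then obtain e K where e: "\<And>s. s \<in> {0..t} \<Longrightarrow> e s > 0"
    and K: "\<And>s r. s \<in> {0..t} \<Longrightarrow> r \<in> {0..t} \<Longrightarrow> \<bar>r - s\<bar> < e s \<Longrightarrow> norm (f r) \<le> K s"
    by metis
  have "{0..t} \<subseteq> (\<Union>s\<in>{0..t}. ball s (e s))" using e by force
  then obtain S where S: "S \<subseteq> {0..t}" "finite S" "{0..t} \<subseteq> (\<Union>s\<in>S. ball s (e s))"
    using compactE_image[OF compact_Icc[of 0 t], of "{0..t}" "\<lambda>s. ball s (e s)"] by auto
  have "norm (f r) \<le> (\<Sum>s\<in>S. \<bar>K s\<bar>)" if r: "r \<in> {0..t}" for r
  proof -
    obtain s where s: "s \<in> S" "r \<in> ball s (e s)" using S(3) r by blast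
    then have "norm (f r) \<le> K s" using S(1) r by (intro K) (auto simp: dist_real_def)
    also have "\<dots> \<le> \<bar>K s\<bar>" by simp
    also have "\<dots> \<le> (\<Sum>s\<in>S. \<bar>K s\<bar>)" using s S(2) by (intro member_le_sum) auto
    finally show ?thesis .
  qed
  moreover have "0 \<le> (\<Sum>s\<in>S. \<bar>K s\<bar>)" by (intro sum_nonneg) auto
  ultimately show ?thesis by blast
qed

text \<open>
  The variation of constants formula
  \<open>q t \<bullet> X t = q 0 \<bullet> X 0 + \<integral> (B\<^sup>T q s) \<bullet> dL s\<close> for a solution \<open>q\<close> of the adjoint equation
  \<open>q' = - A\<^sup>T q\<close>, with the stochastic integral replaced by the limit of its Riemann sums over \<open>n + 1\<close>
  equal cells.  In this form it holds for each path separately, without any integration theory for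
  the irregular \<open>L\<close>.  On a cell \<open>[a, b]\<close> the increment of \<open>q \<bullet> X\<close> differs from the summand by
  \<open>q a \<bullet> \<integral> (A X s - A X b) ds\<close>, whose sum vanishes by right continuity of \<open>X\<close> and dominated
  convergence, and by a Taylor error of order \<open>(b - a)\<^sup>2\<close>.
\<close>

lemma linear_ode_discretization:
  fixes A B :: "real ^ 'd ^ 'd" and X L q q' :: "real \<Rightarrow> real ^ 'd"
  assumes t: "0 < t"
    and X: "cadlag X"
    and int: "\<And>s. 0 \<le> s \<Longrightarrow> (\<lambda>r. A *v X r) integrable_on {0..s}"
    and eq: "\<And>s. 0 \<le> s \<Longrightarrow> X s = x + integral {0..s} (\<lambda>r. A *v X r) + B *v L s"
    and taylor: "\<And>a b. 0 \<le> a \<Longrightarrow> a \<le> b \<Longrightarrow> b \<le> t \<Longrightarrow>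
        norm (q b - q a + (b - a) *\<^sub>R (transpose A *v q a)) \<le> C * (b - a)\<^sup>2"
    and qb: "\<And>s. s \<in> {0..t} \<Longrightarrow> norm (q s) \<le> Q"
  shows "(\<lambda>n. q 0 \<bullet> x + (transpose B *v q 0) \<bullet> L 0 +
      (\<Sum>i<Suc n. (transpose B *v q (real i * (t / real (Suc n)))) \<bullet>
        (L (real (Suc i) * (t / real (Suc n))) - L (real i * (t / real (Suc n)))))) \<longlonglongrightarrow> q t \<bullet> X t"
proof -
  define g where "g s = A *v X s" for s
  obtain K where K0: "0 \<le> K" and K: "\<And>s. s \<in> {0..t} \<Longrightarrow> norm (X s) \<le> K"
    using cadlag_bounded[OF X, of t] by blast
  define h where "h n = t / real (Suc n)" for n
  have h: "0 < h n" for n using t by (simp add: h_def del: of_nat_Suc)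
  have hn: "real (Suc n) * h n = t" for n by (simp add: h_def del: of_nat_Suc)
  have hle: "real i * h n \<le> t" if "i \<le> Suc n" for i n
  proof -
    have "real i * h n \<le> real (Suc n) * h n" using that h[of n] by (intro mult_right_mono) auto
    then show ?thesis unfolding hn .
  qed
  (* kk n s - 1 is the index of the cell (i h, (i + 1) h] that contains s; its right end point tends
     to s from the right. At s = 0 the integrand f is zero whatever the value of q. *)
  define kk where "kk n s = nat \<lceil>s / h n\<rceil>" for n s
  define f where "f n s = q ((real (kk n s) - 1) * h n) \<bullet> (g s - g (real (kk n s) * h n))" for n s
  define J where "J n i = q (real i * h n) \<bullet> (integral {real i * h n..real (Suc i) * h n} g - h n *\<^sub>R g (real (Suc i) * h n))" for n i
  have gi: "g integrable_on {a..b}" if "0 \<le> a" for a b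
  proof (cases "a \<le> b")
    case True
    show ?thesis
      by (rule integrable_on_subinterval[OF int[of b, folded g_def[abs_def]]]) (use that True in auto)
  qed (simp add: integrable_on_empty)
  have cell: "(f n has_integral J n i) {real i * h n..real (Suc i) * h n}" if i: "i \<le> n" for n i
  proof -
    let ?a = "real i * h n" and ?b = "real (Suc i) * h n"
    have ab: "?a \<le> ?b" "?b - ?a = h n" "0 \<le> ?a" using h[of n] by (auto simp: algebra_simps)
    have c: "((\<lambda>_. g ?b) has_integral (?b - ?a) *\<^sub>R g ?b) {?a..?b}"
      using ab(1) has_integral_const_real[of "g ?b" ?a ?b] by simp
    have "((\<lambda>s. g s - g ?b) has_integral integral {?a..?b} g - h n *\<^sub>R g ?b) {?a..?b}"
      using has_integral_diff[OF integrable_integral[OF gi[OF ab(3)]] c] unfolding ab(2) .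
    then have "((\<lambda>s. q ?a \<bullet> (g s - g ?b)) has_integral J n i) {?a..?b}"
      using has_integral_linear[OF _ bounded_linear_inner_right[of "q ?a"]] by (simp add: J_def o_def)
    then show ?thesis
    proof (rule has_integral_spike_finite[of "{?a}", rotated 2])
      fix s assume "s \<in> {?a..?b} - {?a}"
      then have "real i * h n < s" "s \<le> real (Suc i) * h n" by auto
      then have "real i < s / h n" "s / h n \<le> real (Suc i)" using h[of n] by (simp_all add: field_simps)
      then have "\<lceil>s / h n\<rceil> = int (Suc i)" by (intro ceiling_unique) auto
      then have "kk n s = Suc i" by (simp add: kk_def)
      then show "f n s = q ?a \<bullet> (g s - g ?b)" by (simp add: f_def)
    qed simp
  qed
  have sum_cells: "(f n has_integral (\<Sum>i<m. J n i)) {0..real m * h n}" if "m \<le> Suc n" for n m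
    using that
  proof (induct m)
    case 0
    then show ?case by (simp add: has_integral_refl)
  next
    case (Suc m)
    have "(f n has_integral (\<Sum>i<m. J n i) + J n m) {0..real (Suc m) * h n}"
    proof (rule has_integral_combine)
      show "(f n has_integral (\<Sum>i<m. J n i)) {0..real m * h n}" using Suc by simp
      show "(f n has_integral J n m) {real m * h n..real (Suc m) * h n}" using Suc by (intro cell) simp
    qed (use h[of n] in \<open>auto simp: algebra_simps\<close>)
    then show ?case by (simp del: of_nat_Suc)
  qed
  have fi: "(f n has_integral (\<Sum>i<Suc n. J n i)) {0..t}" for n
    using sum_cells[of "Suc n" n] unfolding hn by simp
  have cs: "s \<le> real (kk n s) * h n" "real (kk n s) * h n < s + h n" "real (kk n s) * h n \<le> t" if s: "s \<in> {0..t}" for n s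
  proof -
    have p: "0 \<le> s / h n" using s h[of n] by simp
    then have k: "real (kk n s) = of_int \<lceil>s / h n\<rceil>" unfolding kk_def by simp
    have "s / h n \<le> real (kk n s)" unfolding k by (rule le_of_int_ceiling)
    then show "s \<le> real (kk n s) * h n" using h[of n] by (simp add: pos_divide_le_eq)
    have "real (kk n s) < s / h n + 1" unfolding k using ceiling_correct[of "s / h n"] by linarith
    then show "real (kk n s) * h n < s + h n" using h[of n] by (simp add: field_simps)
    have "s / h n \<le> real (Suc n)"
      using s h[of n] hn[of n] by (simp add: pos_divide_le_eq del: of_nat_Suc)
    then have "\<lceil>s / h n\<rceil> \<le> int (Suc n)" by (intro ceiling_le) (simp only: of_int_of_nat_eq)
    then have "kk n s \<le> Suc n" by (simp only: kk_def nat_le_iff)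
    then show "real (kk n s) * h n \<le> t" by (rule hle)
  qed
  have gK: "norm (g s) \<le> onorm ((*v) A) * K" if "s \<in> {0..t}" for s
    unfolding g_def using onorm[OF matrix_vector_mul_bounded_linear, of A "X s"] K[OF that]
      onorm_pos_le[OF matrix_vector_mul_bounded_linear[of A]]
    by (meson mult_left_mono order_trans)
  let ?G = "onorm ((*v) A) * K"
  have G0: "0 \<le> ?G" using order_trans[OF norm_ge_zero gK[of 0]] t by simp
  have Q0: "0 \<le> Q" using order_trans[OF norm_ge_zero qb[of 0]] t by simp
  have h0: "h \<longlonglongrightarrow> 0"
    using tendsto_mult[OF tendsto_const[of t] LIMSEQ_inverse_real_of_nat] by (simp add: h_def[abs_def] divide_inverse)
  have "(\<lambda>n. integral {0..t} (f n)) \<longlonglongrightarrow> integral {0..t} (\<lambda>_. 0 :: real)"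
  proof (rule dominated_convergence(2))
    show "f n integrable_on {0..t}" for n using fi by blast
    show "(\<lambda>_. Q * (?G + ?G)) integrable_on {0..t}" by (rule integrable_const_ivl)
    have fb: "\<bar>f n s\<bar> \<le> Q * norm (g s - g (real (kk n s) * h n))" if s: "s \<in> {0..t}" for n s
    proof (cases "kk n s = 0")
      case True
      then have "s = 0" using cs(1)[OF s, of n] s by simp
      then show ?thesis using True by (simp add: f_def)
    next
      case False
      then have "(real (kk n s) - 1) * h n \<in> {0..t}"
        using cs[OF s, of n] h[of n] by (auto simp: algebra_simps)
      then have "norm (q ((real (kk n s) - 1) * h n)) \<le> Q" by (rule qb)
      then show ?thesis
        unfolding f_def by (intro order_trans[OF Cauchy_Schwarz_ineq2 mult_right_mono]) auto
    qed
    show "norm (f n s) \<le> Q * (?G + ?G)" if s: "s \<in> {0..t}" for n s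
    proof -
      have "norm (g s - g (real (kk n s) * h n)) \<le> norm (g s) + norm (g (real (kk n s) * h n))"
        by (rule norm_triangle_ineq4)
      also have "\<dots> \<le> ?G + ?G"
        using cs[OF s, of n] s by (intro add_mono gK) auto
      finally show ?thesis using fb[OF s, of n] Q0 by (simp add: order_trans[OF _ mult_left_mono])
    qed
    show "(\<lambda>n. f n s) \<longlonglongrightarrow> 0" if s: "s \<in> {0..t}" for s
    proof (rule Lim_null_comparison)
      show "\<forall>\<^sub>F n in sequentially. norm (f n s) \<le> Q * norm (g s - g (real (kk n s) * h n))"
        using fb[OF s] by simp
      have "(X \<longlongrightarrow> X s) (at_right s)" using X s by (auto simp: cadlag_def)
      then have "(g \<longlongrightarrow> g s) (at_right s)"
        unfolding g_def by (rule bounded_linear.tendsto[OF matrix_vector_mul_bounded_linear])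
      then have cont: "continuous (at s within {s..}) g"
        unfolding continuous_within at_within_Ici_at_right .
      have "(\<lambda>n. real (kk n s) * h n) \<longlonglongrightarrow> s"
      proof (rule tendsto_sandwich)
        show "(\<lambda>n. s) \<longlonglongrightarrow> s" by simp
        show "(\<lambda>n. s + h n) \<longlonglongrightarrow> s" using tendsto_add[OF tendsto_const[of s] h0] by simp
      qed (use cs[OF s] in \<open>auto intro!: always_eventually less_imp_le\<close>)
      then have "(\<lambda>n. g (real (kk n s) * h n)) \<longlonglongrightarrow> g s"
        using continuous_within_tendsto_compose'[OF cont, of "\<lambda>n. real (kk n s) * h n"] cs(1)[OF s] by auto
      then have "(\<lambda>n. Q * norm (g s - g (real (kk n s) * h n))) \<longlonglongrightarrow> Q * norm (g s - g s)"
        by (intro tendsto_intros)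
      then show "(\<lambda>n. Q * norm (g s - g (real (kk n s) * h n))) \<longlonglongrightarrow> 0" by simp
    qed
  qed
  then have Jlim: "(\<lambda>n. \<Sum>i<Suc n. J n i) \<longlonglongrightarrow> 0"
    unfolding integral_unique[OF fi] by simp
  (* the Taylor error of the cell *)
  define D where "D n i = (q (real (Suc i) * h n) - q (real i * h n) + h n *\<^sub>R (transpose A *v q (real i * h n))) \<bullet> X (real (Suc i) * h n)" for n i
  have Dlim: "(\<lambda>n. \<Sum>i<Suc n. D n i) \<longlonglongrightarrow> 0"
  proof (rule Lim_null_comparison)
    show "\<forall>\<^sub>F n in sequentially. norm (\<Sum>i<Suc n. D n i) \<le> t * C * K * h n"
    proof (intro always_eventually allI)
      fix n
      have "norm (\<Sum>i<Suc n. D n i) \<le> (\<Sum>i<Suc n. C * (h n)\<^sup>2 * K)"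
      proof (rule order_trans[OF norm_sum sum_mono])
        fix i assume "i \<in> {..<Suc n}"
        then have i: "real (Suc i) * h n \<le> t" by (intro hle) simp
        have d: "real (Suc i) * h n - real i * h n = h n" by (simp add: algebra_simps)
        have i0: "0 \<le> real i * h n" "real i * h n \<le> real (Suc i) * h n" using h[of n] by (auto simp: algebra_simps)
        have "norm (q (real (Suc i) * h n) - q (real i * h n) + h n *\<^sub>R (transpose A *v q (real i * h n))) \<le> C * (h n)\<^sup>2"
          using taylor[OF i0 i] unfolding d .
        moreover have "norm (X (real (Suc i) * h n)) \<le> K" using i i0 by (intro K) auto
        ultimately show "norm (D n i) \<le> C * (h n)\<^sup>2 * K"
          unfolding D_def real_norm_def
          by (intro order_trans[OF Cauchy_Schwarz_ineq2] mult_mono) (auto intro: order_trans[OF norm_ge_zero])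
      qed
      also have "\<dots> = (real (Suc n) * h n) * C * K * h n" by (simp add: power2_eq_square)
      finally show "norm (\<Sum>i<Suc n. D n i) \<le> t * C * K * h n" unfolding hn .
    qed
    show "(\<lambda>n. t * C * K * h n) \<longlonglongrightarrow> 0"
      using tendsto_mult[OF tendsto_const[of "t * C * K"] h0] by simp
  qed
  have cell_eq: "q (real (Suc i) * h n) \<bullet> X (real (Suc i) * h n) - q (real i * h n) \<bullet> X (real i * h n) =
      J n i + D n i + (transpose B *v q (real i * h n)) \<bullet> (L (real (Suc i) * h n) - L (real i * h n))" for n i
  proof -
    let ?a = "real i * h n" and ?b = "real (Suc i) * h n"
    have ab: "?a \<le> ?b" "0 \<le> ?a" "0 \<le> ?b" using h[of n] by (auto simp: algebra_simps)
    have "integral {0..?a} g + integral {?a..?b} g = integral {0..?b} g"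
      by (rule Henstock_Kurzweil_Integration.integral_combine[OF ab(2,1) gi]) simp
    then have Xd: "X ?b - X ?a = integral {?a..?b} g + B *v (L ?b - L ?a)"
      using eq[OF ab(2)] eq[OF ab(3)] unfolding g_def[symmetric]
      by (simp add: matrix_vector_mult_diff_distrib algebra_simps)
    have tr: "(transpose B *v v) \<bullet> w = v \<bullet> (B *v w)" "(transpose A *v v) \<bullet> w = v \<bullet> (A *v w)" for v w
      by (simp_all add: dot_lmul_matrix[symmetric])
    have "q ?b \<bullet> X ?b - q ?a \<bullet> X ?a = q ?a \<bullet> (X ?b - X ?a) + (q ?b - q ?a) \<bullet> X ?b"
      by (simp add: inner_diff_left inner_diff_right)
    also have "\<dots> = q ?a \<bullet> integral {?a..?b} g + q ?a \<bullet> (B *v (L ?b - L ?a)) + (q ?b - q ?a) \<bullet> X ?b"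
      unfolding Xd by (simp only: inner_add_right)
    also have "\<dots> = J n i + D n i + (transpose B *v q ?a) \<bullet> (L ?b - L ?a)"
      unfolding J_def D_def tr inner_add_left inner_scaleR_left inner_diff_right inner_scaleR_right g_def
      by (simp add: matrix_vector_mult_diff_distrib inner_diff_right)
    finally show ?thesis .
  qed
  define W where "W n = q 0 \<bullet> x + (transpose B *v q 0) \<bullet> L 0 +
      (\<Sum>i<Suc n. (transpose B *v q (real i * h n)) \<bullet> (L (real (Suc i) * h n) - L (real i * h n)))" for n
  have X0: "q 0 \<bullet> X 0 = q 0 \<bullet> x + (transpose B *v q 0) \<bullet> L 0"
    using eq[of 0] by (simp add: inner_add_right dot_lmul_matrix)
  have W: "W n = q t \<bullet> X t - (\<Sum>i<Suc n. J n i) - (\<Sum>i<Suc n. D n i)" for n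
  proof -
    have "(\<Sum>i<Suc n. q (real (Suc i) * h n) \<bullet> X (real (Suc i) * h n) - q (real i * h n) \<bullet> X (real i * h n)) =
        q (real (Suc n) * h n) \<bullet> X (real (Suc n) * h n) - q (real 0 * h n) \<bullet> X (real 0 * h n)"
      by (rule sum_lessThan_telescope)
    then show ?thesis
      unfolding cell_eq sum.distrib hn W_def using X0 by simp
  qed
  have "W \<longlonglongrightarrow> q t \<bullet> X t - 0 - 0"
    unfolding W[abs_def] by (intro tendsto_diff tendsto_const Jlim Dlim)
  then show ?thesis
    by (simp only: W_def[abs_def] h_def diff_zero)
qed

section \<open>Mass of small balls under the jump measure\<close>

text \<open>
  For every jump \<open>z\<close> in this ball the product \<open>w \<bullet> z\<close> is within \<open>1/4\<close> of \<open>1/2\<close>, so these jumps move the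
  phase \<open>w \<bullet> z\<close> noticeably.  The ball has volume of order \<open>norm w\<close> to the power \<open>- d\<close>, and the
  density is of order \<open>norm w\<close> to the power \<open>d + \<alpha>\<close> on it because all its points have norm at most
  \<open>1 / norm w\<close>.
\<close>

lemma assumption_N_ball_lower_bound:
  fixes \<nu> :: "(real ^ 'd) measure"
  assumes N: "assumption_N \<nu>"
  shows "\<exists>\<alpha>>0. \<exists>c>0. \<forall>w. 1 \<le> norm w \<longrightarrow>
    ennreal (c * norm w powr \<alpha>) \<le> emeasure \<nu> (ball (w /\<^sub>R (2 * (norm w)\<^sup>2)) (1 / (4 * norm w)))"
proof -
  obtain \<rho> \<alpha> \<theta> c C where \<nu>: "\<nu> = density lborel (\<lambda>z. ennreal (\<rho> z))" and Ck: "Ck_on 1 (- {0}) \<rho>"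
    and \<alpha>: "0 < \<alpha>" and \<rho>: "\<And>z. 0 < norm z \<Longrightarrow> norm z < 1 \<Longrightarrow> \<rho> z = \<theta> z / norm z powr (real CARD('d) + \<alpha>)"
    and c: "0 < c" and \<theta>: "\<And>z. 0 < norm z \<Longrightarrow> norm z < 1 \<Longrightarrow> c \<le> \<theta> z"
    using N unfolding assumption_N_def by blast
  let ?V = "unit_ball_vol (real DIM(real ^ 'd))" and ?D = "DIM(real ^ 'd)"
  define c1 where "c1 = c * ?V / 4 ^ ?D"
  have c1: "0 < c1" using c by (simp add: c1_def)
  have "continuous_on (- {0}) \<rho>"
  proof (intro continuous_at_imp_continuous_on ballI differentiable_imp_continuous_within)
    fix z :: "real ^ 'd" assume "z \<in> - {0}"
    then show "\<rho> differentiable (at z)" using Ck by simp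
  qed
  then have \<rho>m: "\<rho> \<in> borel_measurable borel"
    by (intro borel_measurable_continuous_countable_exceptions[of "{0}"]) auto
  have bound: "ennreal (c1 * norm w powr \<alpha>) \<le> emeasure \<nu> (ball (w /\<^sub>R (2 * (norm w)\<^sup>2)) (1 / (4 * norm w)))"
    if w: "1 \<le> norm w" for w
  proof -
    let ?B = "ball (w /\<^sub>R (2 * (norm w)\<^sup>2)) (1 / (4 * norm w))"
    have w0: "0 < norm w" using w by linarith
    have nc: "norm (w /\<^sub>R (2 * (norm w)\<^sup>2)) = 1 / (2 * norm w)"
    proof -
      have "norm (w /\<^sub>R (2 * (norm w)\<^sup>2)) = inverse (2 * (norm w)\<^sup>2) * norm w"
        using norm_scaleR[of "inverse (2 * (norm w)\<^sup>2)" w] by simp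
      moreover have "inverse (2 * r\<^sup>2) * r = 1 / (2 * r)" if "0 < r" for r :: real
        using that by (simp add: power2_eq_square field_simps)
      ultimately show ?thesis using w0 by (simp only:)
    qed
    have zB: "0 < norm z" "norm z < 1" "norm z \<le> 1 / norm w" if "z \<in> ?B" for z
    proof -
      let ?c = "w /\<^sub>R (2 * (norm w)\<^sup>2)"
      have d: "norm (?c - z) < 1 / (4 * norm w)" using that by (simp add: dist_norm)
      have "norm ?c - norm z \<le> norm (?c - z)" by (rule norm_triangle_ineq2)
      moreover have "norm z - norm ?c \<le> norm (?c - z)" by (rule norm_triangle_ineq3[THEN abs_le_D2, THEN order_trans[rotated]]) simp
      moreover have "1 / (2 * norm w) = 2 * (1 / (4 * norm w))" "1 / norm w = 4 * (1 / (4 * norm w))" by simp_all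
      moreover have "0 < 1 / (4 * norm w)" "1 / norm w \<le> 1" using w w0 by (simp_all add: divide_le_eq)
      ultimately show "0 < norm z" "norm z < 1" "norm z \<le> 1 / norm w"
        using d unfolding nc by linarith+
    qed
    have \<rho>B: "c * norm w powr (real ?D + \<alpha>) \<le> \<rho> z" if z: "z \<in> ?B" for z
    proof -
      note z' = zB[OF z]
      have "norm w powr (real ?D + \<alpha>) = inverse ((1 / norm w) powr (real ?D + \<alpha>))"
        using w0 by (simp add: powr_divide)
      also have "\<dots> \<le> inverse (norm z powr (real ?D + \<alpha>))"
        using z' \<alpha> by (intro le_imp_inverse_le powr_mono2) auto
      finally have "c * norm w powr (real ?D + \<alpha>) \<le> \<theta> z * inverse (norm z powr (real ?D + \<alpha>))"
        using \<theta>[OF z'(1,2)] c by (intro mult_mono) auto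
      then show ?thesis using \<rho>[OF z'(1,2)] by (simp add: divide_inverse)
    qed
    have "ennreal (c1 * norm w powr \<alpha>) = ennreal (c * norm w powr (real ?D + \<alpha>)) * emeasure lborel ?B"
    proof -
      have eq: "norm w powr (real ?D + \<alpha>) * (1 / (4 * norm w)) ^ ?D = norm w powr \<alpha> / 4 ^ ?D"
        using w0 by (simp add: powr_add powr_realpow power_divide power_mult_distrib)
      have "c1 * norm w powr \<alpha> = c * ?V * (norm w powr \<alpha> / 4 ^ ?D)"
        by (simp add: c1_def)
      also have "\<dots> = c * norm w powr (real ?D + \<alpha>) * (?V * (1 / (4 * norm w)) ^ ?D)"
        unfolding eq[symmetric] by (simp only: mult_ac)
      finally have "c1 * norm w powr \<alpha> = c * norm w powr (real ?D + \<alpha>) * (?V * (1 / (4 * norm w)) ^ ?D)" .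
      moreover have "emeasure lborel ?B = ennreal (?V * (1 / (4 * norm w)) ^ ?D)"
        by (rule emeasure_ball) simp
      ultimately show ?thesis
        using c by (simp only: ennreal_mult[symmetric] powr_ge_zero mult_nonneg_nonneg less_imp_le) (subst ennreal_mult, auto)
    qed
    also have "\<dots> = (\<integral>\<^sup>+z. ennreal (c * norm w powr (real ?D + \<alpha>)) * indicator ?B z \<partial>lborel)"
      by (subst nn_integral_cmult_indicator) auto
    also have "\<dots> \<le> (\<integral>\<^sup>+z. ennreal (\<rho> z) * indicator ?B z \<partial>lborel)"
      using \<rho>B by (intro nn_integral_mono) (auto simp: indicator_def intro!: ennreal_leI)
    also have "\<dots> = emeasure \<nu> ?B"
      unfolding \<nu> using \<rho>m by (subst emeasure_density) auto
    finally show ?thesis .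
  qed
  show ?thesis
    by (rule exI[of _ \<alpha>], rule conjI[OF \<alpha>], rule exI[of _ c1], rule conjI[OF c1]) (intro allI impI bound)
qed

section \<open>Decay of the characteristic function of the solution\<close>

lemma abel_summation_inner:
  fixes c l :: "nat \<Rightarrow> 'a::real_inner"
  shows "c 0 \<bullet> l 0 + (\<Sum>i<n. c i \<bullet> (l (Suc i) - l i)) = (\<Sum>j=1..n. (c (j - 1) - c j) \<bullet> l j) + c n \<bullet> l n"
  by (induct n) (auto simp: inner_diff_left inner_diff_right)

text \<open>
  The coefficient of a jump at time \<open>s\<close> after summation by parts: the telescoping sum recovers the
  value \<open>c m\<close> attached to the cell of \<open>s\<close>.
\<close>

lemma step_function_telescope:
  fixes c :: "nat \<Rightarrow> 'a::real_inner"
  assumes h: "0 < h" and m: "real m * h < s" "s \<le> real (Suc m) * h" and n: "Suc m \<le> n" and cn: "c n = 0"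
  shows "(\<Sum>j=1..n. indicator {0<..real j * h} s * ((c (j - 1) - c j) \<bullet> z)) = c m \<bullet> z"
proof -
  have s0: "0 < s" using h m(1) by (meson less_imp_le mult_nonneg_nonneg of_nat_0_le_iff order_le_less_trans)
  have "indicator {0<..real j * h} s = (if Suc m \<le> j then 1 else 0 :: real)" for j
  proof (cases "Suc m \<le> j")
    case True
    then have "real (Suc m) * h \<le> real j * h" using h by (intro mult_right_mono) auto
    then show ?thesis using True m s0 by simp
  next
    case False
    then have "real j * h \<le> real m * h" using h by (intro mult_right_mono) auto
    then show ?thesis using False m by simp
  qed
  then have "(\<Sum>j=1..n. indicator {0<..real j * h} s * ((c (j - 1) - c j) \<bullet> z)) =
      (\<Sum>j=1..n. if Suc m \<le> j then (c (j - 1) - c j) \<bullet> z else 0)"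
    by (intro sum.cong refl) auto
  also have "\<dots> = (\<Sum>j\<in>{Suc m..n}. (c (j - 1) - c j) \<bullet> z)"
    by (rule sum.mono_neutral_cong_right) auto
  also have "\<dots> = - (\<Sum>j\<in>{Suc m..n}. c j \<bullet> z - c (j - 1) \<bullet> z)"
    by (simp add: sum_negf[symmetric] inner_diff_left)
  also have "(\<Sum>j\<in>{Suc m..n}. c j \<bullet> z - c (j - 1) \<bullet> z) = c n \<bullet> z - c m \<bullet> z"
    using n by (intro sum_telescope'') simp
  finally show ?thesis by (simp add: cn)
qed

text \<open>
  The margins: \<open>w \<bullet> z\<close> lies in \<open>[1/4, 3/4]\<close>, and replacing \<open>w\<close> by \<open>c\<close> costs at most
  \<open>(norm w / 8) (3 / (4 norm w)) = 3/32\<close>, so \<open>c \<bullet> z\<close> stays in \<open>[1/8, 1]\<close>, where \<open>cos\<close> decreases.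
\<close>

lemma phase_on_ball:
  fixes w c z :: "'a::real_inner"
  assumes w: "1 \<le> norm w" and z: "z \<in> ball (w /\<^sub>R (2 * (norm w)\<^sup>2)) (1 / (4 * norm w))"
    and c: "norm (c - w) \<le> norm w / 8"
  shows "1 / (8 * norm w) < norm z" "norm z \<le> 1" "1 - cos (1 / 8) \<le> 1 - cos (c \<bullet> z)"
proof -
  define r where "r = norm w"
  have r: "1 \<le> r" "0 < r" using w by (auto simp: r_def)
  define v where "v = w /\<^sub>R (2 * (norm w)\<^sup>2)"
  have ww: "w \<bullet> w = r\<^sup>2" by (simp add: r_def power2_norm_eq_inner)
  have wv: "w \<bullet> v = 1 / 2" unfolding v_def r_def[symmetric] inner_scaleR_right ww using r(2) by simp
  have nv: "norm v = 1 / (2 * r)"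
  proof -
    have "norm v = inverse (2 * r\<^sup>2) * r"
      unfolding v_def r_def[symmetric] norm_scaleR using r(2) by (simp add: r_def[symmetric])
    then show ?thesis using r(2) by (simp add: power2_eq_square field_simps)
  qed
  have d: "norm (z - v) < 1 / (4 * r)"
    using z by (simp add: v_def r_def dist_norm norm_minus_commute)
  define y where "y = 1 / (4 * r)"
  have y: "0 < y" "y \<le> 1 / 4" "1 / (2 * r) = 2 * y" "1 / (8 * r) = y / 2" "r * y = 1 / 4"
    using r by (auto simp: y_def field_simps)
  have nz: "norm z \<le> norm v + norm (z - v)" "norm v \<le> norm z + norm (z - v)"
    using norm_triangle_sub[of z v] norm_triangle_sub[of v z] by (simp_all add: norm_minus_commute)
  show "1 / (8 * norm w) < norm z" unfolding r_def[symmetric] using nz(2) d unfolding nv y_def[symmetric] y using y by linarith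
  show "norm z \<le> 1" using nz(1) d unfolding nv y_def[symmetric] y using y by linarith
  have nz3: "norm z \<le> 3 * y" using nz(1) d unfolding nv y_def[symmetric] y using y by linarith
  have "\<bar>(c - w) \<bullet> z\<bar> \<le> norm (c - w) * norm z" by (rule Cauchy_Schwarz_ineq2)
  also have "\<dots> \<le> (r / 8) * (3 * y)" using c nz3 r by (intro mult_mono) (auto simp: r_def)
  also have "\<dots> = 3 / 32" using y(5) by simp
  finally have 1: "\<bar>(c - w) \<bullet> z\<bar> \<le> 3 / 32" .
  have "\<bar>w \<bullet> (z - v)\<bar> \<le> norm w * norm (z - v)" by (rule Cauchy_Schwarz_ineq2)
  also have "\<dots> \<le> r * y" using d r unfolding r_def[symmetric] y_def[symmetric] by (intro mult_left_mono) auto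
  finally have 2: "\<bar>w \<bullet> (z - v)\<bar> \<le> 1 / 4" unfolding y(5) .
  have "c \<bullet> z = (c - w) \<bullet> z + w \<bullet> (z - v) + 1 / 2"
    by (simp add: inner_diff_left inner_diff_right wv)
  then have "1 / 8 \<le> c \<bullet> z" "c \<bullet> z \<le> 1" using 1 2 by linarith+
  then have "cos (c \<bullet> z) \<le> cos (1 / 8)"
    using pi_ge_two by (intro cos_monotone_0_pi_le) auto
  then show "1 - cos (1 / 8) \<le> 1 - cos (c \<bullet> z)" by simp
qed

context levy_noise
begin

text \<open>
  Only the jumps in the ball of the previous section that occur between the times \<open>a\<close> and \<open>b\<close> are used.
  During that time the integrand is close to the fixed vector \<open>w\<close>.
\<close>

lemma char_stochastic_sum_bound:
  fixes c :: "nat \<Rightarrow> real ^ 'd"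
  assumes L: "\<And>t. 0 \<le> t \<Longrightarrow> L t \<in> borel_measurable M"
    and dec: "\<And>t. 0 \<le> t \<Longrightarrow> \<exists>J. is_compensated_small_jumps M \<nu> N t J \<and> (AE \<omega> in M. L t \<omega> = J \<omega> + large_jumps N t \<omega>)"
    and t: "0 < t" and n: "0 < n" and h: "h = t / real n"
    and a: "0 \<le> a" "a \<le> b" "b \<le> t"
    and w: "1 \<le> norm w"
    and near: "\<And>i s. i < n \<Longrightarrow> a < s \<Longrightarrow> s \<le> b \<Longrightarrow> \<bar>s - real i * h\<bar> \<le> h \<Longrightarrow> norm (c i - w) \<le> norm w / 8"
    and ball: "ennreal k \<le> emeasure \<nu> (ball (w /\<^sub>R (2 * (norm w)\<^sup>2)) (1 / (4 * norm w)))" and k: "0 \<le> k"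
  shows "cmod (\<integral>\<omega>. iexp (c 0 \<bullet> L 0 \<omega> + (\<Sum>i<n. c i \<bullet> (L (real (Suc i) * h) \<omega> - L (real i * h) \<omega>))) \<partial>M)
    \<le> exp (- ((1 - cos (1 / 8)) * (k * (b - a))))"
proof -
  (* set to zero at n, so that summation by parts leaves no boundary term *)
  define c' where "c' i = (if i < n then c i else 0)" for i
  define V where "V = ball (w /\<^sub>R (2 * (norm w)\<^sup>2)) (1 / (4 * norm w))"
  define E where "E = V \<times> {a<..b}"
  have hp: "0 < h" using h t n by simp
  have hn: "real n * h = t" using h n by simp
  have V0: "1 / (8 * norm w) < norm z" "norm z \<le> 1" if "z \<in> V" for z
    using phase_on_ball[OF w, of z w] that by (auto simp: V_def)
  have Vs: "V \<in> sets borel" "0 \<notin> V" using V0(1)[of 0] w by (auto simp: V_def)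
  have Es: "E \<in> sets \<mu>"
    unfolding E_def by (rule sets_jump_intensity_Times[OF levy Vs a(1)])
  have Esub: "E \<subseteq> slab (1 / (8 * norm w)) 1 t"
    using V0 a by (auto simp: E_def slab_def)
  have d0: "0 < 1 / (8 * norm w)" "1 / (8 * norm w) \<le> 1" using w by (auto simp: divide_le_eq)
  have eq: "c 0 \<bullet> L 0 \<omega> + (\<Sum>i<n. c i \<bullet> (L (real (Suc i) * h) \<omega> - L (real i * h) \<omega>)) =
      (\<Sum>j=1..n. (c' (j - 1) - c' j) \<bullet> L (real j * h) \<omega>)" for \<omega>
    using abel_summation_inner[of c' "\<lambda>i. L (real i * h) \<omega>" n] n by (simp add: c'_def)
  have phase: "1 - cos (1 / 8) \<le> 1 - cos (\<Sum>j=1..n. indicator {0<..real j * h} s * ((c' (j - 1) - c' j) \<bullet> z))"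
    if "(z, s) \<in> E" for z s
  proof -
    have z: "z \<in> V" and s: "a < s" "s \<le> b" using that by (auto simp: E_def)
    define m where "m = nat (\<lceil>s / h\<rceil> - 1)"
    have p: "0 < s / h" using s a hp by simp
    then have "1 \<le> \<lceil>s / h\<rceil>" by simp
    then have "real m = of_int \<lceil>s / h\<rceil> - 1" by (simp add: m_def)
    then have "real m < s / h" "s / h \<le> real (Suc m)" using ceiling_correct[of "s / h"] by auto
    then have m: "real m * h < s" "s \<le> real (Suc m) * h" using hp by (simp_all add: field_simps)
    have "real m * h < real n * h" using m(1) s a unfolding hn by linarith
    then have mn: "m < n" using hp by (simp add: mult_less_cancel_right)
    have "(\<Sum>j=1..n. indicator {0<..real j * h} s * ((c' (j - 1) - c' j) \<bullet> z)) = c' m \<bullet> z"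
      using mn by (intro step_function_telescope[OF hp m]) (auto simp: c'_def)
    moreover have "norm (c m - w) \<le> norm w / 8"
      using m by (intro near[OF mn s]) (simp add: algebra_simps)
    ultimately show ?thesis
      using phase_on_ball(3)[OF w z[unfolded V_def]] mn by (simp add: c'_def)
  qed
  have "cmod (\<integral>\<omega>. iexp (\<Sum>j=1..n. (c' (j - 1) - c' j) \<bullet> L (real j * h) \<omega>) \<partial>M) \<le>
      exp (- ((1 - cos (1 / 8)) * measure \<mu> E))"
  proof (rule char_linear_combination_levy[OF L dec finite_atLeastAtMost _ less_imp_le[OF t] d0 Es Esub phase])
    fix j assume "j \<in> {1..n}"
    then have "real j * h \<le> real n * h" using hp by (intro mult_right_mono) auto
    then show "0 \<le> real j * h \<and> real j * h \<le> t" using hp unfolding hn by simp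
  qed
  also have "\<dots> \<le> exp (- ((1 - cos (1 / 8)) * (k * (b - a))))"
  proof -
    have "ennreal (k * (b - a)) = ennreal k * ennreal (b - a)" using k a by (simp add: ennreal_mult)
    also have "\<dots> \<le> emeasure \<nu> V * ennreal (b - a)"
      using ball by (intro mult_right_mono) (auto simp: V_def)
    also have "\<dots> = emeasure \<mu> E"
      unfolding E_def by (rule emeasure_jump_intensity_Times[OF levy Vs a(1,2), symmetric])
    finally have le: "ennreal (k * (b - a)) \<le> emeasure \<mu> E" .
    have "emeasure \<mu> E \<le> emeasure \<mu> (slab (1 / (8 * norm w)) 1 t)"
      using d0 by (intro emeasure_mono Esub slab_sets_mu) auto
    also have "\<dots> < \<infinity>" using d0 t by (intro emeasure_slab_finite levy) auto
    finally have "emeasure \<mu> E = ennreal (measure \<mu> E)"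
      by (intro emeasure_eq_ennreal_measure) auto
    then have "k * (b - a) \<le> measure \<mu> E"
      using le by (simp add: ennreal_le_iff)
    then show ?thesis by (simp add: mult_left_mono)
  qed
  finally show ?thesis unfolding eq .
qed

end

context levy_noise
begin

text \<open>
  For a frequency \<open>\<xi>\<close>, observability provides a time at which \<open>w = B\<^sup>T q\<close> has norm at least
  \<open>\<kappa> norm \<xi>\<close>, and a Lipschitz estimate keeps \<open>B\<^sup>T q\<close> within \<open>norm w / 8\<close> of \<open>w\<close> during a time interval
  whose length \<open>\<tau> / 2\<close> does not depend on \<open>\<xi>\<close>.  This yields a bound for the Riemann sums that is
  the same for all fine meshes, hence a bound for the solution.
\<close>

lemma char_solution_bound:
  fixes A B :: "real ^ 'd ^ 'd"
  assumes L: "\<And>t. 0 \<le> t \<Longrightarrow> L t \<in> borel_measurable M"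
    and dec: "\<And>t. 0 \<le> t \<Longrightarrow> \<exists>J. is_compensated_small_jumps M \<nu> N t J \<and> (AE \<omega> in M. L t \<omega> = J \<omega> + large_jumps N t \<omega>)"
    and sol: "solves_linear_sde M A B L x X"
    and t: "0 < t" and \<kappa>: "0 < \<kappa>"
    and obs: "\<And>e. norm e = 1 \<Longrightarrow> \<exists>r\<in>{0..t}. \<kappa> \<le> norm (transpose B *v linear_flow ((*v) (transpose A)) r e)"
    and \<alpha>: "0 < \<alpha>" and k: "0 < k"
    and ball: "\<And>w. 1 \<le> norm w \<Longrightarrow>
      ennreal (k * norm w powr \<alpha>) \<le> emeasure \<nu> (ball (w /\<^sub>R (2 * (norm w)\<^sup>2)) (1 / (4 * norm w)))"
  shows "\<exists>c>0. \<forall>\<xi>. 1 / \<kappa> \<le> norm \<xi> \<longrightarrow> cmod (\<integral>\<omega>. iexp (\<xi> \<bullet> X t \<omega>) \<partial>M) \<le> exp (- (c * norm \<xi> powr \<alpha>))"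
proof -
  define T where "T = (*v) (transpose A)"
  define P where "P = (*v) (transpose B)"
  have T: "bounded_linear T" and P: "bounded_linear P" by (auto simp: T_def P_def)
  define \<Lambda> where "\<Lambda> = onorm P * (3 * (exp (onorm T * t) * onorm T)) + 1"
  have \<Lambda>: "0 < \<Lambda>"
    unfolding \<Lambda>_def by (intro add_nonneg_pos mult_nonneg_nonneg onorm_pos_le T P) auto
  have lip: "norm (P (linear_flow T a \<xi>) - P (linear_flow T b \<xi>)) \<le> \<Lambda> * norm \<xi> * \<bar>a - b\<bar>"
    if "a \<in> {0..t}" "b \<in> {0..t}" for a b \<xi>
  proof -
    have "norm (P (linear_flow T a \<xi>) - P (linear_flow T b \<xi>)) = norm (P (linear_flow T a \<xi> - linear_flow T b \<xi>))"
      by (simp add: linear_diff[OF bounded_linear.linear[OF P]])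
    also have "\<dots> \<le> onorm P * norm (linear_flow T a \<xi> - linear_flow T b \<xi>)" by (rule onorm[OF P])
    also have "\<dots> \<le> onorm P * (3 * (exp (onorm T * t) * onorm T * norm \<xi>) * \<bar>a - b\<bar>)"
      using that by (intro mult_left_mono onorm_pos_le P linear_flow_lipschitz T) auto
    also have "\<dots> = (onorm P * (3 * (exp (onorm T * t) * onorm T))) * (norm \<xi> * \<bar>a - b\<bar>)"
      by (simp only: mult_ac)
    also have "\<dots> \<le> \<Lambda> * (norm \<xi> * \<bar>a - b\<bar>)"
      by (intro mult_right_mono) (auto simp: \<Lambda>_def)
    finally show ?thesis by (simp only: mult_ac)
  qed
  (* chosen such that Lambda * tau <= kappa / 8 *)
  define \<tau> where "\<tau> = min t (\<kappa> / (8 * \<Lambda>))"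
  have \<tau>: "0 < \<tau>" "\<tau> \<le> t" using t \<kappa> \<Lambda> by (auto simp: \<tau>_def)
  have \<Lambda>\<tau>: "\<Lambda> * \<tau> \<le> \<kappa> / 8"
  proof -
    have "\<Lambda> * \<tau> \<le> \<Lambda> * (\<kappa> / (8 * \<Lambda>))" using \<Lambda> by (intro mult_left_mono) (auto simp: \<tau>_def)
    then show ?thesis using \<Lambda> by simp
  qed
  define c where "c = (1 - cos (1 / 8)) * (k * \<kappa> powr \<alpha> * (\<tau> / 2))"
  have cos1: "cos (1 / 8 :: real) < 1"
    using cos_monotone_0_pi[of 0 "1 / 8"] pi_ge_two by simp
  have c: "0 < c" unfolding c_def using cos1 k \<kappa> \<tau> by (intro mult_pos_pos) auto
  have main: "cmod (\<integral>\<omega>. iexp (\<xi> \<bullet> X t \<omega>) \<partial>M) \<le> exp (- (c * norm \<xi> powr \<alpha>))" if \<xi>: "1 / \<kappa> \<le> norm \<xi>" for \<xi>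
  proof -
    have \<xi>0: "0 < norm \<xi>" using \<xi> \<kappa> by (auto intro: less_le_trans[OF _ \<xi>])
    (* the adjoint flow that ends in xi *)
    define q where "q s = linear_flow T (t - s) \<xi>" for s
    obtain r0 where r0: "r0 \<in> {0..t}" and kr: "\<kappa> \<le> norm (P (linear_flow T r0 (\<xi> /\<^sub>R norm \<xi>)))"
      using obs[of "\<xi> /\<^sub>R norm \<xi>"] \<xi>0 unfolding T_def P_def by auto
    define s0 where "s0 = t - r0"
    have s0: "0 \<le> s0" "s0 \<le> t" using r0 by (auto simp: s0_def)
    define w where "w = P (q s0)"
    have nw: "\<kappa> * norm \<xi> \<le> norm w"
    proof -
      have "P (linear_flow T r0 (\<xi> /\<^sub>R norm \<xi>)) = w /\<^sub>R norm \<xi>"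
        by (simp add: w_def q_def s0_def linear_scale[OF linear_linear_flow[OF T]] linear_scale[OF bounded_linear.linear[OF P]])
      then have "\<kappa> \<le> norm w / norm \<xi>" using kr by (simp add: divide_inverse mult.commute)
      then show ?thesis using \<xi>0 by (simp add: pos_le_divide_eq)
    qed
    have w1: "1 \<le> norm w" using nw \<xi> \<kappa> by (simp add: pos_divide_le_eq mult.commute)
    (* since tau <= t, the interval fits into [0, t] on one of the two sides of s0 *)
    obtain a where a: "0 \<le> a" "a + \<tau> / 2 \<le> t" "\<And>s. a < s \<Longrightarrow> s \<le> a + \<tau> / 2 \<Longrightarrow> \<bar>s - s0\<bar> \<le> \<tau> / 2"
    proof (cases "\<tau> / 2 \<le> s0")
      case True
      show ?thesis by (rule that[of "s0 - \<tau> / 2"]) (use True s0 in auto)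
    next
      case False
      show ?thesis by (rule that[of s0]) (use False s0 \<tau> in auto)
    qed
    define h where "h n = t / real (Suc n)" for n
    (* the Riemann sums of the stochastic integral *)
    define W where "W n \<omega> = P (q 0) \<bullet> L 0 \<omega> +
      (\<Sum>i<Suc n. P (q (real i * h n)) \<bullet> (L (real (Suc i) * h n) \<omega> - L (real i * h n) \<omega>))" for n \<omega>
    have hp: "0 < h n" for n using t by (simp add: h_def del: of_nat_Suc)
    have h0: "h \<longlonglongrightarrow> 0"
      using tendsto_mult[OF tendsto_const[of t] LIMSEQ_inverse_real_of_nat] by (simp add: h_def[abs_def] divide_inverse)
    have Wm: "W n \<in> borel_measurable M" for n
      unfolding W_def[abs_def] using hp[of n]
      by (intro borel_measurable_add borel_measurable_sum borel_measurable_inner borel_measurable_const borel_measurable_diff L)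
        (auto intro!: mult_nonneg_nonneg less_imp_le)
    have Wbound: "cmod (\<integral>\<omega>. iexp (q 0 \<bullet> x + W n \<omega>) \<partial>M) \<le> exp (- (c * norm \<xi> powr \<alpha>))" if hn: "h n \<le> \<tau> / 2" for n
    proof -
      have hn': "real (Suc n) * h n = t" by (simp add: h_def del: of_nat_Suc)
      have "(\<integral>\<omega>. iexp (q 0 \<bullet> x + W n \<omega>) \<partial>M) = (\<integral>\<omega>. iexp (q 0 \<bullet> x) * iexp (W n \<omega>) \<partial>M)"
        by (simp only: of_real_add distrib_left exp_add)
      also have "\<dots> = iexp (q 0 \<bullet> x) * (\<integral>\<omega>. iexp (W n \<omega>) \<partial>M)" by (rule integral_mult_right_zero)
      also have "cmod \<dots> = cmod (\<integral>\<omega>. iexp (W n \<omega>) \<partial>M)" by (simp only: norm_mult norm_exp_i_times mult_1)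
      also have "\<dots> \<le> exp (- ((1 - cos (1 / 8)) * (k * norm w powr \<alpha> * (a + \<tau> / 2 - a))))"
        unfolding W_def
      proof (rule char_stochastic_sum_bound[where c="\<lambda>i. P (q (real i * h n))" and t=t and w=w, simplified of_nat_0 mult_zero_left, OF L dec t])
        show "h n = t / real (Suc n)" by (simp only: h_def)
        show "ennreal (k * norm w powr \<alpha>) \<le> emeasure \<nu> (ball (w /\<^sub>R (2 * (norm w)\<^sup>2)) (1 / (4 * norm w)))"
          by (rule ball[OF w1])
        fix i s assume i: "i < Suc n" and s: "a < s" "s \<le> a + \<tau> / 2" and d: "\<bar>s - real i * h n\<bar> \<le> h n"
        have "real i * h n \<le> real (Suc n) * h n" using i hp[of n] by (intro mult_right_mono) auto
        then have ih: "0 \<le> real i * h n" "real i * h n \<le> t" using hp[of n] unfolding hn' by auto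
        have "norm (P (q (real i * h n)) - w) \<le> \<Lambda> * norm \<xi> * \<bar>(t - real i * h n) - (t - s0)\<bar>"
          unfolding w_def q_def using ih s0 by (intro lip) auto
        also have "\<dots> \<le> \<Lambda> * norm \<xi> * \<tau>"
        proof (intro mult_left_mono)
          show "\<bar>(t - real i * h n) - (t - s0)\<bar> \<le> \<tau>" using a(3)[OF s] d hn by linarith
        qed (use \<Lambda> in auto)
        also have "\<dots> = (\<Lambda> * \<tau>) * norm \<xi>" by (simp only: mult_ac)
        also have "\<dots> \<le> (\<kappa> / 8) * norm \<xi>" by (intro mult_right_mono \<Lambda>\<tau>) simp
        also have "\<dots> \<le> norm w / 8" using nw by simp
        finally show "norm (P (q (real i * h n)) - w) \<le> norm w / 8" .
      qed (use a \<tau> w1 k in auto)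
      also have "\<dots> \<le> exp (- (c * norm \<xi> powr \<alpha>))"
      proof -
        have "\<kappa> powr \<alpha> * norm \<xi> powr \<alpha> = (\<kappa> * norm \<xi>) powr \<alpha>" using \<kappa> by (simp add: powr_mult)
        also have "\<dots> \<le> norm w powr \<alpha>" using nw \<alpha> \<kappa> by (intro powr_mono2) auto
        finally have "((1 - cos (1 / 8)) * k * (\<tau> / 2)) * (\<kappa> powr \<alpha> * norm \<xi> powr \<alpha>) \<le>
            ((1 - cos (1 / 8)) * k * (\<tau> / 2)) * norm w powr \<alpha>"
          using cos1 k \<tau> by (intro mult_left_mono) auto
        then show ?thesis by (simp add: c_def mult_ac)
      qed
      finally show ?thesis .
    qed
    have Xm: "X t \<in> borel_measurable M" using sol t by (simp add: solves_linear_sde_def)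
    obtain C where C: "\<And>a b. 0 \<le> a \<Longrightarrow> 0 \<le> b \<Longrightarrow> a \<le> t \<Longrightarrow> b \<le> t \<Longrightarrow>
        norm (linear_flow T b \<xi> - linear_flow T a \<xi> - (b - a) *\<^sub>R linear_flow T a (T \<xi>)) \<le> C * (b - a)\<^sup>2"
      using linear_flow_taylor[OF T less_imp_le[OF t], of \<xi>] by blast
    have "AE \<omega> in M. (\<lambda>n. q 0 \<bullet> x + W n \<omega>) \<longlonglongrightarrow> \<xi> \<bullet> X t \<omega>"
    proof -
      have "AE \<omega> in M. cadlag (\<lambda>t. X t \<omega>) \<and> (\<forall>t\<ge>0. (\<lambda>s. A *v X s \<omega>) integrable_on {0..t} \<and>
           X t \<omega> = x + integral {0..t} (\<lambda>s. A *v X s \<omega>) + B *v L t \<omega>)"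
        using sol by (simp add: solves_linear_sde_def)
      then show ?thesis
      proof eventually_elim
        case (elim \<omega>)
        have "(\<lambda>n. q 0 \<bullet> x + (transpose B *v q 0) \<bullet> L 0 \<omega> +
          (\<Sum>i<Suc n. (transpose B *v q (real i * (t / real (Suc n)))) \<bullet>
            (L (real (Suc i) * (t / real (Suc n))) \<omega> - L (real i * (t / real (Suc n))) \<omega>))) \<longlonglongrightarrow> q t \<bullet> X t \<omega>"
        proof (rule linear_ode_discretization[OF t, where X="\<lambda>t. X t \<omega>" and L="\<lambda>t. L t \<omega>" and A=A and C=C and Q="exp (onorm T * t) * norm \<xi>"])
          fix a b assume ab: "0 \<le> a" "a \<le> b" "b \<le> t"
          have "norm (linear_flow T (t - b) \<xi> - linear_flow T (t - a) \<xi> - ((t - b) - (t - a)) *\<^sub>R linear_flow T (t - a) (T \<xi>))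
              \<le> C * ((t - b) - (t - a))\<^sup>2"
            using ab by (intro C) auto
          moreover have "linear_flow T (t - a) (T \<xi>) = transpose A *v q a"
            unfolding linear_flow_commute[OF T, symmetric] q_def by (simp only: T_def)
          moreover have "(t - b) - (t - a) = - (b - a)" by simp
          ultimately show "norm (q b - q a + (b - a) *\<^sub>R (transpose A *v q a)) \<le> C * (b - a)\<^sup>2"
            by (simp only: q_def scaleR_minus_left diff_minus_eq_add power2_minus)
        next
          fix s assume s: "s \<in> {0..t}"
          have "norm (q s) \<le> exp (onorm T * \<bar>t - s\<bar>) * norm \<xi>" unfolding q_def by (rule norm_linear_flow_le[OF T])
          also have "\<dots> \<le> exp (onorm T * t) * norm \<xi>"
            using s onorm_pos_le[OF T] by (intro mult_right_mono) (auto intro!: mult_left_mono)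
          finally show "norm (q s) \<le> exp (onorm T * t) * norm \<xi>" .
        qed (use elim in auto)
        moreover have "q t = \<xi>" by (simp add: q_def linear_flow_0[OF T])
        ultimately show ?case by (simp only: W_def h_def P_def add.assoc)
      qed
    qed
    then have "(\<lambda>n. \<integral>\<omega>. iexp (q 0 \<bullet> x + W n \<omega>) \<partial>M) \<longlonglongrightarrow> (\<integral>\<omega>. iexp (\<xi> \<bullet> X t \<omega>) \<partial>M)"
    proof (intro integral_dominated_convergence[where w="\<lambda>_. 1"], goal_cases)
      case 1 then show ?case using Xm by measurable
    next
      case (2 i) then show ?case using Wm by measurable
    next
      case 4 then show ?case by eventually_elim (intro tendsto_intros)
    qed auto
    then have "(\<lambda>n. cmod (\<integral>\<omega>. iexp (q 0 \<bullet> x + W n \<omega>) \<partial>M)) \<longlonglongrightarrow> cmod (\<integral>\<omega>. iexp (\<xi> \<bullet> X t \<omega>) \<partial>M)"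
      by (rule tendsto_norm)
    moreover have "eventually (\<lambda>n. h n < \<tau> / 2) sequentially"
      using \<tau> by (intro order_tendstoD(2)[OF h0]) auto
    then have "eventually (\<lambda>n. cmod (\<integral>\<omega>. iexp (q 0 \<bullet> x + W n \<omega>) \<partial>M) \<le> exp (- (c * norm \<xi> powr \<alpha>))) sequentially"
      by eventually_elim (intro Wbound less_imp_le)
    ultimately show ?thesis
      by (intro tendsto_upperbound) auto
  qed
  show ?thesis by (rule exI[of _ c], rule conjI[OF c], intro allI impI main)
qed

end

theorem theorem2p1:
  fixes A B :: "real ^ 'd ^ 'd"
    and \<nu> :: "(real ^ 'd) measure"
    and M :: "'w measure"
    and L :: "real \<Rightarrow> 'w \<Rightarrow> real ^ 'd"
    and X :: "real ^ 'd \<Rightarrow> real \<Rightarrow> 'w \<Rightarrow> real ^ 'd"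
  assumes "A \<noteq> 0"
    and "pure_jump_levy_process M \<nu> L"
    and "assumption_N \<nu>"
    and "\<exists>n. concat_rank n (pow_mult A B) = CARD('d)"
    and "\<And>x. solves_linear_sde M A B L x (X x)"
  shows "\<forall>t>0. \<forall>x. has_smooth_density (distr M borel (X x t))"
proof (intro allI impI)
  fix t :: real and x :: "real ^ 'd"
  assume t: "0 < t"
  note levy = assms(2)[unfolded pure_jump_levy_process_def]
  interpret prob_space M using levy by blast
  have lm: "levy_measure \<nu>" and L: "\<And>t. 0 \<le> t \<Longrightarrow> L t \<in> borel_measurable M"
    using levy by auto
  obtain N where N: "poisson_random_measure M (jump_intensity \<nu>) N"
    and dec: "\<And>t. 0 \<le> t \<Longrightarrow> \<exists>J. is_compensated_small_jumps M \<nu> N t J \<and> (AE \<omega> in M. L t \<omega> = J \<omega> + large_jumps N t \<omega>)"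
    using levy by blast
  interpret levy_noise M \<nu> N
    by unfold_locales (fact N lm)+
  obtain n where rank: "concat_rank n (pow_mult A B) = CARD('d)" using assms(4) by blast
  obtain \<kappa> where \<kappa>: "0 < \<kappa>"
    and obs: "\<And>e. norm e = 1 \<Longrightarrow> \<exists>r\<in>{0..t}. \<kappa> \<le> norm (transpose B *v linear_flow ((*v) (transpose A)) r e)"
    using linear_flow_observable[OF matrix_vector_mul_bounded_linear[of "transpose A"]
        matrix_vector_mul_bounded_linear[of "transpose B"] t kalman_observable[OF rank]] by blast
  obtain \<alpha> k where \<alpha>: "0 < \<alpha>" and k: "0 < k"
    and ball: "\<And>w. 1 \<le> norm w \<Longrightarrow>
      ennreal (k * norm w powr \<alpha>) \<le> emeasure \<nu> (ball (w /\<^sub>R (2 * (norm w)\<^sup>2)) (1 / (4 * norm w)))"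
    using assumption_N_ball_lower_bound[OF assms(3)] by blast
  obtain c where c: "0 < c"
    and bound: "\<And>\<xi>. 1 / \<kappa> \<le> norm \<xi> \<Longrightarrow> cmod (\<integral>\<omega>. iexp (\<xi> \<bullet> X x t \<omega>) \<partial>M) \<le> exp (- (c * norm \<xi> powr \<alpha>))"
    using char_solution_bound[OF L dec assms(5)[of x] t \<kappa> obs \<alpha> k ball] by blast
  have Xm[measurable]: "X x t \<in> borel_measurable M" using assms(5)[of x] t by (simp add: solves_linear_sde_def)
  show "has_smooth_density (distr M borel (X x t))"
  proof (rule smooth_density_of_rapidly_decreasing_char)
    show "prob_space (distr M borel (X x t))" by (rule prob_space_distr) simp
    show "sets (distr M borel (X x t)) = sets borel" by simp
    fix m :: nat
    obtain K where K: "\<And>r::real. 0 \<le> r \<Longrightarrow> r ^ m * exp (- (c * r powr \<alpha>)) \<le> K"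
      using power_exp_powr_bounded[OF c \<alpha>, of m] by blast
    have "norm \<xi> ^ m * cmod (\<integral>y. iexp (\<xi> \<bullet> y) \<partial>distr M borel (X x t)) \<le> max K ((1 / \<kappa>) ^ m)" for \<xi>
    proof -
      have eq: "(\<integral>y. iexp (\<xi> \<bullet> y) \<partial>distr M borel (X x t)) = (\<integral>\<omega>. iexp (\<xi> \<bullet> X x t \<omega>) \<partial>M)"
        by (rule integral_distr) measurable
      show ?thesis
      proof (cases "1 / \<kappa> \<le> norm \<xi>")
        case True
        have "norm \<xi> ^ m * cmod (\<integral>\<omega>. iexp (\<xi> \<bullet> X x t \<omega>) \<partial>M) \<le> norm \<xi> ^ m * exp (- (c * norm \<xi> powr \<alpha>))"
          by (intro mult_left_mono bound True) simp
        also have "\<dots> \<le> K" by (rule K) simp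
        finally show ?thesis unfolding eq by simp
      next
        case False
        have "cmod (\<integral>\<omega>. iexp (\<xi> \<bullet> X x t \<omega>) \<partial>M) \<le> (\<integral>\<omega>. cmod (iexp (\<xi> \<bullet> X x t \<omega>)) \<partial>M)"
          by (rule integral_norm_bound)
        also have "\<dots> = 1" by (simp add: prob_space)
        finally have "norm \<xi> ^ m * cmod (\<integral>\<omega>. iexp (\<xi> \<bullet> X x t \<omega>) \<partial>M) \<le> (1 / \<kappa>) ^ m * 1"
          using False \<kappa> by (intro mult_mono power_mono) auto
        then show ?thesis unfolding eq by simp
      qed
    qed
    then show "\<exists>K. \<forall>\<xi>. norm \<xi> ^ m * cmod (\<integral>y. iexp (\<xi> \<bullet> y) \<partial>distr M borel (X x t)) \<le> K" by blast
  qed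
qed

end
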